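(* Let $G$ be a connected simple graph with a perfect matching. Then $G[K_4]$ has a face-simple orientable quadrangular embedding. Moreover, if $G$ also has a cycle, then $G[K_4]$ also has a face-simple nonorientable quadrangular embedding.
   Context: Graphs are finite. The composition (lexicographic product) $G[H]$ of simple graphs $G$ and $H$ has vertex set $V(G)\times V(H)$, with $(v_1,w_1)$ and $(v_2,w_2)$ adjacent if and only if either $v_1v_2\in E(G)$, or $v_1=v_2$ and $w_1w_2\in E(H)$. $K_4$ is the complete graph on 4 vertices. Embeddings are in connected compact surfaces without boundary and are cellular (every face is homeomorphic to an open disk). An embedding is quadrangular if every face is bounded by a 4-cycle, and face-simple if every two distinct faces share at most one boundary edge. An embedding is orientable (nonorientable) if its surface is. *)

theory Defs
  imports "HOL-Analysis.Analysis" "HOL-Homology.Homology"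
begin

section \<open>Graphs\<close>

text \<open>A graph is a pair of a vertex set and a set of edges, an edge being the set of its two ends.\<close>

type_synonym 'v graph = "'v set \<times> 'v set set"

abbreviation verts :: "'v graph \<Rightarrow> 'v set" where "verts \<equiv> fst"

abbreviation edges :: "'v graph \<Rightarrow> 'v set set" where "edges \<equiv> snd"

definition simple_graph :: "'v graph \<Rightarrow> bool" where
  "simple_graph G \<longleftrightarrow> finite (verts G) \<and>
     (\<forall>e\<in>edges G. \<exists>u\<in>verts G. \<exists>v\<in>verts G. u \<noteq> v \<and> e = {u, v})"

text \<open>The graph without vertices is not regarded as connected.\<close>

definition connected_graph :: "'v graph \<Rightarrow> bool" where
  "connected_graph G \<longleftrightarrow> verts G \<noteq> {} \<and>
     (\<forall>u\<in>verts G. \<forall>v\<in>verts G. (u, v) \<in> {(x, y). {x, y} \<in> edges G}\<^sup>*)"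

definition perfect_matching :: "'v graph \<Rightarrow> 'v set set \<Rightarrow> bool" where
  "perfect_matching G M \<longleftrightarrow> M \<subseteq> edges G \<and> (\<forall>v\<in>verts G. \<exists>!e. e \<in> M \<and> v \<in> e)"

text \<open>A cycle is given by the list of its distinct vertices in cyclic order.\<close>

definition cycle_edges :: "'v list \<Rightarrow> 'v set set" where
  "cycle_edges vs = {{vs ! i, vs ! (Suc i mod length vs)} | i. i < length vs}"

definition cycle_in :: "'v graph \<Rightarrow> 'v list \<Rightarrow> bool" where
  "cycle_in G vs \<longleftrightarrow> length vs \<ge> 3 \<and> distinct vs \<and> cycle_edges vs \<subseteq> edges G"

definition lex_product :: "'v graph \<Rightarrow> 'w graph \<Rightarrow> ('v \<times> 'w) graph" where
  "lex_product G H =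
     (verts G \<times> verts H,
      {{(v1, w1), (v2, w2)} | v1 w1 v2 w2.
         v1 \<in> verts G \<and> v2 \<in> verts G \<and> w1 \<in> verts H \<and> w2 \<in> verts H \<and>
         ({v1, v2} \<in> edges G \<or> v1 = v2 \<and> {w1, w2} \<in> edges H)})"

definition complete_graph :: "nat \<Rightarrow> nat graph" where
  "complete_graph n = ({..<n}, {{i, j} | i j. i < n \<and> j < n \<and> i \<noteq> j})"

section \<open>Surfaces\<close>

abbreviation open_disk :: "complex topology" where
  "open_disk \<equiv> top_of_set (ball 0 1)"

abbreviation closed_disk :: "complex topology" where
  "closed_disk \<equiv> top_of_set (cball 0 1)"

text \<open>Second countability is automatic here, by compactness.\<close>

definition closed_surface :: "'p topology \<Rightarrow> bool" where
  "closed_surface X \<longleftrightarrow> topspace X \<noteq> {} \<and> connected_space X \<and> compact_space X \<and> Hausdorff_space X \<and>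
     (\<forall>x\<in>topspace X. \<exists>U. openin X U \<and> x \<in> U \<and>
        subtopology X U homeomorphic_space open_disk)"

text \<open>
  The usual homological notion of orientation of a 2-manifold \<open>X\<close>: a choice of a generator
  \<open>\<mu> x\<close> of the infinite cyclic group \<open>H\<^sub>2(X, X - {x})\<close> for each point \<open>x\<close> that is locally
  consistent, in that near every point the \<open>\<mu> y\<close> are the images of a single class of
  \<open>H\<^sub>2(X, X - U)\<close> under the maps induced by inclusion.
\<close>

definition surface_orientation :: "'p topology \<Rightarrow> ('p \<Rightarrow> 'p chain set) \<Rightarrow> bool" where
  "surface_orientation X \<mu> \<longleftrightarrow>
     (\<forall>x\<in>topspace X.
        \<mu> x \<in> carrier (relative_homology_group 2 X (topspace X - {x})) \<and>
        subgroup_generated (relative_homology_group 2 X (topspace X - {x})) {\<mu> x} =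
          relative_homology_group 2 X (topspace X - {x})) \<and>
     (\<forall>x\<in>topspace X. \<exists>U m. openin X U \<and> x \<in> U \<and>
        m \<in> carrier (relative_homology_group 2 X (topspace X - U)) \<and>
        (\<forall>y\<in>U. hom_induced 2 X (topspace X - U) X (topspace X - {y}) id m = \<mu> y))"

definition orientable :: "'p topology \<Rightarrow> bool" where
  "orientable X \<longleftrightarrow> (\<exists>\<mu>. surface_orientation X \<mu>)"

section \<open>Embeddings\<close>

text \<open>
  A drawing of \<open>G\<close> in the space \<open>X\<close> places each vertex \<open>v\<close> at the point \<open>p v\<close> and each edge
  \<open>e\<close> along the simple arc \<open>a e\<close>, parametrised by the unit interval.
\<close>

definition embedding :: "'v graph \<Rightarrow> 'p topology \<Rightarrow> ('v \<Rightarrow> 'p) \<Rightarrow> ('v set \<Rightarrow> real \<Rightarrow> 'p) \<Rightarrow> bool" where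
  "embedding G X p a \<longleftrightarrow>
     p ` verts G \<subseteq> topspace X \<and> inj_on p (verts G) \<and>
     (\<forall>e\<in>edges G. pathin X (a e) \<and> inj_on (a e) {0..1} \<and> {a e 0, a e 1} = p ` e \<and>
        a e ` {0<..<1} \<inter> p ` verts G = {}) \<and>
     (\<forall>e\<in>edges G. \<forall>f\<in>edges G. e \<noteq> f \<longrightarrow> a e ` {0<..<1} \<inter> a f ` {0<..<1} = {})"

definition faces :: "'v graph \<Rightarrow> 'p topology \<Rightarrow> ('v \<Rightarrow> 'p) \<Rightarrow> ('v set \<Rightarrow> real \<Rightarrow> 'p) \<Rightarrow> 'p set set" where
  "faces G X p a =
     connected_components_of
       (subtopology X (topspace X - (p ` verts G \<union> (\<Union>e\<in>edges G. a e ` {0..1}))))"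

definition cellular_embedding ::
    "'v graph \<Rightarrow> 'p topology \<Rightarrow> ('v \<Rightarrow> 'p) \<Rightarrow> ('v set \<Rightarrow> real \<Rightarrow> 'p) \<Rightarrow> bool" where
  "cellular_embedding G X p a \<longleftrightarrow> closed_surface X \<and> embedding G X p a \<and>
     (\<forall>F\<in>faces G X p a. subtopology X F homeomorphic_space open_disk)"

text \<open>
  A face is bounded by a cycle if its boundary walk is that cycle, traversed once.  Asking only
  that the frontier of the face be the image of the cycle would also admit walks running around
  the cycle twice, as for a noncontractible cycle in the projective plane; so the
  face together with the cycle has to form a closed disk.
\<close>

definition face_bounded_by ::
    "'p topology \<Rightarrow> ('v set \<Rightarrow> real \<Rightarrow> 'p) \<Rightarrow> 'p set \<Rightarrow> 'v list \<Rightarrow> bool" where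
  "face_bounded_by X a F vs \<longleftrightarrow>
     (\<exists>h. homeomorphic_map closed_disk (subtopology X (X closure_of F)) h \<and>
          h ` ball 0 1 = F \<and> h ` sphere 0 1 = (\<Union>e\<in>cycle_edges vs. a e ` {0..1}))"

definition quadrangular ::
    "'v graph \<Rightarrow> 'p topology \<Rightarrow> ('v \<Rightarrow> 'p) \<Rightarrow> ('v set \<Rightarrow> real \<Rightarrow> 'p) \<Rightarrow> bool" where
  "quadrangular G X p a \<longleftrightarrow>
     (\<forall>F\<in>faces G X p a. \<exists>vs. cycle_in G vs \<and> length vs = 4 \<and> face_bounded_by X a F vs)"

definition boundary_edges ::
    "'v graph \<Rightarrow> 'p topology \<Rightarrow> ('v set \<Rightarrow> real \<Rightarrow> 'p) \<Rightarrow> 'p set \<Rightarrow> 'v set set" where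
  "boundary_edges G X a F = {e \<in> edges G. a e ` {0..1} \<subseteq> X frontier_of F}"

definition face_simple ::
    "'v graph \<Rightarrow> 'p topology \<Rightarrow> ('v \<Rightarrow> 'p) \<Rightarrow> ('v set \<Rightarrow> real \<Rightarrow> 'p) \<Rightarrow> bool" where
  "face_simple G X p a \<longleftrightarrow>
     (\<forall>F\<in>faces G X p a. \<forall>F'\<in>faces G X p a. F \<noteq> F' \<longrightarrow>
        (\<forall>e\<in>boundary_edges G X a F \<inter> boundary_edges G X a F'.
         \<forall>f\<in>boundary_edges G X a F \<inter> boundary_edges G X a F'. e = f))"

text \<open>
  An existential statement about surfaces has to fix a type for their points.  Every closed
  surface has the cardinality of the continuum, so up to homeomorphism all of them occur as
  topologies on subsets of any type of at least that size; the coordinate type of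
  \<^const>\<open>Euclidean_space\<close> is used.
\<close>

type_synonym point = "nat \<Rightarrow> real"

end

(*
  Combinatorial part.  In G[K4], blow up a perfect matching: the eight vertices over a matched edge span
  K8 and those over any other edge span K44 (plus edges inside the ends).  Each edge of G is given a fixed
  pattern of quadrilaterals, and the patterns around a vertex u of G are glued cyclically, along the
  two slits (u,0)-(u,1) and (u,2)-(u,3), by the quadrilaterals joining the ends of the patterns of
  consecutive neighbours of u.  The links of all vertices are then single cycles, any two quadrilaterals share
  at most one edge, and with the patterns chosen here all quadrilaterals are coherently oriented.
  Reflecting one pattern at one slit at a vertex of degree at least 2 (which exists as soon as G has a cycle)
  produces a closed chain of six quadrilaterals whose orientations cannot be made coherent.

  Topological part.  Such a system of 4-cycles is realised by the geometric realisation of its flag complex.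
  The star of each simplex is a cone over a cycle, hence a disk, which yields the charts and the closed faces.
  The local homology at a point is generated by the alternating sum of the triangles around it, so an
  orientation of the surface amounts to a choice of signs of the flags that is alternating under change of
  vertex, edge or face.
*)
theory Submission
  imports Defs
begin

subsection \<open>Straight-line homotopies\<close>

text \<open>Each vertex of G lies on exactly one matched edge, so the six edges inside the copy of
  K4 over it are supplied by exactly one pattern. A pattern comes from a closed oriented
  quadrangulation, of the torus by K44 or of the surface of genus 4 by K8, by removing the four
  quadrilaterals in \<open>slp\<close>. Each removed one, such as (u,0),(v,0),(u,1),(v,3), is
  imagined cut along the diagonal from (u,0) to (u,1), and its halves are joined to halves from the
  patterns of the next and the previous neighbour of u; hence the word slit. What the patterns must
  satisfy is finite and is decided by evaluation.

  The topological obstacle is that orientability is defined by homology. Every flag triangle lists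
  its vertices in the order vertex, edge, face, so two adjacent triangles have literally the same
  singular simplex as common side, with the same sign in both boundaries; in a cycle their
  coefficients must be opposite, which is why coherence takes the form of alternating signs. Classes
  are compared at barycentres only, and isomorphisms inside charts carry them to all other
  points.\<close>

definition seg :: "real \<Rightarrow> (nat \<Rightarrow> real) \<Rightarrow> (nat \<Rightarrow> real) \<Rightarrow> nat \<Rightarrow> real" where
  "seg t x y = (\<lambda>i. (1 - t) * x i + t * y i)"

lemma continuous_on_seg:
  assumes "continuous_on S t" "continuous_on S f" "continuous_on S g"
  shows "continuous_on S (\<lambda>z. seg (t z) (f z) (g z))"
proof -
  have "continuous_on S (\<lambda>z. f z i)" "continuous_on S (\<lambda>z. g z i)" for i
    using assms by (auto intro: continuous_on_product_then_coordinatewise)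
  then show ?thesis
    unfolding seg_def
    using assms(1) by (intro continuous_on_coordinatewise_then_product continuous_on_add continuous_on_mult continuous_on_diff continuous_on_const)
qed

lemma homotopic_with_seg:
  assumes f: "continuous_on A f" and g: "continuous_on A g"
    and B: "\<And>t x. t \<in> {0..1} \<Longrightarrow> x \<in> A \<Longrightarrow> seg t (f x) (g x) \<in> B"
    and P: "\<And>t. t \<in> {0..1} \<Longrightarrow> P (\<lambda>x. seg t (f x) (g x))"
  shows "homotopic_with P (top_of_set A) (top_of_set B) f g"
  unfolding homotopic_with_def
proof (intro exI conjI allI ballI)
  let ?h = "\<lambda>z. seg (fst z) (f (snd z)) (g (snd z))"
  have "continuous_on ({0..1} \<times> A) ?h"
    by (rule continuous_on_seg continuous_on_compose2[OF f] continuous_on_compose2[OF g]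
        | force intro: continuous_intros)+
  then show "continuous_map (prod_topology (top_of_set {0..1}) (top_of_set A)) (top_of_set B) ?h"
    unfolding prod_topology_subtopology_eu continuous_map_subtopology_eu continuous_map_in_subtopology continuous_map_iff_continuous
    using B by (intro conjI) auto
  show "\<And>t. t \<in> {0..1} \<Longrightarrow> P (\<lambda>x. ?h (t, x))"
    using P by simp
  show "?h (0, x) = f x" "?h (1, x) = g x" for x
    by (simp_all add: seg_def)
qed

lemma contractible_space_star:
  fixes a :: "nat \<Rightarrow> real"
  assumes "\<And>t x. t \<in> {0..1} \<Longrightarrow> x \<in> A \<Longrightarrow> seg t x a \<in> A"
  shows "contractible_space (top_of_set A)"
proof -
  have "homotopic_with (\<lambda>x. True) (top_of_set A) (top_of_set A) id (\<lambda>x. a)"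
    by (rule homotopic_with_seg) (simp_all add: assms)
  then show ?thesis
    unfolding contractible_space_def by blast
qed

subsection \<open>Infinite cyclic groups\<close>

text \<open>Freeness is part of the notion because signs of triangles are later recovered by
  comparing exponents of a generator.\<close>

definition infgen :: "('a, 'b) monoid_scheme \<Rightarrow> 'a \<Rightarrow> bool" where
  "infgen G g \<longleftrightarrow> g \<in> carrier G \<and> (\<forall>x\<in>carrier G. \<exists>k::int. x = g [^]\<^bsub>G\<^esub> k)
     \<and> (\<forall>k::int. g [^]\<^bsub>G\<^esub> k = \<one>\<^bsub>G\<^esub> \<longrightarrow> k = 0)"

lemma infgen_iso:
  assumes G: "group G" and H: "group H" and h: "h \<in> iso G H" and g: "g \<in> carrier G"
  shows "infgen H (h g) \<longleftrightarrow> infgen G g"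
proof -
  interpret group_hom G H h
    using assms by (auto simp: group_hom_def group_hom_axioms_def iso_def)
  have b: "bij_betw h (carrier G) (carrier H)"
    using h by (auto simp: iso_def)
  have pow: "h (g [^]\<^bsub>G\<^esub> (k::int)) = h g [^]\<^bsub>H\<^esub> k" for k
    using g by (simp add: hom_int_pow)
  have inj: "x = y" if "x \<in> carrier G" "y \<in> carrier G" "h x = h y" for x y
    using b that by (auto simp: bij_betw_def inj_on_def)
  have surj: "\<exists>x\<in>carrier G. y = h x" if "y \<in> carrier H" for y
    using b that by (auto simp: bij_betw_def)
  have 1: "(\<forall>x\<in>carrier H. \<exists>k::int. x = h g [^]\<^bsub>H\<^esub> k) \<longleftrightarrow> (\<forall>x\<in>carrier G. \<exists>k::int. x = g [^]\<^bsub>G\<^esub> k)"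
  proof safe
    fix x assume *: "\<forall>x\<in>carrier H. \<exists>k::int. x = h g [^]\<^bsub>H\<^esub> k" "x \<in> carrier G"
    then obtain k :: int where "h x = h g [^]\<^bsub>H\<^esub> k" by (meson hom_closed)
    then have "h x = h (g [^]\<^bsub>G\<^esub> k)" by (simp only: pow)
    then show "\<exists>k::int. x = g [^]\<^bsub>G\<^esub> k" using inj[OF *(2) G.int_pow_closed[OF g]] by blast
  next
    fix y assume *: "\<forall>x\<in>carrier G. \<exists>k::int. x = g [^]\<^bsub>G\<^esub> k" "y \<in> carrier H"
    then obtain x where x: "x \<in> carrier G" "y = h x" using surj by blast
    with * obtain k :: int where "x = g [^]\<^bsub>G\<^esub> k" by blast
    then show "\<exists>k::int. y = h g [^]\<^bsub>H\<^esub> k" using x pow by blast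
  qed
  have 2: "h g [^]\<^bsub>H\<^esub> (k::int) = \<one>\<^bsub>H\<^esub> \<longleftrightarrow> g [^]\<^bsub>G\<^esub> k = \<one>\<^bsub>G\<^esub>" for k
    using inj[OF G.int_pow_closed[OF g, of k] G.one_closed] pow[of k] by auto
  show ?thesis
    unfolding infgen_def using 1 2 g by simp
qed

subsection \<open>Classes of chains\<close>

lemma cls_carrier:
  "singular_relcycle p X S c \<Longrightarrow>
     homologous_rel_set p X S c \<in> carrier (relative_homology_group (int p) X S)"
  by (simp add: carrier_relative_homology_group)

text \<open>Passing to classes is the projection of relative cycles modulo relative boundaries, a
  homomorphism. The lemmas up to \<open>cls_cmul\<close> turn arithmetic of chains into arithmetic
  of classes.\<close>

lemma cls_add:
  assumes "singular_relcycle p X S a" "singular_relcycle p X S b"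
  shows "homologous_rel_set p X S (a + b) =
    homologous_rel_set p X S a \<otimes>\<^bsub>relative_homology_group (int p) X S\<^esub> homologous_rel_set p X S b"
proof -
  interpret N: normal "singular_relboundary_set p X S" "relcycle_group p X S"
    by (rule normal_subgroup_singular_relboundary_relcycle)
  have "(\<lambda>a. singular_relboundary_set p X S #>\<^bsub>relcycle_group p X S\<^esub> a)
      \<in> hom (relcycle_group p X S) (relcycle_group p X S Mod singular_relboundary_set p X S)"
    by (rule N.r_coset_hom_Mod)
  then show ?thesis
    using assms by (simp add: hom_def right_coset_singular_relboundary nontrivial_relative_homology_group)
qed

lemma cls_0: "homologous_rel_set p X S 0 = \<one>\<^bsub>relative_homology_group (int p) X S\<^esub>"
  by (simp add: homologous_rel_set_eq_relboundary)

lemma cls_eq_one_iff: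
  "homologous_rel_set p X S c = \<one>\<^bsub>relative_homology_group (int p) X S\<^esub> \<longleftrightarrow> singular_relboundary p X S c"
  by (simp add: homologous_rel_set_eq_relboundary)

lemma cls_minus:
  assumes "singular_relcycle p X S a"
  shows "homologous_rel_set p X S (- a) = inv\<^bsub>relative_homology_group (int p) X S\<^esub> homologous_rel_set p X S a"
proof -
  interpret group "relative_homology_group (int p) X S" by simp
  have "homologous_rel_set p X S (- a) \<otimes>\<^bsub>relative_homology_group (int p) X S\<^esub> homologous_rel_set p X S a
     = homologous_rel_set p X S (- a + a)"
    using assms by (intro cls_add[symmetric]) (auto simp: singular_relcycle_minus)
  then have "homologous_rel_set p X S (- a) \<otimes>\<^bsub>relative_homology_group (int p) X S\<^esub> homologous_rel_set p X S a
     = \<one>\<^bsub>relative_homology_group (int p) X S\<^esub>"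
    by (simp add: cls_0 del: one_relative_homology_group)
  then show ?thesis
    using assms by (intro inv_equality[symmetric]) (auto intro!: cls_carrier simp: singular_relcycle_minus)
qed

lemma cls_cmul:
  assumes "singular_relcycle p X S a"
  shows "homologous_rel_set p X S (frag_cmul k a) = homologous_rel_set p X S a [^]\<^bsub>relative_homology_group (int p) X S\<^esub> (k::int)"
proof -
  interpret group "relative_homology_group (int p) X S" by simp
  let ?c = "homologous_rel_set p X S a"
  have c: "?c \<in> carrier (relative_homology_group (int p) X S)" by (rule cls_carrier[OF assms])
  have n: "homologous_rel_set p X S (frag_cmul (int n) a) = ?c [^]\<^bsub>relative_homology_group (int p) X S\<^esub> n" for n
  proof (induction n)
    case 0 then show ?case by (simp add: cls_0 del: one_relative_homology_group)
  next
    case (Suc n)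
    have "frag_cmul (int (Suc n)) a = frag_cmul (int n) a + a"
      by (simp add: frag_cmul_distrib)
    then show ?case
      using Suc assms by (simp add: cls_add singular_relcycle_cmul)
  qed
  show ?thesis
  proof (cases "k \<ge> 0")
    case True
    then obtain m where "k = int m" using nonneg_eq_int by blast
    then show ?thesis using n[of m] by (simp add: int_pow_int)
  next
    case False
    then obtain m where m: "k = - int m" by (metis int_cases2 of_nat_0_le_iff)
    have "frag_cmul k a = - frag_cmul (int m) a" by (simp add: m)
    moreover have "homologous_rel_set p X S (- frag_cmul (int m) a) = inv\<^bsub>relative_homology_group (int p) X S\<^esub> homologous_rel_set p X S (frag_cmul (int m) a)"
      by (intro cls_minus singular_relcycle_cmul assms)
    ultimately have "homologous_rel_set p X S (frag_cmul k a) = inv\<^bsub>relative_homology_group (int p) X S\<^esub> (?c [^]\<^bsub>relative_homology_group (int p) X S\<^esub> m)"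
      by (simp only: n)
    also have "\<dots> = ?c [^]\<^bsub>relative_homology_group (int p) X S\<^esub> k"
      using c by (simp add: m int_pow_neg int_pow_int)
    finally show ?thesis .
  qed
qed

text \<open>A chain inside the subspace is a relative boundary. This discards all sides of a simplex
  but one, and later all triangles but one.\<close>

lemma cls_cong:
  assumes "singular_chain p (subtopology X S) (a - b)"
  shows "homologous_rel_set p X S a = homologous_rel_set p X S b"
  using singular_chain_imp_relboundary[OF assms]
  by (simp only: homologous_rel_set_eq) (simp only: homologous_rel_def)

subsection \<open>The local homology of a simplex\<close>

definition bary :: "nat \<Rightarrow> nat \<Rightarrow> real" where
  "bary n = (\<lambda>i. if i \<le> n then 1 / (real n + 1) else 0)"

abbreviation idc :: "nat \<Rightarrow> (nat \<Rightarrow> real) chain" where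
  "idc n \<equiv> frag_of (restrict id (standard_simplex n))"

lemma singular_simplex_id:
  "singular_simplex n (top_of_set (standard_simplex n)) (restrict id (standard_simplex n))"
  using simplicial_simplex_id[of n "standard_simplex n"]
  by (simp add: simplicial_simplex_def euclidean_product_topology)

lemma bary_in: "bary n \<in> standard_simplex n"
proof -
  have "0 \<le> 1 / (real n + 1)" "1 / (real n + 1) \<le> 1" by simp_all
  then show ?thesis
    by (simp add: standard_simplex_def bary_def divide_simps)
qed

lemma standard_simplex_eq_bary:
  assumes "t \<in> standard_simplex n" "\<And>i. i \<le> n \<Longrightarrow> t i = c"
  shows "t = bary n"
proof -
  have "(\<Sum>i\<le>n. t i) = 1" and z: "\<forall>i>n. t i = 0"
    using assms(1) by (auto simp: standard_simplex_def)
  moreover have "(\<Sum>i\<le>n. t i) = (\<Sum>i\<le>n. c)" by (rule sum.cong) (use assms in auto)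
  ultimately have "(real n + 1) * c = 1" by (simp add: add.commute)
  then have "c = 1 / (real n + 1)" by (simp add: eq_divide_eq mult.commute)
  then show ?thesis using assms z by (auto simp: fun_eq_iff bary_def)
qed

lemma seg_standard_simplex:
  assumes "x \<in> standard_simplex n" "y \<in> standard_simplex n" "t \<in> {0..1}"
  shows "seg t x y \<in> standard_simplex n"
  using convex_standard_simplex[of x n y t] assms by (auto simp: seg_def)

text \<open>On the k-th face the k-th barycentric coordinate vanishes, whereas all relevant
  coordinates of the barycentre are positive.\<close>

lemma singular_face_avoids_bary:
  assumes "k \<le> Suc n"
  shows "singular_simplex n (subtopology (top_of_set (standard_simplex (Suc n))) {t. t k = 0})
     (singular_face (Suc n) k (restrict id (standard_simplex (Suc n))))"
proof (rule iffD2[OF singular_simplex_subtopology[of n "top_of_set (standard_simplex (Suc n))"]], rule conjI)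
  show "singular_simplex n (top_of_set (standard_simplex (Suc n)))
     (singular_face (Suc n) k (restrict id (standard_simplex (Suc n))))"
    using singular_simplex_singular_face[OF singular_simplex_id[of "Suc n"], of k] assms by simp
  show "singular_face (Suc n) k (restrict id (standard_simplex (Suc n))) ` standard_simplex n \<subseteq> {t. t k = 0}"
  proof clarify
    fix x assume x: "x \<in> standard_simplex n"
    then have "simplical_face k x \<in> standard_simplex (Suc n)"
      using simplical_face_in_standard_simplex[of "Suc n" k x] assms by simp
    then show "singular_face (Suc n) k (restrict id (standard_simplex (Suc n))) x k = 0"
      using x by (simp add: singular_face_def simplical_face_def)
  qed
qed

lemma idc_relcycle: "singular_relcycle n (top_of_set (standard_simplex n)) (- {bary n}) (idc n)"
proof (cases n)
  case 0
  then show ?thesis using singular_simplex_id[of 0]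
    by (simp add: singular_relcycle chain_boundary_of singular_chain_of)
next
  case (Suc m)
  have "{t. t k = 0} \<subseteq> - {bary n}" if "k \<le> n" for k
    using that by (auto simp: bary_def)
  then have "singular_simplex m (subtopology (top_of_set (standard_simplex n)) (- {bary n}))
     (singular_face n k (restrict id (standard_simplex n)))" if "k \<le> n" for k
    using singular_simplex_mono[OF singular_face_avoids_bary[of k m]] that Suc by blast
  then have "singular_chain m (subtopology (top_of_set (standard_simplex n)) (- {bary n}))
     (\<Sum>k\<le>n. frag_cmul ((-1) ^ k) (frag_of (singular_face n k (restrict id (standard_simplex n)))))"
    by (intro singular_chain_sum singular_chain_cmul) (simp add: singular_chain_of)
  then show ?thesis using singular_simplex_id[of n] Suc
    by (simp add: singular_relcycle chain_boundary_of singular_chain_of)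
qed

lemma frag_cmul_frag_of_eq_0: "frag_cmul k (frag_of a) = 0 \<longleftrightarrow> k = 0"
  by (metis frag_cmul_eq_0_iff frag_of_nonzero)

text \<open>The complement of the barycentre of a point is empty, so this is absolute homology of a
  one-point space: every 0-chain is a multiple of the only simplex, and no nonzero one
  bounds.\<close>

lemma infgen_idc_0:
  "infgen (relative_homology_group 0 (top_of_set (standard_simplex 0)) (- {bary 0}))
     (homologous_rel_set 0 (top_of_set (standard_simplex 0)) (- {bary 0}) (idc 0))"
proof -
  let ?X = "top_of_set (standard_simplex 0)"
  let ?a = "\<lambda>j. if j = 0 then 1 else (0::real)"
  have S: "standard_simplex 0 = {?a}" by (rule standard_simplex_0)
  have e: "standard_simplex 0 \<inter> - {bary 0} = {}"
    unfolding S by (auto simp: bary_def)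
  have eq: "relative_homology_group 0 ?X (- {bary 0}) = homology_group 0 ?X"
    using relative_homology_group_restrict[of 0 ?X "- {bary 0}"] e by simp
  have eq2: "homologous_rel_set 0 ?X (- {bary 0}) c = homologous_rel_set 0 ?X {} c" for c
    using homologous_rel_restrict[of 0 ?X "- {bary 0}"] e by simp
  have rc: "singular_relcycle 0 ?X {} (idc 0)"
    using idc_relcycle[of 0] singular_relcycle_restrict[of 0 ?X "- {bary 0}"] e by simp
  have idr: "restrict id (standard_simplex 0) = restrict (\<lambda>x. ?a) (standard_simplex 0)"
    unfolding S by auto
  have top: "topspace ?X = {?a}" by (simp add: S)
  have "infgen (relative_homology_group (int 0) ?X {}) (homologous_rel_set 0 ?X {} (idc 0))"
    unfolding infgen_def
  proof (intro conjI ballI allI impI)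
    show "homologous_rel_set 0 ?X {} (idc 0) \<in> carrier (relative_homology_group (int 0) ?X {})"
      using cls_carrier[OF rc] by simp
  next
    fix x assume "x \<in> carrier (relative_homology_group (int 0) ?X {})"
    then obtain c where c: "x = homologous_rel_set 0 ?X {} c" "singular_relcycle 0 ?X {} c"
      by (auto simp: carrier_relative_homology_group simp del: of_nat_0)
    then have "singular_chain 0 ?X c" by (simp add: singular_relcycle)
    then obtain b where "c = frag_cmul b (idc 0)"
      using singular_chain_singleton[OF top, of 0 c] idr by auto
    then show "\<exists>k::int. x = homologous_rel_set 0 ?X {} (idc 0) [^]\<^bsub>relative_homology_group (int 0) ?X {}\<^esub> k"
      using cls_cmul[OF rc] c by blast
  next
    fix k :: int
    assume "homologous_rel_set 0 ?X {} (idc 0) [^]\<^bsub>relative_homology_group (int 0) ?X {}\<^esub> k = \<one>\<^bsub>relative_homology_group (int 0) ?X {}\<^esub>"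
    then have "homologous_rel_set 0 ?X {} (frag_cmul k (idc 0)) = \<one>\<^bsub>relative_homology_group (int 0) ?X {}\<^esub>"
      using cls_cmul[OF rc, of k] by simp
    then have "singular_relboundary 0 ?X {} (frag_cmul k (idc 0))"
      unfolding cls_eq_one_iff .
    then have "frag_cmul k (idc 0) = 0"
      using singular_boundary_singleton[OF top, of 0] by simp
    then show "k = 0"
      by (simp add: frag_cmul_frag_of_eq_0)
  qed
  then show ?thesis by (simp add: eq eq2)
qed

text \<open>Three isomorphisms link dimensions n + 1 and n. The boundary map of the triple
  \<open>D\<close>, \<open>S\<close>, \<open>T\<close> sends the identity simplex to its face 0,
  since the other faces lie in \<open>T\<close>; excision of \<open>U\<close> cuts \<open>S\<close>
  down to the neighbourhood \<open>V\<close> of face 0; and \<open>V\<close> retracts onto face 0,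
  where the induction hypothesis applies.\<close>

lemma infgen_idc_step:
  assumes IH: "infgen (relative_homology_group (int n) (top_of_set (standard_simplex n)) (- {bary n}))
     (homologous_rel_set n (top_of_set (standard_simplex n)) (- {bary n}) (idc n))"
  shows "infgen (relative_homology_group (int (Suc n)) (top_of_set (standard_simplex (Suc n))) (- {bary (Suc n)}))
     (homologous_rel_set (Suc n) (top_of_set (standard_simplex (Suc n))) (- {bary (Suc n)}) (idc (Suc n)))"
proof -
  define D where "D = standard_simplex (Suc n)"
  define c where "c = 1 / (real n + 2)"
  define S where "S = - {bary (Suc n)}"
  \<comment> \<open>In the simplex this is the complement of the segment from the barycentre to the
    barycentre of face 0. The segment prolongs the line from vertex 0, here \<open>e\<close>,
    through the barycentre, so its complement is star-shaped about \<open>e\<close>.\<close>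
  define T where "T = {t::nat \<Rightarrow> real. \<not> ((\<exists>d. \<forall>i\<in>{1..Suc n}. t i = d) \<and> t 0 \<le> c)}"
  define U where "U = {t::nat \<Rightarrow> real. c \<le> t 0}"
  define e where "e = (\<lambda>j::nat. if j = 0 then 1 else (0::real))"
  have ins: "{..Suc n} = insert 0 {1..Suc n}" by auto
  have c: "0 < c" "c < 1" by (auto simp: c_def)
  have bc: "bary (Suc n) i = c" if "i \<le> Suc n" for i
    using that by (simp add: bary_def c_def)
  have TS: "T \<subseteq> S"
  proof -
    have "bary (Suc n) \<notin> T" unfolding T_def using bc by force
    then show ?thesis by (auto simp: S_def)
  qed
  have eD: "e \<in> D" by (simp add: e_def D_def)
  have eT: "e \<in> T" using c by (simp add: e_def T_def)
  \<comment> \<open>Moving towards vertex 0 does not lower coordinate 0 and scales the others by one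
    common factor, so a point that arrives on the segment must have started on it.\<close>
  have segT: "seg t x e \<in> T" if t: "t \<in> {0..1}" and x: "x \<in> D" "x \<in> T" for t x
  proof (cases "t = 1")
    case True then show ?thesis using eT by (simp add: seg_def)
  next
    case False
    with t have t1: "0 < 1 - t" by simp
    have x0: "x 0 \<le> 1" using x by (simp add: D_def standard_simplex_def)
    have "x 0 \<le> (1 - t) * x 0 + t"
      using mult_left_mono[OF x0, of t] t by (simp add: algebra_simps)
    then have 0: "x 0 \<le> seg t x e 0" by (simp add: seg_def e_def)
    have i: "x i = seg t x e i / (1 - t)" if "i \<in> {1..Suc n}" for i
      using that t1 by (simp add: seg_def e_def)
    show ?thesis
    proof (rule ccontr)
      assume "seg t x e \<notin> T"
      then obtain d where "\<forall>i\<in>{1..Suc n}. seg t x e i = d" "seg t x e 0 \<le> c"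
        unfolding T_def by blast
      then have "\<forall>i\<in>{1..Suc n}. x i = d / (1 - t)" "x 0 \<le> c"
        using i 0 by auto
      then show False using x(2) unfolding T_def by blast
    qed
  qed
  have contr: "contractible_space (top_of_set D)"
    by (rule contractible_space_star[where a = e])
      (use eD in \<open>auto simp: D_def seg_standard_simplex\<close>)
  have contrT: "contractible_space (subtopology (top_of_set D) T)"
    unfolding subtopology_subtopology
    by (rule contractible_space_star[where a = e])
      (use eD segT in \<open>auto simp: D_def seg_standard_simplex\<close>)
  \<comment> \<open>With \<open>D\<close> and \<open>T\<close> contractible, exactness turns the
    boundary map of the triple into an isomorphism.\<close>
  have rel: "hom_relboundary (int (Suc n)) (top_of_set D) S T
      \<in> iso (relative_homology_group (int (Suc n)) (top_of_set D) S)
            (relative_homology_group (int (Suc n) - 1) (subtopology (top_of_set D) S) T)"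
    by (rule iso_hom_relboundary_contractible) (use contr contrT TS eD eT in auto)
  have rc: "singular_relcycle (Suc n) (top_of_set D) S (idc (Suc n))"
    using idc_relcycle[of "Suc n"] by (simp add: D_def S_def)
  let ?face = "\<lambda>k. singular_face (Suc n) k (restrict id D)"
  let ?Y = "subtopology (top_of_set D) S"
  have bd: "chain_boundary (Suc n) (idc (Suc n)) = (\<Sum>k\<le>Suc n. frag_cmul ((-1) ^ k) (frag_of (?face k)))"
    by (simp add: chain_boundary_of D_def)
  \<comment> \<open>A point of the segment on a face with k \<ge> 1 would have all coordinates from
    1 on equal to 0, hence t 0 = 1, which exceeds \<open>c\<close>.\<close>
  have faceT: "singular_simplex n (subtopology ?Y T) (?face k)" if "k \<in> {1..Suc n}" for k
  proof -
    have "t \<in> T" if t: "t \<in> D" "t k = 0" for t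
    proof (rule ccontr)
      assume "t \<notin> T"
      then obtain d where d: "\<forall>i\<in>{1..Suc n}. t i = d" and *: "t 0 \<le> c" unfolding T_def by blast
      have "t k = d" using d \<open>k \<in> {1..Suc n}\<close> by blast
      then have "d = 0" using t by simp
      with d have "\<forall>i\<in>{1..Suc n}. t i = 0" by blast
      then have "(\<Sum>i\<le>Suc n. t i) = t 0"
        by (subst sum.atMost_Suc_shift) (simp add: sum.neutral)
      then show False using * c t by (simp add: D_def standard_simplex_def)
    qed
    then have sub: "D \<inter> {t. t k = 0} \<subseteq> D \<inter> S \<inter> T" using TS by auto
    have "singular_simplex n (top_of_set (D \<inter> {t. t k = 0})) (?face k)"
      using singular_face_avoids_bary[of k n] that by (simp add: D_def subtopology_subtopology)
    from singular_simplex_mono[OF this sub] show ?thesis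
      by (simp only: subtopology_subtopology)
  qed
  have face0: "singular_simplex n ?Y (?face 0)"
  proof -
    have sub: "D \<inter> {t. t 0 = 0} \<subseteq> D \<inter> S" using bc[of 0] c by (auto simp: S_def)
    have "singular_simplex n (top_of_set (D \<inter> {t. t 0 = 0})) (?face 0)"
      using singular_face_avoids_bary[of 0 n] by (simp add: D_def subtopology_subtopology)
    from singular_simplex_mono[OF this sub] show ?thesis
      by (simp only: subtopology_subtopology)
  qed
  have 1: "hom_relboundary (int (Suc n)) (top_of_set D) S T (homologous_rel_set (Suc n) (top_of_set D) S (idc (Suc n)))
     = homologous_rel_set n ?Y T (frag_of (?face 0))"
  proof -
    have "hom_boundary (int (Suc n)) (top_of_set D) S (homologous_rel_set (Suc n) (top_of_set D) S (idc (Suc n)))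
      = homologous_rel_set n ?Y {} (chain_boundary (Suc n) (idc (Suc n)))"
      using hom_boundary_chain_boundary[OF rc] by simp
    moreover have "singular_relcycle n ?Y {} (chain_boundary (Suc n) (idc (Suc n)))"
      using rc chain_boundary_boundary_alt[of n "top_of_set D" "idc (Suc n)"]
      by (simp add: singular_cycle) (simp add: singular_relcycle)
    moreover have "int (Suc n) - 1 = int n" by simp
    ultimately have "hom_relboundary (int (Suc n)) (top_of_set D) S T (homologous_rel_set (Suc n) (top_of_set D) S (idc (Suc n)))
       = homologous_rel_set n ?Y T (chain_map n id (chain_boundary (Suc n) (idc (Suc n))))"
      unfolding hom_relboundary_def o_apply
      by (simp only: hom_induced_chain_map[OF continuous_map_id] Pi_empty UNIV_I empty_iff)
    moreover have "chain_map n id (chain_boundary (Suc n) (idc (Suc n))) = chain_boundary (Suc n) (idc (Suc n))"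
      using rc by (intro chain_map_id_gen[of n ?Y]) (auto simp: singular_relcycle)
    moreover have "homologous_rel_set n ?Y T (chain_boundary (Suc n) (idc (Suc n))) = homologous_rel_set n ?Y T (frag_of (?face 0))"
    proof (rule cls_cong)
      have "chain_boundary (Suc n) (idc (Suc n)) - frag_of (?face 0)
         = (\<Sum>k\<in>{1..Suc n}. frag_cmul ((-1) ^ k) (frag_of (?face k)))"
        unfolding bd ins by (subst sum.insert) simp_all
      moreover have "singular_chain n (subtopology ?Y T) (\<Sum>k\<in>{1..Suc n}. frag_cmul ((-1) ^ k) (frag_of (?face k)))"
        by (intro singular_chain_sum singular_chain_cmul) (simp only: singular_chain_of faceT)
      ultimately show "singular_chain n (subtopology ?Y T) (chain_boundary (Suc n) (idc (Suc n)) - frag_of (?face 0))"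
        by (simp only:)
    qed
    ultimately show ?thesis by (simp only:)
  qed
  define V where "V = D \<inter> {t. t 0 < c}"
  \<comment> \<open>\<open>U\<close> meets the segment only at the barycentre, which
    \<open>S\<close> lacks. So inside \<open>S\<close> the closed set \<open>U\<close> lies in the
    open set \<open>T\<close>, as excision requires.\<close>
  have bU: "t = bary (Suc n)" if t: "t \<in> D" "t \<in> U" "t \<notin> T" for t
  proof -
    obtain d where d: "\<forall>i\<in>{1..Suc n}. t i = d" and "t 0 \<le> c" using t(3) unfolding T_def by blast
    moreover have "c \<le> t 0" using t(2) by (simp add: U_def)
    ultimately have t0: "t 0 = c" by linarith
    have "(\<Sum>i\<le>Suc n. t i) = t 0 + (\<Sum>i\<in>{1..Suc n}. t i)"
      unfolding ins by (subst sum.insert) simp_all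
    also have "\<dots> = c + (\<Sum>i\<in>{1..Suc n}. d)" using d t0 by (intro arg_cong2[of _ _ _ _ "(+)"] sum.cong) blast+
    also have "\<dots> = c + (real n + 1) * d" by simp
    finally have "c + (real n + 1) * d = 1" using that by (simp add: D_def standard_simplex_def)
    moreover have "c + (real n + 1) * c = 1" by (simp add: c_def field_simps)
    ultimately have "d = c" using mult_left_cancel[of "real n + 1" d c] by linarith
    have "t i = c" if "i \<le> Suc n" for i
      using bspec[OF d, of i] t0 \<open>d = c\<close> that by (cases "i = 0") auto
    then show ?thesis using standard_simplex_eq_bary[of t "Suc n" c] that by (simp add: D_def)
  qed
  have coord: "continuous_on UNIV (\<lambda>t::nat \<Rightarrow> real. t i)" for i
    by (rule continuous_on_product_coordinates)
  have clU: "closed U"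
    unfolding U_def by (intro closed_Collect_le continuous_on_const coord)
  have opT: "open T"
  proof -
    have "T = - ({t. \<forall>i\<in>{1..Suc n}. t i = t 1} \<inter> {t. t 0 \<le> c})"
    proof (rule Set.set_eqI, rule iffI)
      fix t assume "t \<in> - ({t. \<forall>i\<in>{1..Suc n}. t i = t 1} \<inter> {t. t 0 \<le> c})"
      then show "t \<in> T" unfolding T_def by fastforce
    next
      fix t assume "t \<in> T"
      then show "t \<in> - ({t. \<forall>i\<in>{1..Suc n}. t i = t 1} \<inter> {t. t 0 \<le> c})" unfolding T_def by blast
    qed
    moreover have "closed {t::nat \<Rightarrow> real. \<forall>i\<in>{1..Suc n}. t i = t 1}"
      unfolding Collect_ball_eq by (intro closed_INT ballI closed_Collect_eq coord)
    moreover have "closed {t::nat \<Rightarrow> real. t 0 \<le> c}"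
      by (intro closed_Collect_le continuous_on_const coord)
    ultimately show ?thesis by (simp add: open_closed closed_Int)
  qed
  have Y: "?Y = top_of_set (D \<inter> S)" by (simp add: subtopology_subtopology)
  have "?Y closure_of U \<subseteq> ?Y interior_of T"
  proof -
    have cl: "closedin ?Y (D \<inter> S \<inter> U)" and op: "openin ?Y (D \<inter> S \<inter> T)"
      unfolding Y using clU opT by (auto intro: closedin_closed_Int openin_open_Int)
    have "?Y closure_of (topspace ?Y \<inter> U) \<subseteq> D \<inter> S \<inter> U"
      by (rule closure_of_minimal[OF _ cl]) (simp add: Y)
    moreover have "D \<inter> S \<inter> T \<subseteq> ?Y interior_of T"
      by (rule interior_of_maximal[OF _ op]) simp
    moreover have "D \<inter> S \<inter> U \<subseteq> D \<inter> S \<inter> T" using bU by (auto simp: S_def)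
    ultimately show ?thesis unfolding closure_of_restrict[of ?Y U] by blast
  qed
  then have exc: "hom_induced (int n) (subtopology ?Y (UNIV - U)) (T - U) (subtopology ?Y UNIV) T id
      \<in> iso (relative_homology_group (int n) (subtopology ?Y (UNIV - U)) (T - U))
            (relative_homology_group (int n) (subtopology ?Y UNIV) T)"
    by (intro homology_excision_axiom) auto
  have V: "subtopology ?Y (UNIV - U) = top_of_set V"
  proof -
    have "D \<inter> S \<inter> (UNIV - U) = V" using bc[of 0] by (auto simp: V_def U_def S_def)
    then show ?thesis by (simp add: subtopology_subtopology)
  qed
  \<comment> \<open>\<open>j\<close> is the inclusion of face 0 and \<open>r\<close> the projection
    onto it from vertex 0; the denominator is positive on \<open>V\<close> because t 0 < c < 1
    there.\<close>
  define j where "j = (simplical_face 0 :: (nat \<Rightarrow> real) \<Rightarrow> nat \<Rightarrow> real)"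
  define r where "r = (\<lambda>t::nat \<Rightarrow> real. \<lambda>i. t (Suc i) / (1 - t 0))"
  have j0: "j t 0 = 0" and jS: "j t (Suc i) = t i" for t i
    by (auto simp: j_def simplical_face_def)
  have jr0: "j (r t) 0 = 0" and jrS: "j (r t) (Suc i) = t (Suc i) / (1 - t 0)" for t i
    by (auto simp: j0 jS r_def)
  have jD: "j t \<in> D" if "t \<in> standard_simplex n" for t
    using simplical_face_in_standard_simplex[of "Suc n" 0 t] that by (simp add: j_def D_def)
  have jV: "j t \<in> V" if "t \<in> standard_simplex n" for t
    using jD[OF that] c by (simp add: V_def j0)
  have rD: "r t \<in> standard_simplex n" if "t \<in> V" for t
  proof -
    have t: "0 \<le> t i" "\<forall>i>Suc n. t i = 0" "(\<Sum>i\<le>Suc n. t i) = 1" "t 0 < c" for i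
      using that by (auto simp: V_def D_def standard_simplex_def)
    have p: "0 < 1 - t 0" using t(4) c by simp
    have s: "(\<Sum>i\<le>n. t (Suc i)) = 1 - t 0"
      using t(3) by (simp add: sum.atMost_Suc_shift del: sum.atMost_Suc)
    have "t (Suc i) \<le> 1 - t 0" for i
    proof (cases "i \<le> n")
      case True
      then show ?thesis using member_le_sum[of i "{..n}" "\<lambda>i. t (Suc i)"] t(1) s by simp
    next
      case False
      then show ?thesis using t(2) p by simp
    qed
    then show ?thesis
      using t p s by (simp add: standard_simplex_def r_def sum_divide_distrib[symmetric])
  qed
  have cj: "continuous_on A j" for A
  proof (rule continuous_on_coordinatewise_then_product)
    show "continuous_on A (\<lambda>x. j x i)" for i
      by (cases i) (auto simp: j0 jS intro: continuous_on_subset[OF coord])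
  qed
  have cr: "continuous_on V r"
    unfolding r_def
    by (intro continuous_on_coordinatewise_then_product continuous_on_divide continuous_on_diff continuous_on_const
        continuous_on_subset[OF coord]) (use c in \<open>auto simp: V_def\<close>)
  have inT: "t \<in> T \<longleftrightarrow> \<not> (\<exists>d. \<forall>i\<le>n. t (Suc i) = d)" if "t \<in> V" for t
  proof -
    have "(\<forall>i\<in>{1..Suc n}. t i = d) \<longleftrightarrow> (\<forall>i\<le>n. t (Suc i) = d)" for d
      by (auto simp: Suc_le_eq gr0_conv_Suc)
    moreover have "t 0 \<le> c" using that by (simp add: V_def)
    ultimately show ?thesis unfolding T_def by blast
  qed
  have VU: "t \<notin> U" if "t \<in> V" for t using that by (auto simp: V_def U_def)
  have jb: "j t \<in> T" if "t \<in> standard_simplex n" "t \<noteq> bary n" for t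
    using inT[OF jV] standard_simplex_eq_bary that by (auto simp: jS)
  have rb: "r t \<noteq> bary n" if "t \<in> V" "t \<in> T" for t
  proof
    assume rt: "r t = bary n"
    have p: "1 - t 0 \<noteq> 0" using that c by (auto simp: V_def)
    have "t (Suc i) = (1 - t 0) * (1 / (real n + 1))" if "i \<le> n" for i
      using fun_cong[OF rt, of i] that p by (simp add: r_def bary_def divide_eq_eq mult.commute)
    then have "\<forall>i\<le>n. t (Suc i) = (1 - t 0) * (1 / (real n + 1))" by blast
    then show False using inT that by blast
  qed
  have rj: "r (j t) = t" for t by (simp add: r_def j0 jS)
  have hom: "homotopic_with (\<lambda>k. k \<in> V \<inter> T \<rightarrow> V \<inter> T) (top_of_set V) (top_of_set V) (j \<circ> r) id"
  proof (rule homotopic_with_seg)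
    show "continuous_on V (j \<circ> r)"
      using cr cj continuous_on_compose by blast
    show "continuous_on V id" by simp
    have segV: "seg t ((j \<circ> r) x) (id x) \<in> V" if "t \<in> {0..1}" "x \<in> V" for t x
    proof -
      have "x 0 \<le> c" "0 \<le> x 0" using that by (auto simp: V_def D_def standard_simplex_def)
      then have "t * x 0 \<le> x 0" using that by (simp add: mult_left_le_one_le)
      then show ?thesis
        using jD[OF rD[OF that(2)]] that by (auto simp: V_def D_def seg_standard_simplex) (simp add: seg_def j0)
    qed
    then show "\<And>t x. t \<in> {0..1} \<Longrightarrow> x \<in> V \<Longrightarrow> seg t ((j \<circ> r) x) (id x) \<in> V" .
    show "(\<lambda>x. seg t ((j \<circ> r) x) (id x)) \<in> V \<inter> T \<rightarrow> V \<inter> T" if t: "t \<in> {0..1}" for t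
    proof
      fix x assume x: "x \<in> V \<inter> T"
      \<comment> \<open>The homotopy multiplies all coordinates from 1 on by this positive factor,
        so it never makes unequal ones equal.\<close>
      define k where "k = (1 - t) / (1 - x 0) + t"
      have "0 < 1 - x 0" using x c by (auto simp: V_def)
      then have k: "0 < k" using t unfolding k_def
        by (cases "t = 0") (auto intro!: add_nonneg_pos)
      have s: "seg t ((j \<circ> r) x) (id x) (Suc i) = k * x (Suc i)" for i
        by (simp add: seg_def jrS k_def distrib_right)
      have "seg t ((j \<circ> r) x) (id x) \<in> V" using segV t x by blast
      moreover have "\<not> (\<exists>d. \<forall>i\<le>n. seg t ((j \<circ> r) x) (id x) (Suc i) = d)"
      proof
        assume "\<exists>d. \<forall>i\<le>n. seg t ((j \<circ> r) x) (id x) (Suc i) = d"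
        then obtain d where d: "\<forall>i\<le>n. k * x (Suc i) = d" unfolding s by blast
        have "x (Suc i) = d / k" if "i \<le> n" for i
        proof -
          have "k * x (Suc i) = d" using d that by blast
          then show ?thesis using k by auto
        qed
        then show False using inT[of x] x by blast
      qed
      ultimately show "seg t ((j \<circ> r) x) (id x) \<in> V \<inter> T" using inT by blast
    qed
  qed
  have hj: "hom_induced (int n) (top_of_set (standard_simplex n)) (topspace (top_of_set (standard_simplex n)) \<inter> - {bary n}) (top_of_set V) (V \<inter> T) j
    \<in> iso (relative_homology_group (int n) (top_of_set (standard_simplex n)) (topspace (top_of_set (standard_simplex n)) \<inter> - {bary n}))
          (relative_homology_group (int n) (top_of_set V) (V \<inter> T))"
  proof (rule homotopy_equivalence_relative_homology_group_isomorphism[where g = r])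
    show "continuous_map (top_of_set (standard_simplex n)) (top_of_set V) j"
      using cj jV by (auto simp: continuous_map_in_subtopology)
    show "continuous_map (top_of_set V) (top_of_set (standard_simplex n)) r"
      using cr rD by (auto simp: continuous_map_in_subtopology)
    have "r \<circ> j = id" by (auto simp: rj)
    then show "homotopic_with (\<lambda>h. h \<in> topspace (top_of_set (standard_simplex n)) \<inter> - {bary n} \<rightarrow> topspace (top_of_set (standard_simplex n)) \<inter> - {bary n})
      (top_of_set (standard_simplex n)) (top_of_set (standard_simplex n)) (r \<circ> j) id"
      by (auto simp: homotopic_with_refl)
  qed (use hom jb jV rb rD in auto)
  have cmj: "chain_map n j (idc n) = frag_of (?face 0)"
  proof -
    have "simplex_map n j (restrict id (standard_simplex n)) = ?face 0"
      unfolding simplex_map_def singular_face_def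
      by (rule ext) (use jD in \<open>auto simp: j_def D_def\<close>)
    then show ?thesis by simp
  qed
  have rcn: "singular_relcycle n (top_of_set (standard_simplex n)) (topspace (top_of_set (standard_simplex n)) \<inter> - {bary n}) (idc n)"
    using idc_relcycle[of n] by (simp only: singular_relcycle_restrict)
  have 2: "infgen (relative_homology_group (int n) (top_of_set V) (V \<inter> T))
    (homologous_rel_set n (top_of_set V) (V \<inter> T) (frag_of (?face 0)))"
  proof -
    have "hom_induced (int n) (top_of_set (standard_simplex n)) (topspace (top_of_set (standard_simplex n)) \<inter> - {bary n}) (top_of_set V) (V \<inter> T) j
      (homologous_rel_set n (top_of_set (standard_simplex n)) (topspace (top_of_set (standard_simplex n)) \<inter> - {bary n}) (idc n))
      = homologous_rel_set n (top_of_set V) (V \<inter> T) (chain_map n j (idc n))"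
      using cj jV jb
      by (intro hom_induced_chain_map[OF _ _ rcn]) (auto simp: continuous_map_in_subtopology)
    moreover note cmj
    ultimately show ?thesis
      using IH infgen_iso[OF _ _ hj, of "homologous_rel_set n (top_of_set (standard_simplex n)) (topspace (top_of_set (standard_simplex n)) \<inter> - {bary n}) (idc n)"]
        cls_carrier[OF idc_relcycle[of n]]
      by (simp only: relative_homology_group_restrict homologous_rel_restrict group_relative_homology_group)
  qed
  have eqV: "relative_homology_group (int n) (top_of_set V) (V \<inter> T) = relative_homology_group (int n) (top_of_set V) (T - U)"
    "homologous_rel_set n (top_of_set V) (V \<inter> T) f = homologous_rel_set n (top_of_set V) (T - U) f" for f
  proof -
    have "topspace (top_of_set V) \<inter> (T - U) = V \<inter> T" using VU by auto
    then show "relative_homology_group (int n) (top_of_set V) (V \<inter> T) = relative_homology_group (int n) (top_of_set V) (T - U)"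
    "homologous_rel_set n (top_of_set V) (V \<inter> T) f = homologous_rel_set n (top_of_set V) (T - U) f"
      using relative_homology_group_restrict[of "int n" "top_of_set V" "T - U"]
       homologous_rel_restrict[of n "top_of_set V" "T - U"] by simp_all
  qed
  have YU: "subtopology ?Y UNIV = ?Y" by simp
  have 3: "infgen (relative_homology_group (int n) ?Y T) (homologous_rel_set n ?Y T (frag_of (?face 0)))"
  proof -
    have "singular_simplex n (top_of_set V) (?face 0)"
    proof -
      have "D \<inter> {t. t 0 = 0} \<subseteq> V" using c by (auto simp: V_def)
      moreover have "singular_simplex n (top_of_set (D \<inter> {t. t 0 = 0})) (?face 0)"
        using singular_face_avoids_bary[of 0 n] by (simp add: D_def subtopology_subtopology)
      ultimately show ?thesis using singular_simplex_mono[of n euclidean] by blast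
    qed
    moreover note cmj
    moreover have "singular_relcycle n (top_of_set V) (V \<inter> T) (chain_map n j (idc n))"
      by (rule singular_relcycle_chain_map[OF rcn]) (use cj jV jb in \<open>auto simp: continuous_map_in_subtopology\<close>)
    moreover have "topspace (top_of_set V) \<inter> (T - U) = V \<inter> T" using VU by auto
    ultimately have rcf: "singular_relcycle n (top_of_set V) (T - U) (frag_of (?face 0))"
      using singular_relcycle_restrict[of n "top_of_set V" "T - U"] by (simp only:)
    have "hom_induced (int n) (top_of_set V) (T - U) ?Y T id (homologous_rel_set n (top_of_set V) (T - U) (frag_of (?face 0)))
      = homologous_rel_set n ?Y T (chain_map n id (frag_of (?face 0)))"
    proof (rule hom_induced_chain_map[OF _ _ rcf])
      show "continuous_map (top_of_set V) ?Y id"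
        unfolding V[symmetric] by (simp add: continuous_map_from_subtopology)
    qed auto
    moreover have "chain_map n id (frag_of (?face 0)) = frag_of (?face 0)"
      using face0 by (intro chain_map_ident[of n ?Y]) (simp only: singular_chain_of)
    ultimately show ?thesis
      using infgen_iso[OF _ _ exc[unfolded V YU] cls_carrier[OF rcf]] 2 unfolding eqV
      by (simp only: group_relative_homology_group)
  qed
  have "int (Suc n) - 1 = int n" by simp
  then show ?thesis
    using infgen_iso[OF _ _ rel cls_carrier[OF rc]] 3 1
    by (simp only: group_relative_homology_group S_def D_def)
qed

theorem infgen_idc:
  "infgen (relative_homology_group (int n) (top_of_set (standard_simplex n)) (- {bary n}))
     (homologous_rel_set n (top_of_set (standard_simplex n)) (- {bary n}) (idc n))"
proof (induction n)
  case 0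
  show ?case using infgen_idc_0 by (simp only: of_nat_0)
next
  case (Suc n)
  then show ?case by (rule infgen_idc_step)
qed

subsection \<open>Local homology in a chart\<close>

text \<open>\<open>p\<close> lies on the segment from \<open>y\<close> to the pushed point, so by
  convexity the pushed point cannot be in the ball.\<close>

lemma expand_outside_ball:
  fixes y p a :: complex
  assumes "y \<in> ball a r" "p \<notin> ball a r" "1 \<le> k"
  shows "y + k *\<^sub>R (p - y) \<notin> ball a r"
proof
  assume q: "y + k *\<^sub>R (p - y) \<in> ball a r"
  have "(1 - 1 / k) *\<^sub>R y + (1 / k) *\<^sub>R (y + k *\<^sub>R (p - y)) \<in> ball a r"
    using assms q by (intro convexD[OF convex_ball]) auto
  moreover have "(1 - 1 / k) *\<^sub>R y + (1 / k) *\<^sub>R (y + k *\<^sub>R (p - y)) = p"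
    using assms by (simp add: algebra_simps)
  ultimately show False using assms by simp
qed

text \<open>The plane without \<open>y\<close> is pushed radially away from \<open>y\<close> into
  the complement of the ball, and points of that complement stay in it throughout.\<close>

lemma trivial_homology_punctured_plane:
  fixes y a :: complex
  assumes y: "y \<in> ball a r"
  shows "trivial_group (relative_homology_group p (top_of_set (- {y})) (- ball a r))"
proof -
  \<comment> \<open>A point at distance 2 r from \<open>y\<close> is outside the ball, as
    \<open>y\<close> is closer than r to the centre. The maximum with 1 makes the push an expansion
    everywhere.\<close>
  define k where "k = (\<lambda>x. max 1 (2 * r / norm (x - y)))"
  define f where "f = (\<lambda>x. y + k x *\<^sub>R (x - y))"
  have "dist a y < r" using y by simp
  then have r: "0 < r" using zero_le_dist[of a y] by linarith
  have k1: "1 \<le> k x" for x by (simp add: k_def)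
  have f: "f x \<notin> ball a r" if "x \<noteq> y" for x
  proof -
    have n: "norm (x - y) > 0" using that by simp
    have "2 * r / norm (x - y) * norm (x - y) \<le> k x * norm (x - y)"
      by (intro mult_right_mono) (auto simp: k_def)
    then have "2 * r \<le> norm (k x *\<^sub>R (x - y))" using n k1[of x] by simp
    also have "k x *\<^sub>R (x - y) = f x - y" by (simp add: f_def)
    also have "norm (f x - y) \<le> dist a (f x) + dist a y"
      by (metis dist_norm dist_triangle dist_commute)
    finally show ?thesis using y by simp
  qed
  have cf: "continuous_on (- {y}) k"
    unfolding k_def by (intro continuous_intros) auto
  have "continuous_map (top_of_set (- {y})) (subtopology (top_of_set (- {y})) (- ball a r)) f"
  proof -
    have "continuous_on (- {y}) f" unfolding f_def by (intro continuous_intros cf)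
    moreover have "f x \<noteq> y" if "x \<noteq> y" for x using f[OF that] y by metis
    ultimately show ?thesis using f by (auto simp: continuous_map_in_subtopology)
  qed
  moreover have "homotopic_with (\<lambda>k. k ` (- ball a r) \<subseteq> - ball a r) (top_of_set (- {y})) (top_of_set (- {y})) f id"
    unfolding homotopic_with_def
  proof (intro exI conjI allI ballI)
    let ?H = "\<lambda>z. y + ((1 - fst z) * k (snd z) + fst z) *\<^sub>R (snd z - y)"
    have "continuous_on ({0..1} \<times> (- {y})) (\<lambda>z. k (snd z))"
      by (rule continuous_on_compose2[OF cf]) (auto intro: continuous_intros)
    then have "continuous_on ({0..1} \<times> (- {y})) ?H"
      by (intro continuous_intros)
    moreover have g1: "1 \<le> (1 - t) * k x + t" if "t \<in> {0..1}" for t x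
      using mult_left_mono[OF k1[of x], of "1 - t"] that by simp
    moreover have "?H z \<noteq> y" if "z \<in> {0..1} \<times> (- {y})" for z
      using g1[of "fst z" "snd z"] that by (cases z) auto
    ultimately show "continuous_map (prod_topology (top_of_set {0..1}) (top_of_set (- {y}))) (top_of_set (- {y})) ?H"
      unfolding prod_topology_subtopology_eu continuous_map_in_subtopology continuous_map_iff_continuous
      by auto
    show "?H (0, x) = f x" "?H (1, x) = id x" for x by (simp_all add: f_def)
    show "(\<lambda>x. ?H (t, x)) ` (- ball a r) \<subseteq> - ball a r" if "t \<in> {0..1}" for t
      using expand_outside_ball[OF y] g1[OF that] by auto
  qed
  ultimately show ?thesis by (rule trivial_relative_homology_group_alt)
qed

abbreviation lhom :: "'a topology \<Rightarrow> 'a set \<Rightarrow> 'a chain set monoid" where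
  "lhom X A \<equiv> relative_homology_group 2 X (topspace X - A)"

abbreviation res :: "'a topology \<Rightarrow> 'a set \<Rightarrow> 'a set \<Rightarrow> 'a chain set \<Rightarrow> 'a chain set" where
  "res X A B \<equiv> hom_induced 2 X (topspace X - A) X (topspace X - B) id"

lemma res_res: "B \<subseteq> A \<Longrightarrow> C \<subseteq> B \<Longrightarrow> res X B C (res X A B x) = res X A C x"
  by (subst hom_induced_compose') auto

lemma res_carrier: "res X A B x \<in> carrier (lhom X B)"
  by (rule hom_induced_carrier)

text \<open>Parametrised by the whole plane rather than by a disk: any finitely many points of a
  chart then lie in the image of one ball, see \<open>chart_ball\<close>, and closed balls have
  compact image.\<close>

definition chart :: "'a topology \<Rightarrow> 'a set \<Rightarrow> (complex \<Rightarrow> 'a) \<Rightarrow> bool" where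
  "chart X U h \<longleftrightarrow> openin X U \<and> homeomorphic_map euclidean (subtopology X U) h"

lemma chart_inj: "chart X U h \<Longrightarrow> inj h"
  by (auto simp: chart_def dest: homeomorphic_imp_injective_map)

lemma chart_range: "chart X U h \<Longrightarrow> range h = U"
  using homeomorphic_imp_surjective_map openin_subset
  by (fastforce simp: chart_def topspace_subtopology)

text \<open>By the exact sequence of a triple it suffices that the homology of X minus
  \<open>h y\<close>, relative to the complement of the ball, vanishes in degrees 1 and 2. Excision
  of everything outside the chart reduces this to the punctured plane.\<close>

lemma iso_res:
  assumes X: "Hausdorff_space X" and ch: "chart X U h" and y: "y \<in> ball a r"
  shows "res X (h ` ball a r) {h y} \<in> iso (lhom X (h ` ball a r)) (lhom X {h y})"
proof (rule very_short_exact_sequence)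
  let ?S = "topspace X - {h y}" and ?T = "topspace X - h ` ball a r"
  have TS: "?T \<subseteq> ?S" using y by auto
  have U: "openin X U" "U \<subseteq> topspace X" using ch by (auto simp: chart_def openin_subset)
  have hm: "homeomorphic_map euclidean (subtopology X U) h" using ch by (simp add: chart_def)
  have inj: "inj h" and rng: "range h = U" using chart_inj[OF ch] chart_range[OF ch] by auto
  have triv: "trivial_group (relative_homology_group q (subtopology X ?S) ?T)" for q
  proof -
    \<comment> \<open>The Hausdorff property makes the image of the closed ball closed, so the
      outside of the chart has an open neighbourhood disjoint from the ball, as excision
      requires.\<close>
    have "compactin (subtopology X U) (h ` cball a r)"
      using image_compactin[of euclidean "cball a r" "subtopology X U" h] homeomorphic_imp_continuous_map[OF hm] by simp
    then have "compactin X (h ` cball a r)" by (simp add: compactin_subtopology)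
    then have "closedin X (h ` cball a r)" using X compactin_imp_closedin by blast
    then have op: "openin X (topspace X - h ` cball a r)" by (simp add: openin_diff)
    have "X closure_of (topspace X - U) = topspace X - U"
      using U by (simp add: closure_of_eq closedin_diff)
    also have "\<dots> \<subseteq> topspace X - h ` cball a r" using rng by auto
    also have "\<dots> \<subseteq> X interior_of ?T"
      using ball_subset_cball by (intro interior_of_maximal[OF _ op]) blast
    finally have "hom_induced q (subtopology X (?S - (topspace X - U))) (?T - (topspace X - U)) (subtopology X ?S) ?T id
       \<in> iso (relative_homology_group q (subtopology X (?S - (topspace X - U))) (?T - (topspace X - U)))
             (relative_homology_group q (subtopology X ?S) ?T)"
      using TS by (intro homology_excision_axiom) auto
    then have exc: "relative_homology_group q (subtopology X (?S - (topspace X - U))) (?T - (topspace X - U))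
        \<cong> relative_homology_group q (subtopology X ?S) ?T"
      by (auto simp: is_iso_def)
    have S': "?S - (topspace X - U) = h ` (- {y})" and T': "?T - (topspace X - U) = h ` (- ball a r)"
      using U rng inj by (auto simp: inj_def)
    have "homeomorphic_map (top_of_set (- {y})) (subtopology (subtopology X U) (h ` (- {y}))) h"
      using hm by (rule homeomorphic_map_subtopologies) (use U rng in auto)
    moreover have "U \<inter> h ` (- {y}) = h ` (- {y})" using rng by auto
    ultimately have "homeomorphic_map (top_of_set (- {y})) (subtopology X (h ` (- {y}))) h"
      by (simp add: subtopology_subtopology)
    then have "hom_induced q (top_of_set (- {y})) (- ball a r) (subtopology X (h ` (- {y}))) (h ` (- ball a r)) h
      \<in> iso (relative_homology_group q (top_of_set (- {y})) (- ball a r)) (relative_homology_group q (subtopology X (h ` (- {y}))) (h ` (- ball a r)))"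
      using y by (intro homeomorphic_map_relative_homology_iso) auto
    then have "relative_homology_group q (top_of_set (- {y})) (- ball a r) \<cong> relative_homology_group q (subtopology X (h ` (- {y}))) (h ` (- ball a r))"
      by (auto simp: is_iso_def)
    then show ?thesis
      using exc trivial_homology_punctured_plane[OF y, of q] unfolding S' T'
      by (meson group_relative_homology_group isomorphic_group_triviality)
  qed
  show "trivial_group (relative_homology_group 2 (subtopology X ?S) ?T)"
    "trivial_group (relative_homology_group (2 - 1) (subtopology X ?S) ?T)"
    using triv by auto
  show "exact_seq ([relative_homology_group (2 - 1) (subtopology X ?S) ?T, lhom X {h y}, lhom X (h ` ball a r), relative_homology_group 2 (subtopology X ?S) ?T],
     [hom_relboundary 2 X ?S ?T, res X (h ` ball a r) {h y}, hom_induced 2 (subtopology X ?S) ?T X ?T id])"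
    using homology_exactness_triple_1[OF TS, of 2 X] homology_exactness_triple_3[OF TS, of 2 X] by fastforce
qed

section \<open>Generators and orientations\<close>

lemma infgen_imp_generated:
  assumes "group G" "infgen G g"
  shows "subgroup_generated G {g} = G"
proof -
  interpret group G by fact
  have g: "g \<in> carrier G" using assms by (simp add: infgen_def)
  have "generate G {g} = carrier G"
    using assms(2) g generate_pow[OF g] by (fastforce simp: infgen_def)
  then show ?thesis using g by (simp add: subgroup_generated_def)
qed

text \<open>Two generators are powers of each other, and by freeness the exponents multiply to 1, so
  they are units of the integers.\<close>

lemma infgen_generated_cases:
  assumes G: "group G" and g: "infgen G g" and x: "x \<in> carrier G" "subgroup_generated G {x} = G"
  shows "x = g \<or> x = inv\<^bsub>G\<^esub> g"
proof -
  interpret group G by fact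
  have gc: "g \<in> carrier G" using g by (simp add: infgen_def)
  obtain k :: int where k: "x = g [^]\<^bsub>G\<^esub> k" using g x by (auto simp: infgen_def)
  have "carrier (subgroup_generated G {x}) = carrier G" by (simp add: x(2))
  then have "generate G {x} = carrier G" using x(1) by (simp add: subgroup_generated_def)
  then obtain l :: int where l: "g = x [^]\<^bsub>G\<^esub> l" using generate_pow[OF x(1)] gc by auto
  have "g [^]\<^bsub>G\<^esub> (k * l - 1) = \<one>\<^bsub>G\<^esub>"
  proof -
    have "g [^]\<^bsub>G\<^esub> (k * l) = (g [^]\<^bsub>G\<^esub> k) [^]\<^bsub>G\<^esub> l" using gc by (simp add: int_pow_pow)
    also have "\<dots> = g" by (simp only: k[symmetric] l[symmetric])
    finally have kl: "g [^]\<^bsub>G\<^esub> (k * l) = g" .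
    have "g [^]\<^bsub>G\<^esub> (k * l - 1) = g [^]\<^bsub>G\<^esub> (k * l) \<otimes>\<^bsub>G\<^esub> inv\<^bsub>G\<^esub> (g [^]\<^bsub>G\<^esub> (1::int))"
      using gc by (rule int_pow_diff)
    then show ?thesis unfolding kl using gc by (simp add: int_pow_1)
  qed
  then have "k * l = 1" using g by (auto simp: infgen_def)
  then have "k = 1 \<or> k = -1" by (simp add: zmult_eq_1_iff) auto
  then show ?thesis using k gc by (auto simp: int_pow_1 int_pow_neg)
qed

text \<open>Restrictions to the points of a ball factor through one group, by isomorphisms. Hence a
  global class that restricts to a generator at one point of the ball does so at all of them. Local
  consistency is then automatic, with the whole space as neighbourhood.\<close>

lemma orientableI:
  assumes X: "Hausdorff_space X" and m: "m \<in> carrier (homology_group 2 X)"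
    and loc: "\<And>x. x \<in> topspace X \<Longrightarrow> \<exists>U h a r z. chart X U h \<and> x \<in> h ` ball a r \<and> z \<in> h ` ball a r \<and>
       infgen (lhom X {z}) (hom_induced 2 X {} X (topspace X - {z}) id m)"
  shows "orientable X"
proof -
  let ?\<mu> = "\<lambda>x. hom_induced 2 X {} X (topspace X - {x}) id m"
  have e: "topspace X - topspace X = {}" by simp
  have gen: "infgen (lhom X {x}) (?\<mu> x)" if x: "x \<in> topspace X" for x
  proof -
    obtain U h a r z where ch: "chart X U h" and xW: "x \<in> h ` ball a r" and zW: "z \<in> h ` ball a r"
      and z: "infgen (lhom X {z}) (?\<mu> z)"
      using loc[OF x] by blast
    let ?W = "h ` ball a r"
    let ?m = "res X (topspace X) ?W m"
    have W: "?W \<subseteq> topspace X" using chart_range[OF ch] ch openin_subset by (fastforce simp: chart_def)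
    have *: "res X ?W {w} \<in> iso (lhom X ?W) (lhom X {w})" "res X ?W {w} ?m = ?\<mu> w" if "w \<in> ?W" for w
      using iso_res[OF X ch] res_res[of ?W "topspace X" "{w}" X m] that W e by auto
    have "infgen (lhom X ?W) ?m"
      using infgen_iso[OF _ _ *(1)[OF zW], of ?m] *(2)[OF zW] z by (simp add: hom_induced_carrier)
    then show ?thesis
      using infgen_iso[OF _ _ *(1)[OF xW], of ?m] *(2)[OF xW] by (simp add: hom_induced_carrier)
  qed
  have "surface_orientation X ?\<mu>"
    unfolding surface_orientation_def
  proof (intro conjI ballI)
    fix x assume x: "x \<in> topspace X"
    show "?\<mu> x \<in> carrier (lhom X {x})" by (rule hom_induced_carrier)
    show "subgroup_generated (lhom X {x}) {?\<mu> x} = lhom X {x}"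
      using gen[OF x] by (intro infgen_imp_generated) auto
    show "\<exists>U m'. openin X U \<and> x \<in> U \<and> m' \<in> carrier (lhom X U) \<and> (\<forall>y\<in>U. res X U {y} m' = ?\<mu> y)"
      using m x e by (intro exI[of _ "topspace X"] exI[of _ m]) auto
  qed
  then show ?thesis by (auto simp: orientable_def)
qed

text \<open>Local consistency provides only unspecified small neighbourhoods. Pulling each
  \<open>\<mu> (h b)\<close> back to the whole ball gives a class depending on b; near any point
  these classes have the same restriction to a small ball, so the dependence is locally constant,
  and the ball is connected.\<close>

lemma orientation_on_chart:
  assumes X: "Hausdorff_space X" and \<mu>: "surface_orientation X \<mu>" and ch: "chart X U h" and r: "0 < r"
  obtains n where "n \<in> carrier (lhom X (h ` ball a r))"
    "\<And>y. y \<in> h ` ball a r \<Longrightarrow> res X (h ` ball a r) {y} n = \<mu> y"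
proof -
  let ?W = "h ` ball a r"
  have Wt: "?W \<subseteq> topspace X" using chart_range[OF ch] ch openin_subset by (fastforce simp: chart_def)
  have bij: "bij_betw (res X ?W {h b}) (carrier (lhom X ?W)) (carrier (lhom X {h b}))" if "b \<in> ball a r" for b
    using iso_res[OF X ch that] by (auto simp: iso_def)
  have \<mu>c: "\<mu> x \<in> carrier (lhom X {x})" if "x \<in> topspace X" for x
    using \<mu> that by (auto simp: surface_orientation_def)
  have "\<exists>n. n \<in> carrier (lhom X ?W) \<and> res X ?W {h b} n = \<mu> (h b)" if "b \<in> ball a r" for b
  proof -
    have "h b \<in> topspace X" using Wt that by auto
    then have "\<mu> (h b) \<in> res X ?W {h b} ` carrier (lhom X ?W)"
      using \<mu>c bij[OF that] by (simp add: bij_betw_def)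
    then show ?thesis by force
  qed
  then obtain n where n: "\<And>b. b \<in> ball a r \<Longrightarrow> n b \<in> carrier (lhom X ?W)"
    "\<And>b. b \<in> ball a r \<Longrightarrow> res X ?W {h b} (n b) = \<mu> (h b)"
    by metis
  have "n constant_on ball a r"
  proof (rule locally_constant_imp_constant)
    fix c assume c: "c \<in> ball a r"
    then have hc: "h c \<in> topspace X" using Wt by auto
    obtain V m where V: "openin X V" "h c \<in> V" "m \<in> carrier (lhom X V)" "\<And>y. y \<in> V \<Longrightarrow> res X V {y} m = \<mu> y"
    proof -
      have "\<exists>V m. openin X V \<and> h c \<in> V \<and> m \<in> carrier (lhom X V) \<and> (\<forall>y\<in>V. res X V {y} m = \<mu> y)"
        using \<mu>[unfolded surface_orientation_def, THEN conjunct2] hc by (rule bspec)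
      then show ?thesis by (elim exE conjE) (rule that, assumption+, erule bspec)
    qed
    have "open (h -` V)"
    proof -
      have "continuous_map euclidean X h"
        using ch homeomorphic_imp_continuous_map[of euclidean "subtopology X U" h]
        by (simp add: chart_def continuous_map_in_subtopology)
      then show ?thesis
        using openin_continuous_map_preimage[of euclidean X h V] V(1) by (simp add: vimage_def)
    qed
    then have "open (h -` V \<inter> ball a r)" by auto
    then obtain e where e: "e > 0" "ball c e \<subseteq> h -` V \<inter> ball a r"
      using c V(2) open_contains_ball by (metis IntI vimageI2)
    let ?W' = "h ` ball c e"
    have sub: "?W' \<subseteq> V" "?W' \<subseteq> ?W" using e by auto
    have inj': "inj_on (res X ?W' {h b}) (carrier (lhom X ?W'))" if "b \<in> ball c e" for b
      using iso_res[OF X ch that] by (auto simp: iso_def bij_betw_def)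
    have 1: "res X ?W ?W' (n b) = res X V ?W' m" if b: "b \<in> ball c e" for b
    proof (rule inj_onD[OF inj'[OF b]])
      have ba: "b \<in> ball a r" "h b \<in> V" using b e by auto
      show "res X ?W' {h b} (res X ?W ?W' (n b)) = res X ?W' {h b} (res X V ?W' m)"
        using n(2)[OF ba(1)] V(4)[OF ba(2)] sub b by (simp add: res_res)
    qed (auto simp: res_carrier)
    have cc: "c \<in> ball c e" using e by simp
    have "n b = n c" if b: "b \<in> ball c e" for b
    proof -
      have ba: "b \<in> ball a r" using b e by auto
      have "res X ?W' {h c} (res X ?W ?W' (n b)) = res X ?W' {h c} (res X ?W ?W' (n c))"
        using 1[OF b] 1[OF cc] by simp
      then have "res X ?W {h c} (n b) = res X ?W {h c} (n c)"
        using sub cc by (simp add: res_res)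
      then show ?thesis
        by (rule inj_onD[OF bij_betw_imp_inj_on[OF bij[OF c]] _ n(1)[OF ba] n(1)[OF c]])
    qed
    moreover have "openin (top_of_set (ball a r)) (ball c e)"
      using e by (intro open_subset) auto
    ultimately show "\<exists>T. openin (top_of_set (ball a r)) T \<and> c \<in> T \<and> (\<forall>x\<in>T. n x = n c)"
      using cc by blast
  qed (rule connected_ball)
  then obtain n0 where n0: "\<And>b. b \<in> ball a r \<Longrightarrow> n b = n0" unfolding constant_on_def by blast
  have a: "a \<in> ball a r" using r by simp
  have "n0 \<in> carrier (lhom X ?W)" "\<And>b. b \<in> ball a r \<Longrightarrow> res X ?W {h b} n0 = \<mu> (h b)"
    using n(1)[OF a] n(2) n0[OF a] n0 by auto
  then show ?thesis using that[of n0] by blast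
qed

subsection \<open>Geometric simplices\<close>

text \<open>The closed simplex on the vertex set \<open>\<sigma>\<close> in barycentric coordinates.
  As all simplices share one coordinate space, two of them meet exactly in the simplex on their
  common vertices.\<close>

definition fc :: "nat set \<Rightarrow> (nat \<Rightarrow> real) set" where
  "fc \<sigma> = {t. (\<forall>i. 0 \<le> t i) \<and> (\<forall>i. i \<notin> \<sigma> \<longrightarrow> t i = 0) \<and> sum t \<sigma> = 1}"

lemma fc_le_1:
  assumes "finite \<sigma>" "t \<in> fc \<sigma>"
  shows "t i \<le> 1"
proof (cases "i \<in> \<sigma>")
  case True
  then have "t i \<le> sum t \<sigma>"
    using assms by (intro member_le_sum) (auto simp: fc_def)
  then show ?thesis using assms by (simp add: fc_def)
qed (use assms in \<open>auto simp: fc_def\<close>)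

lemma continuous_on_coord: "continuous_on A (\<lambda>t::nat \<Rightarrow> real. t i)"
  by (rule continuous_on_subset[OF continuous_on_product_coordinates]) simp

lemma compact_fc:
  assumes "finite \<sigma>"
  shows "compact (fc \<sigma>)"
proof -
  have "compactin (product_topology (\<lambda>i. euclideanreal) UNIV) (PiE UNIV (\<lambda>i. {0..1}))"
    by (simp add: compactin_PiE)
  then have c: "compact (PiE UNIV (\<lambda>i::nat. {0..1::real}))"
    by (simp add: euclidean_product_topology)
  have "closed {t::nat \<Rightarrow> real. 0 \<le> t i}" for i
    by (intro closed_Collect_le continuous_on_const continuous_on_coord)
  moreover have "closed {t::nat \<Rightarrow> real. t i = 0}" for i
    by (intro closed_Collect_eq continuous_on_const continuous_on_coord)
  moreover have "closed {t::nat \<Rightarrow> real. sum t \<sigma> = 1}"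
    by (intro closed_Collect_eq continuous_on_const continuous_on_sum continuous_on_coord)
  moreover have "fc \<sigma> = (\<Inter>i. {t. 0 \<le> t i}) \<inter> (\<Inter>i\<in>-\<sigma>. {t. t i = 0}) \<inter> {t. sum t \<sigma> = 1}"
    by (auto simp: fc_def)
  ultimately have "closed (fc \<sigma>)" by (simp add: closed_INT closed_Int)
  moreover have "fc \<sigma> \<subseteq> PiE UNIV (\<lambda>i. {0..1})"
    using fc_le_1[OF assms] by (auto simp: fc_def PiE_def)
  ultimately show ?thesis
    using compact_Int_closed[OF c] by (metis Int_absorb1)
qed

lemma seg_fc: "x \<in> fc \<sigma> \<Longrightarrow> y \<in> fc \<sigma> \<Longrightarrow> t \<in> {0..1} \<Longrightarrow> seg t x y \<in> fc \<sigma>"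
  by (auto simp: fc_def seg_def sum.distrib sum_distrib_left[symmetric])

lemma connected_fc: "connected (fc \<sigma>)"
proof (cases "fc \<sigma> = {}")
  case False
  then obtain a where a: "a \<in> fc \<sigma>" by blast
  have "contractible_space (top_of_set (fc \<sigma>))"
    by (rule contractible_space_star[where a = a]) (simp add: seg_fc a)
  then have "connected_space (top_of_set (fc \<sigma>))"
    by (intro path_connected_imp_connected_space contractible_imp_path_connected_space)
  then show ?thesis by (simp add: connectedin_def flip: connectedin_iff_connected)
qed simp

definition ev :: "nat \<Rightarrow> nat \<Rightarrow> real" where
  "ev w = (\<lambda>i. if i = w then 1 else 0)"

lemma ev_fc: "finite \<sigma> \<Longrightarrow> w \<in> \<sigma> \<Longrightarrow> ev w \<in> fc \<sigma>"
  by (simp add: fc_def ev_def)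

subsection \<open>The cone over a cycle is a disk\<close>

text \<open>Polar coordinates on the cone with apex \<open>w\<close> over the cycle
  \<open>xs\<close>: \<open>\<rho>\<close> measures the way from the apex to the base, and
  \<open>\<theta>\<close> runs from 0 to the length of the cycle, its integer part naming an edge
  and its fractional part a position on that edge.\<close>

definition polar :: "nat \<Rightarrow> nat list \<Rightarrow> real \<Rightarrow> real \<Rightarrow> nat \<Rightarrow> real" where
  "polar w xs \<rho> \<theta> = (\<lambda>y. if y = w then 1 - \<rho>
     else if y = xs ! nat \<lfloor>\<theta>\<rfloor> then \<rho> * (1 - frac \<theta>)
     else if y = xs ! (Suc (nat \<lfloor>\<theta>\<rfloor>) mod length xs) then \<rho> * frac \<theta> else 0)"

text \<open>Only in a cycle of length at most 2 can two positions be successors of each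
  other.\<close>

lemma mod_cycle_asym:
  fixes i j n :: nat
  assumes n: "3 \<le> n" and i: "i < n" and j: "j < n" and ij: "i = Suc j mod n" and ji: "j = Suc i mod n"
  shows False
proof -
  have "(Suc j = n \<and> i = 0) \<or> i = Suc j"
    using j unfolding ij by (cases "Suc j = n") auto
  moreover have "(Suc i = n \<and> j = 0) \<or> j = Suc i"
    using i unfolding ji by (cases "Suc i = n") auto
  ultimately show False using n by (elim disjE conjE) linarith+
qed

locale cycle_cone =
  fixes w :: nat and xs :: "nat list"
  assumes dist: "distinct xs" and len: "3 \<le> length xs" and w: "w \<notin> set xs"
begin

abbreviation "n \<equiv> length xs"

definition tri :: "nat \<Rightarrow> nat set" where
  "tri i = {w, xs ! i, xs ! (Suc i mod n)}"

definition cst :: "(nat \<Rightarrow> real) set" where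
  "cst = (\<Union>i<n. fc (tri i))"

lemma n0: "0 < n" using len by linarith

lemma nth_neq: "i < n \<Longrightarrow> xs ! i \<noteq> xs ! (Suc i mod n)"
proof
  assume i: "i < n" and e: "xs ! i = xs ! (Suc i mod n)"
  have "Suc i mod n < n" using n0 by simp
  then have "i = Suc i mod n" using e i dist by (simp add: nth_eq_iff_index_eq)
  then show False using i len by (cases "Suc i = n") auto
qed

lemma nth_w: "i < n \<Longrightarrow> xs ! i \<noteq> w" "xs ! (Suc i mod n) \<noteq> w"
  using w n0 by (metis nth_mem, metis mod_less_divisor nth_mem)

lemma finite_tri [simp]: "finite (tri i)" by (simp add: tri_def)

lemma sum_tri: "i < n \<Longrightarrow> sum t (tri i) = t w + t (xs ! i) + t (xs ! (Suc i mod n))" for t :: "nat \<Rightarrow> real"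
  using nth_neq[of i] nth_w[of i] unfolding tri_def by (auto simp: insert_commute)

lemma fl: "0 \<le> \<theta> \<Longrightarrow> \<theta> < real n \<Longrightarrow> nat \<lfloor>\<theta>\<rfloor> < n" 
  by linarith

lemma polar_in:
  assumes "0 \<le> \<rho>" "\<rho> \<le> 1" "0 \<le> \<theta>" "\<theta> < real n"
  shows "polar w xs \<rho> \<theta> \<in> fc (tri (nat \<lfloor>\<theta>\<rfloor>))"
proof -
  let ?i = "nat \<lfloor>\<theta>\<rfloor>"
  have i: "?i < n" using fl assms by simp
  have f: "0 \<le> frac \<theta>" "frac \<theta> < 1" by (auto simp: frac_lt_1)
  have "sum (polar w xs \<rho> \<theta>) (tri ?i) = 1"
    unfolding sum_tri[OF i] using nth_neq[OF i] nth_w[of ?i] i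
    by (simp add: polar_def algebra_simps)
  then show ?thesis
    using assms f by (auto simp: fc_def tri_def polar_def)
qed

lemma polar_cst:
  "0 \<le> \<rho> \<Longrightarrow> \<rho> \<le> 1 \<Longrightarrow> 0 \<le> \<theta> \<Longrightarrow> \<theta> < real n \<Longrightarrow> polar w xs \<rho> \<theta> \<in> cst"
  using polar_in[of \<rho> \<theta>] fl[of \<theta>] by (auto simp: cst_def)

text \<open>The strict inequality excludes the apex and the ray through the second base vertex.
  There the fractional part would have to be 1, so that ray takes its coordinates from the next
  triangle.\<close>

lemma fc_polar:
  assumes i: "i < n" and t: "t \<in> fc (tri i)" and "t (xs ! (Suc i mod n)) < 1 - t w"
  shows "t = polar w xs (1 - t w) (real i + t (xs ! (Suc i mod n)) / (1 - t w))"
proof -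
  let ?l = "t (xs ! (Suc i mod n)) / (1 - t w)"
  have p: "0 \<le> t (xs ! (Suc i mod n))" using t by (simp add: fc_def)
  then have l: "0 \<le> ?l" "?l < 1" using assms(3) by auto
  have fl: "\<lfloor>real i + ?l\<rfloor> = int i" using l by linarith
  have fr: "frac (real i + ?l) = ?l" unfolding frac_def fl by simp
  have s: "t w + t (xs ! i) + t (xs ! (Suc i mod n)) = 1"
    using t sum_tri[OF i, of t] by (simp add: fc_def)
  have z: "t y = 0" if "y \<noteq> w" "y \<noteq> xs ! i" "y \<noteq> xs ! (Suc i mod n)" for y
    using t that by (auto simp: fc_def tri_def)
  have m: "(1 - t w) * ?l = t (xs ! (Suc i mod n))" using assms(3) p by simp
  show ?thesis
    unfolding polar_def fl fr nat_int right_diff_distrib m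
    using s z nth_w[of i] i by (auto simp: fun_eq_iff)
qed

text \<open>The first vertex of the edge named by the angle has positive weight. If two angles named
  different edges, each first vertex would have to be the second vertex of the other edge, which
  \<open>mod_cycle_asym\<close> forbids.\<close>

lemma polar_inj:
  assumes 1: "0 \<le> \<theta>" "\<theta> < real n" and 2: "0 \<le> \<theta>'" "\<theta>' < real n" and \<rho>: "0 < \<rho>"
    and eq: "polar w xs \<rho> \<theta> = polar w xs \<rho>' \<theta>'"
  shows "\<rho> = \<rho>'" "\<theta> = \<theta>'"
proof -
  show r: "\<rho> = \<rho>'" using fun_cong[OF eq, of w] by (simp add: polar_def)
  let ?i = "nat \<lfloor>\<theta>\<rfloor>" and ?j = "nat \<lfloor>\<theta>'\<rfloor>"
  have i: "?i < n" and j: "?j < n" using fl 1 2 by auto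
  have f: "0 < 1 - frac \<theta>" "0 < 1 - frac \<theta>'" by (auto simp: frac_lt_1)
  have ii: "polar w xs \<rho> \<theta> (xs ! ?i) > 0" and jj: "polar w xs \<rho>' \<theta>' (xs ! ?j) > 0"
    using nth_w i j f \<rho> r by (auto simp: polar_def)
  have "?i = ?j"
  proof (rule ccontr)
    assume ne: "?i \<noteq> ?j"
    then have nx: "xs ! ?i \<noteq> xs ! ?j" using dist i j by (simp add: nth_eq_iff_index_eq)
    have "xs ! ?i = xs ! (Suc ?j mod n)"
      using ii nx nth_w[of ?i] i unfolding eq by (auto simp: polar_def split: if_splits)
    then have a: "?i = Suc ?j mod n" using dist i n0 by (simp add: nth_eq_iff_index_eq)
    have "xs ! ?j = xs ! (Suc ?i mod n)"
      using jj nx nth_w[of ?j] j unfolding eq[symmetric] by (auto simp: polar_def split: if_splits)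
    then have b: "?j = Suc ?i mod n" using dist j n0 by (simp add: nth_eq_iff_index_eq)
    show False using mod_cycle_asym[OF len i j a b] .
  qed
  moreover have "polar w xs \<rho> \<theta> (xs ! ?i) = \<rho> * (1 - frac \<theta>)" "polar w xs \<rho>' \<theta>' (xs ! ?j) = \<rho>' * (1 - frac \<theta>')"
    using nth_w i j by (auto simp: polar_def)
  ultimately have "frac \<theta> = frac \<theta>'" using eq r \<rho> by auto
  moreover have "\<lfloor>\<theta>\<rfloor> = \<lfloor>\<theta>'\<rfloor>" using \<open>?i = ?j\<close> 1 2 by (simp add: eq_nat_nat_iff)
  ultimately show "\<theta> = \<theta>'" by (simp add: frac_def)
qed

definition angle :: "real \<Rightarrow> complex" where
  "angle \<theta> = cis (2 * pi * \<theta> / real n)"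

lemma angle_n: "angle (real n) = angle 0"
  using n0 by (simp add: angle_def)

text \<open>Covers the two places missing from \<open>fc_polar\<close>: at the apex any angle works,
  and on the far ray the angle of the next triangle is taken, which is 0 after the last one. The
  final conclusion says that this change does not affect the point in the plane.\<close>

lemma fc_rep:
  assumes i: "i < n" and t: "t \<in> fc (tri i)"
  obtains \<theta> where "0 \<le> \<theta>" "\<theta> < real n" "t = polar w xs (1 - t w) \<theta>"
    "complex_of_real (1 - t w) * angle \<theta> = complex_of_real (1 - t w) * angle (real i + t (xs ! (Suc i mod n)) / (1 - t w))"
proof -
  let ?y = "t (xs ! (Suc i mod n))"
  have s: "t w + t (xs ! i) + ?y = 1" and p: "0 \<le> ?y" "0 \<le> t (xs ! i)"
    using t sum_tri[OF i, of t] by (simp_all add: fc_def)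
  consider "?y < 1 - t w" | "t w = 1" | "?y = 1 - t w" "t w < 1" using s p by linarith
  then show ?thesis
  proof cases
    case 1
    have l: "0 \<le> ?y / (1 - t w)" "?y / (1 - t w) < 1" using 1 p by auto
    show ?thesis
    proof (rule that[OF _ _ fc_polar[OF i t 1] refl])
      show "0 \<le> real i + ?y / (1 - t w)" using l by simp
      show "real i + ?y / (1 - t w) < real n" using l i by linarith
    qed
  next
    case 2
    then have "t (xs ! i) = 0" "?y = 0" using s p by linarith+
    then have z: "t y = 0" if "y \<noteq> w" for y
      using s p t that by (cases "y = xs ! i"; cases "y = xs ! (Suc i mod n)") (auto simp: fc_def tri_def)
    have e: "t = polar w xs (1 - t w) 0" using 2 z by (auto simp: polar_def fun_eq_iff)
    show ?thesis by (rule that[OF _ _ e]) (use 2 n0 in simp_all)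
  next
    case 3
    let ?j = "Suc i mod n"
    have j: "?j < n" using n0 by simp
    have z: "t y = 0" if "y \<noteq> w" "y \<noteq> xs ! ?j" for y
      using s t 3 that by (cases "y = xs ! i") (auto simp: fc_def tri_def)
    have e: "t = polar w xs (1 - t w) (real ?j)"
      using z 3 nth_w(1)[OF j] by (auto simp: polar_def fun_eq_iff)
    have a: "angle (real ?j) = angle (real i + ?y / (1 - t w))"
    proof (cases "Suc i = n")
      case True
      then have "real i + 1 = real n" by linarith
      moreover have "?y / (1 - t w) = 1" using 3 by simp
      ultimately have "real i + ?y / (1 - t w) = real n" by linarith
      moreover have "real ?j = 0" using True by simp
      ultimately show ?thesis using angle_n by metis
    next
      case False
      then have "?j = Suc i" using i by simp
      then show ?thesis using 3 by (simp add: add.commute)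
    qed
    show ?thesis by (rule that[OF _ _ e]) (use j a in simp_all)
  qed
qed

text \<open>The angle is a choice only at the apex, where the factor in front of it
  vanishes.\<close>

definition chi :: "(nat \<Rightarrow> real) \<Rightarrow> complex" where
  "chi t = (let \<theta> = SOME \<theta>. 0 \<le> \<theta> \<and> \<theta> < real n \<and> t = polar w xs (1 - t w) \<theta>
     in complex_of_real (1 - t w) * angle \<theta>)"

lemma chi_polar:
  assumes "0 \<le> \<rho>" "0 \<le> \<theta>" "\<theta> < real n"
  shows "chi (polar w xs \<rho> \<theta>) = complex_of_real \<rho> * angle \<theta>"
proof -
  let ?P = "\<lambda>t \<theta>. 0 \<le> \<theta> \<and> \<theta> < real n \<and> t = polar w xs (1 - t w) \<theta>"
  let ?t = "polar w xs \<rho> \<theta>"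
  have r: "1 - ?t w = \<rho>" by (simp add: polar_def)
  have "?P ?t \<theta>" using assms r by simp
  then have P: "?P ?t (SOME \<theta>. ?P ?t \<theta>)" by (rule someI)
  show ?thesis
  proof (cases "\<rho> = 0")
    case True then show ?thesis using r by (simp add: chi_def)
  next
    case False
    then have "\<theta> = (SOME \<theta>. ?P ?t \<theta>)"
      using P polar_inj(2)[of \<theta> "SOME \<theta>. ?P ?t \<theta>" \<rho> \<rho>] assms unfolding r by (metis less_eq_real_def)
    then show ?thesis using r by (simp add: chi_def Let_def)
  qed
qed

lemma chi_fc:
  assumes "i < n" "t \<in> fc (tri i)"
  shows "chi t = complex_of_real (1 - t w) * angle (real i + t (xs ! (Suc i mod n)) / (1 - t w))"
proof -
  have tw: "t w \<le> 1" using fc_le_1[OF finite_tri assms(2)] .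
  obtain \<theta> where \<theta>: "0 \<le> \<theta>" "\<theta> < real n" "t = polar w xs (1 - t w) \<theta>"
    "complex_of_real (1 - t w) * angle \<theta> = complex_of_real (1 - t w) * angle (real i + t (xs ! (Suc i mod n)) / (1 - t w))"
    using fc_rep[OF assms] by metis
  have "chi (polar w xs (1 - t w) \<theta>) = complex_of_real (1 - t w) * angle \<theta>"
    by (rule chi_polar) (use tw \<theta> in auto)
  then show ?thesis unfolding \<theta>(3)[symmetric] \<theta>(4) .
qed

lemma norm_chi: "t \<in> cst \<Longrightarrow> norm (chi t) = 1 - t w"
proof -
  assume "t \<in> cst"
  then obtain i where i: "i < n" "t \<in> fc (tri i)" by (auto simp: cst_def)
  have "t w \<le> 1" using fc_le_1[OF finite_tri i(2)] .
  then show ?thesis by (simp add: chi_fc[OF i] angle_def norm_mult del: of_real_diff)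
qed

text \<open>Finitely many closed triangles are pasted together, on each of which
  \<open>chi_fc\<close> gives a formula. It is visibly continuous away from the apex; at the apex
  the angle has no limit, but the modulus 1 - t w tends to 0.\<close>

lemma continuous_chi: "continuous_on cst chi"
  unfolding cst_def
proof (rule continuous_on_closed_Union)
  fix i assume "i \<in> {..<n}"
  then have i: "i < n" by simp
  show "closed (fc (tri i))" by (simp add: compact_fc compact_imp_closed)
  let ?f = "\<lambda>t. complex_of_real (1 - t w) * angle (real i + t (xs ! (Suc i mod n)) / (1 - t w))"
  have "continuous_on (fc (tri i)) ?f"
    unfolding continuous_on_def
  proof
    fix s assume s: "s \<in> fc (tri i)"
    show "(?f \<longlongrightarrow> ?f s) (at s within fc (tri i))"
    proof (cases "s w = 1")
      case False
      have "((\<lambda>t. t y) \<longlongrightarrow> s y) (at s within fc (tri i))" for y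
        using continuous_on_coord[of "fc (tri i)" y] s by (simp add: continuous_on_def)
      then show ?thesis
        unfolding angle_def using False n0 by (intro tendsto_intros) auto
    next
      case True
      have "((\<lambda>t. t w) \<longlongrightarrow> 1) (at s within fc (tri i))"
        using continuous_on_coord[of "fc (tri i)" w] s True by (force simp: continuous_on_def)
      then have "((\<lambda>t. 1 - t w) \<longlongrightarrow> 1 - 1) (at s within fc (tri i))"
        by (intro tendsto_intros)
      moreover have "\<forall>\<^sub>F t in at s within fc (tri i). norm (?f t) \<le> 1 - t w"
        using fc_le_1[OF finite_tri] by (auto simp: eventually_at_filter angle_def norm_mult simp del: of_real_diff intro!: always_eventually)
      ultimately have "(?f \<longlongrightarrow> 0) (at s within fc (tri i))"
        by (intro Lim_null_comparison[of ?f "\<lambda>t. 1 - t w"]) auto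
      then show ?thesis using True by simp
    qed
  qed
  then show "continuous_on (fc (tri i)) chi"
    using chi_fc[OF i] by (simp cong: continuous_on_cong)
qed simp

lemma cst_rep:
  assumes "t \<in> cst"
  obtains \<theta> where "0 \<le> \<theta>" "\<theta> < real n" "t = polar w xs (1 - t w) \<theta>"
  using assms fc_rep unfolding cst_def by (metis UN_E lessThan_iff)

lemma Arg2pi_angle:
  assumes "0 < \<rho>" "0 \<le> \<theta>" "\<theta> < real n"
  shows "Arg2pi (complex_of_real \<rho> * angle \<theta>) = 2 * pi * \<theta> / real n"
proof (rule Arg2pi_unique)
  show "complex_of_real \<rho> * exp (\<i> * complex_of_real (2 * pi * \<theta> / real n)) = complex_of_real \<rho> * angle \<theta>"
    by (simp add: angle_def cis_conv_exp)
  show "2 * pi * \<theta> / real n < 2 * pi" using assms n0 by (simp add: divide_less_eq)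
qed (use assms in auto)

lemma inj_chi: "inj_on chi cst"
proof (rule inj_onI)
  fix s t assume s: "s \<in> cst" and t: "t \<in> cst" and e: "chi s = chi t"
  obtain \<theta> where \<theta>: "0 \<le> \<theta>" "\<theta> < real n" "s = polar w xs (1 - s w) \<theta>" using cst_rep[OF s] by metis
  obtain \<phi> where \<phi>: "0 \<le> \<phi>" "\<phi> < real n" "t = polar w xs (1 - t w) \<phi>" using cst_rep[OF t] by metis
  have st: "s w = t w" using norm_chi[OF s] norm_chi[OF t] e by simp
  have r: "0 \<le> 1 - s w" using norm_chi[OF s] by (metis norm_ge_zero)
  show "s = t"
  proof (cases "s w = 1")
    case True
    then have "polar w xs (1 - s w) \<theta> = polar w xs (1 - t w) \<phi>" using st by (auto simp: polar_def fun_eq_iff)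
    then show ?thesis using \<theta>(3) \<phi>(3) by simp
  next
    case False
    then have p: "0 < 1 - s w" using r by simp
    define R where "R = 1 - s w"
    have "chi s = complex_of_real R * angle \<theta>" unfolding R_def using chi_polar[of "1 - s w" \<theta>] \<theta> r by simp
    moreover have "chi t = complex_of_real R * angle \<phi>" unfolding R_def using chi_polar[of "1 - t w" \<phi>] \<phi> r st by simp
    ultimately have "2 * pi * \<theta> / real n = 2 * pi * \<phi> / real n"
      using e Arg2pi_angle[OF p \<theta>(1,2)] Arg2pi_angle[OF p \<phi>(1,2)] unfolding R_def[symmetric] by metis
    then have "\<theta> = \<phi>" using n0 by simp
    then show ?thesis using \<theta>(3) \<phi>(3) st by simp
  qed
qed

lemma image_chi: "chi ` cst = cball 0 1"
proof (intro equalityI subsetI)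
  fix z assume "z \<in> chi ` cst"
  then obtain t where t: "t \<in> cst" "z = chi t" by blast
  then have "0 \<le> t w" by (auto simp: cst_def fc_def)
  then show "z \<in> cball 0 1" using norm_chi[OF t(1)] t(2) by simp
next
  fix z :: complex assume z: "z \<in> cball 0 1"
  let ?\<theta> = "Arg2pi z * real n / (2 * pi)"
  have \<theta>: "0 \<le> ?\<theta>" "?\<theta> < real n"
    using Arg2pi_ge_0[of z] Arg2pi_lt_2pi[of z] n0 by (auto simp: divide_less_eq)
  have "chi (polar w xs (norm z) ?\<theta>) = complex_of_real (norm z) * angle ?\<theta>"
    by (rule chi_polar) (use \<theta> in auto)
  also have "2 * pi * ?\<theta> / real n = Arg2pi z" using n0 by simp
  then have "angle ?\<theta> = exp (\<i> * complex_of_real (Arg2pi z))" by (simp add: angle_def cis_conv_exp)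
  then have "complex_of_real (norm z) * angle ?\<theta> = z" using Arg2pi_eq[of z] by simp
  finally have "z = chi (polar w xs (norm z) ?\<theta>)" by simp
  moreover have "polar w xs (norm z) ?\<theta> \<in> cst" using \<theta> z by (intro polar_cst) auto
  ultimately show "z \<in> chi ` cst" by blast
qed

lemma compact_cst: "compact cst"
  unfolding cst_def by (intro compact_UN) (auto simp: compact_fc)

text \<open>A continuous bijection from a compact set onto the disk is a homeomorphism, and the
  modulus 1 - t w tells the interior from the boundary circle.\<close>

lemma cone_homeomorphism:
  obtains h where "homeomorphism (cball 0 1) cst h chi"
    "h ` ball 0 1 = {t \<in> cst. 0 < t w}" "h ` sphere 0 1 = {t \<in> cst. t w = 0}"
proof -
  obtain h where h: "homeomorphism cst (cball 0 1) chi h"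
    using homeomorphism_compact[OF compact_cst continuous_chi image_chi inj_chi] by blast
  then have hs: "homeomorphism (cball 0 1) cst h chi" using homeomorphism_sym by blast
  have *: "h ` A = {t \<in> cst. chi t \<in> A}" if "A \<subseteq> cball 0 1" for A
  proof (intro equalityI subsetI)
    fix t assume "t \<in> h ` A"
    then obtain z where z: "z \<in> A" "t = h z" by blast
    then have "z \<in> cball 0 1" using that by blast
    then have "h z \<in> cst" "chi (h z) = z" using hs by (auto simp: homeomorphism_def)
    then show "t \<in> {t \<in> cst. chi t \<in> A}" using z by simp
  next
    fix t assume t: "t \<in> {t \<in> cst. chi t \<in> A}"
    then have "t = h (chi t)" using hs by (auto simp: homeomorphism_def)
    then show "t \<in> h ` A" using t by blast
  qed
  show ?thesis
  proof (rule that[OF hs])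
    show "h ` ball 0 1 = {t \<in> cst. 0 < t w}"
      unfolding *[OF ball_subset_cball] using norm_chi by auto
    show "h ` sphere 0 1 = {t \<in> cst. t w = 0}"
      unfolding *[OF sphere_cball] using norm_chi by auto
  qed
qed

end

context cycle_cone
begin

text \<open>Successor modulo n is injective, so two different triangles at \<open>w\<close> share a
  second vertex only if they are consecutive.\<close>

lemma tri_share:
  assumes i: "i < n" and j: "j < n" and ne: "i \<noteq> j" and q: "q \<in> tri i" "q \<in> tri j" "q \<noteq> w"
  shows "(j = Suc i mod n \<and> q = xs ! j) \<or> (i = Suc j mod n \<and> q = xs ! i)"
proof -
  have eq: "xs ! a = xs ! b \<longleftrightarrow> a = b" if "a < n" "b < n" for a b
    using dist that by (simp add: nth_eq_iff_index_eq)
  have s: "Suc i mod n < n" "Suc j mod n < n" using n0 by simp_all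
  have inj: "Suc i mod n \<noteq> Suc j mod n"
    using i j ne by (auto simp: mod_Suc split: if_splits)
  show ?thesis
    using q ne inj eq[OF i j] eq[OF i s(2)] eq[OF s(1) j] eq[OF s] unfolding tri_def by auto
qed

lemma tri_inj: "i < n \<Longrightarrow> j < n \<Longrightarrow> tri i = tri j \<Longrightarrow> i = j"
proof (rule ccontr)
  assume i: "i < n" and j: "j < n" and e: "tri i = tri j" and ne: "i \<noteq> j"
  have s: "Suc i mod n < n" using n0 by simp
  have q: "xs ! i \<in> tri i" "xs ! (Suc i mod n) \<in> tri i" by (auto simp: tri_def)
  have "(j = Suc i mod n \<and> xs ! i = xs ! j) \<or> i = Suc j mod n"
    using tri_share[OF i j ne q(1)] q e nth_w(1)[OF i] nth_w(2)[of i] by auto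
  then have 1: "i = Suc j mod n"
    using dist i j ne by (auto simp: nth_eq_iff_index_eq)
  have "j = Suc i mod n \<or> (xs ! (Suc i mod n) = xs ! i)"
    using tri_share[OF i j ne q(2)] q e nth_w(1)[OF i] nth_w(2)[of i] by auto
  then have 2: "j = Suc i mod n" using nth_neq[OF i] by auto
  show False using mod_cycle_asym[OF len i j 1 2] .
qed

lemma tri_next: "i < n \<Longrightarrow> \<exists>j<n. j \<noteq> i \<and> xs ! (Suc i mod n) \<in> tri j"
  using nth_neq[of i] n0 by (intro exI[of _ "Suc i mod n"]) (auto simp: tri_def)

lemma tri_prev: "i < n \<Longrightarrow> \<exists>j<n. j \<noteq> i \<and> xs ! i \<in> tri j"
proof -
  assume i: "i < n"
  obtain j where j: "j < n" "Suc j mod n = i"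
  proof (cases i)
    case 0 then show ?thesis using n0 that[of "n - 1"] by simp
  next
    case (Suc k) then show ?thesis using i that[of k] by simp
  qed
  then have "j \<noteq> i" using nth_neq[of j] by auto
  then show ?thesis using j by (auto simp: tri_def)
qed

end

lemma homeomorphism_imp_maps:
  "homeomorphism S T f g \<Longrightarrow> homeomorphic_maps (top_of_set S) (top_of_set T) f g"
  by (auto simp: homeomorphism_def homeomorphic_maps_def continuous_map_in_subtopology)

lemma homeomorphic_imp_space:
  assumes "S homeomorphic T"
  shows "top_of_set S homeomorphic_space top_of_set T"
proof -
  obtain f g where "homeomorphism S T f g" using assms by (auto simp: homeomorphic_def)
  then show ?thesis
    using homeomorphism_imp_maps homeomorphic_maps_imp_homeomorphic_space by blast
qed

lemma cycle_edges_member: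
  assumes "x \<in> set xs"
  shows "\<exists>e\<in>cycle_edges xs. x \<in> e"
proof -
  obtain i where "i < length xs" "x = xs ! i" using assms by (auto simp: in_set_conv_nth)
  then show ?thesis unfolding cycle_edges_def by blast
qed

subsection \<open>Two-dimensional complexes whose links are cycles\<close>

text \<open>The colouring numbers the vertices of every triangle in a way that agrees on common
  sides; for flags it is the kind of the vertex. Links are prescribed as edge sets of one cycle, so
  that every closed star is a cone over a cycle.\<close>

locale surf =
  fixes T :: "nat set set" and col :: "nat \<Rightarrow> nat"
  assumes fin: "finite T" and ne: "T \<noteq> {}"
    and col: "\<And>\<sigma>. \<sigma> \<in> T \<Longrightarrow> bij_betw col \<sigma> {0, 1, 2}"
    and link: "\<And>w. w \<in> \<Union>T \<Longrightarrow> \<exists>xs. distinct xs \<and> 3 \<le> length xs \<and>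
        (\<lambda>\<sigma>. \<sigma> - {w}) ` {\<sigma> \<in> T. w \<in> \<sigma>} = cycle_edges xs"
    and conn: "\<And>w w'. w \<in> \<Union>T \<Longrightarrow> w' \<in> \<Union>T \<Longrightarrow> (w, w') \<in> {(x, y). \<exists>\<sigma>\<in>T. x \<in> \<sigma> \<and> y \<in> \<sigma>}\<^sup>*"
begin

definition K :: "(nat \<Rightarrow> real) set" where "K = (\<Union>\<sigma>\<in>T. fc \<sigma>)"

abbreviation X :: "(nat \<Rightarrow> real) topology" where "X \<equiv> top_of_set K"

definition star :: "nat \<Rightarrow> (nat \<Rightarrow> real) set" where "star w = {t \<in> K. 0 < t w}"

definition cstar :: "nat \<Rightarrow> (nat \<Rightarrow> real) set" where "cstar w = (\<Union>\<sigma>\<in>{\<sigma>\<in>T. w \<in> \<sigma>}. fc \<sigma>)"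

definition lnk :: "nat \<Rightarrow> (nat \<Rightarrow> real) set" where "lnk w = {t \<in> cstar w. t w = 0}"

lemma finite_T: "\<sigma> \<in> T \<Longrightarrow> finite \<sigma>" 
  using col bij_betw_finite by blast

lemma card_T: "\<sigma> \<in> T \<Longrightarrow> card \<sigma> = 3"
  using bij_betw_same_card[OF col] by simp

lemma sub_T: "\<sigma> \<in> T \<Longrightarrow> \<tau> \<in> T \<Longrightarrow> \<sigma> \<subseteq> \<tau> \<Longrightarrow> \<sigma> = \<tau>"
  using card_T finite_T card_subset_eq by metis

lemma cone_at:
  assumes w: "w \<in> \<Union>T"
  obtains xs where "cycle_cone w xs" "cycle_cone.tri w xs ` {..<length xs} = {\<sigma> \<in> T. w \<in> \<sigma>}"
proof -
  obtain xs where xs: "distinct xs" "3 \<le> length xs" "(\<lambda>\<sigma>. \<sigma> - {w}) ` {\<sigma> \<in> T. w \<in> \<sigma>} = cycle_edges xs"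
    using link[OF w] by blast
  have "w \<notin> set xs"
    using cycle_edges_member[of w xs] xs(3) by force
  then have c: "cycle_cone w xs" using xs by unfold_locales auto
  have "cycle_cone.tri w xs ` {..<length xs} = insert w ` cycle_edges xs"
    by (auto simp: cycle_cone.tri_def[OF c] cycle_edges_def)
  also have "\<dots> = {\<sigma> \<in> T. w \<in> \<sigma>}"
    unfolding xs(3)[symmetric] image_image by (auto simp: insert_absorb)
  finally show ?thesis using c that by blast
qed

lemma star_cstar: "star w = {t \<in> cstar w. 0 < t w}"
proof (intro equalityI subsetI)
  fix t assume "t \<in> star w"
  then obtain \<sigma> where s: "\<sigma> \<in> T" "t \<in> fc \<sigma>" "0 < t w" by (auto simp: star_def K_def)
  then have "w \<in> \<sigma>" by (auto simp: fc_def)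
  then show "t \<in> {t \<in> cstar w. 0 < t w}" using s by (auto simp: cstar_def)
next
  fix t assume "t \<in> {t \<in> cstar w. 0 < t w}"
  then show "t \<in> star w" by (auto simp: star_def K_def cstar_def)
qed

lemma cst_cstar: "cycle_cone w xs \<Longrightarrow> cycle_cone.tri w xs ` {..<length xs} = {\<sigma> \<in> T. w \<in> \<sigma>} \<Longrightarrow> cycle_cone.cst w xs = cstar w"
  unfolding cycle_cone.cst_def cstar_def by (metis image_image)

lemma star_disk:
  assumes w: "w \<in> \<Union>T"
  obtains h g where "homeomorphism (cball 0 1) (cstar w) h g" "h ` ball (0::complex) 1 = star w" "h ` sphere 0 1 = lnk w"
proof -
  obtain xs where xs: "cycle_cone w xs" "cycle_cone.tri w xs ` {..<length xs} = {\<sigma> \<in> T. w \<in> \<sigma>}"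
    by (rule cone_at[OF w])
  obtain h where h: "homeomorphism (cball 0 1) (cycle_cone.cst w xs) h (cycle_cone.chi w xs)"
    "h ` ball 0 1 = {t \<in> cycle_cone.cst w xs. 0 < t w}" "h ` sphere 0 1 = {t \<in> cycle_cone.cst w xs. t w = 0}"
    by (rule cycle_cone.cone_homeomorphism[OF xs(1)])
  then show ?thesis
    using that[of h "cycle_cone.chi w xs"] unfolding cst_cstar[OF xs] star_cstar lnk_def by blast
qed

lemma open_star: "openin X (star w)"
proof -
  have "open {t::nat \<Rightarrow> real. 0 < t w}"
    by (intro open_Collect_less continuous_on_const continuous_on_coord)
  then show ?thesis
    unfolding star_def using openin_open_Int[of "{t. 0 < t w}" K] by (simp add: Int_def conj_commute)
qed

lemma compact_K: "compact K"
  unfolding K_def using fin finite_T by (intro compact_UN) (auto simp: compact_fc)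

lemma compact_cstar: "compact (cstar w)"
  unfolding cstar_def using fin finite_T by (intro compact_UN) (auto simp: compact_fc)

lemma cstar_K: "cstar w \<subseteq> K" by (auto simp: cstar_def K_def)

lemma star_K: "star w \<subseteq> K" by (auto simp: star_def)

lemma star_nonneg: "t \<in> K \<Longrightarrow> 0 \<le> t w" by (auto simp: K_def fc_def)

lemma in_some_star:
  assumes "t \<in> K"
  obtains w where "w \<in> \<Union>T" "t \<in> star w"
proof -
  obtain \<sigma> where s: "\<sigma> \<in> T" "t \<in> fc \<sigma>" using assms by (auto simp: K_def)
  then have "sum t \<sigma> \<noteq> 0" by (simp add: fc_def)
  then obtain w where "w \<in> \<sigma>" "t w \<noteq> 0" by (meson sum.neutral)
  moreover have "0 \<le> t w" using s by (simp add: fc_def)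
  ultimately show ?thesis using that[of w] s assms by (auto simp: star_def)
qed

lemma star_homeomorphic:
  assumes "w \<in> \<Union>T"
  shows "ball (0::complex) 1 homeomorphic star w"
proof -
  obtain h g where h: "homeomorphism (cball 0 1) (cstar w) h g" "h ` ball (0::complex) 1 = star w" "h ` sphere 0 1 = lnk w"
    by (rule star_disk[OF assms])
  have "homeomorphism (ball 0 1) (h ` ball 0 1) h g"
    by (rule homeomorphism_of_subsets[OF h(1)]) auto
  then show ?thesis using h(2) homeomorphic_def by metis
qed

lemma star_chart:
  assumes "w \<in> \<Union>T"
  obtains h where "chart X (star w) h"
proof -
  have "(UNIV::complex set) homeomorphic ball (0::complex) 1"
    using homeomorphic_ball01_UNIV homeomorphic_sym by blast
  then have "(UNIV::complex set) homeomorphic star w"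
    using star_homeomorphic[OF assms] homeomorphic_trans by blast
  then have "(euclidean::complex topology) homeomorphic_space top_of_set (star w)"
    using homeomorphic_imp_space by fastforce
  moreover have "subtopology X (star w) = top_of_set (star w)"
    using star_K by (simp add: subtopology_subtopology Int_absorb1)
  ultimately show ?thesis
    using that open_star by (auto simp: chart_def homeomorphic_space)
qed

lemma connected_K: "connected K"
  unfolding connected_iff_connected_component
proof (intro ballI)
  have tri: "connected_component K s t" if "\<sigma> \<in> T" "s \<in> fc \<sigma>" "t \<in> fc \<sigma>" for s t \<sigma>
    unfolding connected_component_def using that connected_fc[of \<sigma>] by (auto simp: K_def)
  have vert: "connected_component K (ev w) (ev w')"
    if a: "(w, w') \<in> {(x, y). \<exists>\<sigma>\<in>T. x \<in> \<sigma> \<and> y \<in> \<sigma>}\<^sup>*" "w \<in> \<Union>T" for w w'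
    using a(1)
  proof (induction rule: rtrancl_induct)
    case base
    obtain \<sigma> where "\<sigma> \<in> T" "w \<in> \<sigma>" using a(2) by blast
    then show ?case using tri[of \<sigma>] ev_fc[of \<sigma> w] finite_T by blast
  next
    case (step y z)
    then obtain \<sigma> where "\<sigma> \<in> T" "y \<in> \<sigma>" "z \<in> \<sigma>" by blast
    then have "connected_component K (ev y) (ev z)" using tri ev_fc finite_T by blast
    then show ?case using step.IH connected_component_trans by blast
  qed
  fix s t assume "s \<in> K" "t \<in> K"
  then obtain \<sigma> \<tau> where st: "\<sigma> \<in> T" "\<tau> \<in> T" "s \<in> fc \<sigma>" "t \<in> fc \<tau>" by (auto simp: K_def)
  then have "\<sigma> \<noteq> {}" "\<tau> \<noteq> {}" by (auto simp: fc_def)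
  then obtain w w' where w: "w \<in> \<sigma>" "w' \<in> \<tau>" by blast
  have "connected_component K s (ev w)" "connected_component K (ev w') t"
    using tri st w ev_fc finite_T by blast+
  moreover have "connected_component K (ev w) (ev w')"
    using vert conn[of w w'] st w by blast
  ultimately show "connected_component K s t" using connected_component_trans by blast
qed

lemma Hausdorff_X: "Hausdorff_space X"
  by (simp add: Hausdorff_space_subtopology)

text \<open>The coordinates of a point sum to 1, so one of them is positive and the point lies in an
  open star, which is an open disk.\<close>

lemma closed_surface_X: "closed_surface X"
  unfolding closed_surface_def
proof (intro conjI ballI)
  obtain \<sigma> where "\<sigma> \<in> T" using ne by blast
  moreover then obtain w where "w \<in> \<sigma>" using card_T by fastforce
  ultimately show "topspace X \<noteq> {}" using ev_fc[OF finite_T] by (auto simp: K_def)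
  show "connected_space X" using connected_K by (simp add: connectedin_def flip: connectedin_iff_connected)
  show "compact_space X" using compact_K by (simp add: compact_space_subtopology compactin_euclidean_iff)
  show "Hausdorff_space X" by (rule Hausdorff_X)
  fix t assume "t \<in> topspace X"
  then have "t \<in> K" by simp
  then obtain w where w: "w \<in> \<Union>T" "t \<in> star w" by (rule in_some_star)
  have "subtopology X (star w) = top_of_set (star w)"
    using star_K by (simp add: subtopology_subtopology Int_absorb1)
  then have "subtopology X (star w) homeomorphic_space open_disk"
    using homeomorphic_imp_space[OF homeomorphic_sym[THEN iffD1, OF star_homeomorphic[OF w(1)]]] by simp
  then show "\<exists>U. openin X U \<and> t \<in> U \<and> subtopology X U homeomorphic_space open_disk"
    using open_star w(2) by blast
qed

end

context surf
begin

subsection \<open>The simplices of a complex as singular simplices\<close>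

definition vt :: "nat set \<Rightarrow> nat \<Rightarrow> nat" where
  "vt \<sigma> j = the_inv_into \<sigma> col j"

lemma vt_in: "\<sigma> \<in> T \<Longrightarrow> j \<le> 2 \<Longrightarrow> vt \<sigma> j \<in> \<sigma>"
  and col_vt: "\<sigma> \<in> T \<Longrightarrow> j \<le> 2 \<Longrightarrow> col (vt \<sigma> j) = j"
proof -
  assume s: "\<sigma> \<in> T" and j: "j \<le> 2"
  have i: "inj_on col \<sigma>" and m: "j \<in> col ` \<sigma>"
    using col[OF s] j by (auto simp: bij_betw_def)
  show "vt \<sigma> j \<in> \<sigma>" unfolding vt_def by (rule the_inv_into_into[OF i m]) simp
  show "col (vt \<sigma> j) = j" unfolding vt_def by (rule f_the_inv_into_f[OF i m])
qed

lemma vt_col: "\<sigma> \<in> T \<Longrightarrow> p \<in> \<sigma> \<Longrightarrow> vt \<sigma> (col p) = p"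
  using col by (simp add: vt_def bij_betw_def the_inv_into_f_f)

lemma col_le: "\<sigma> \<in> T \<Longrightarrow> p \<in> \<sigma> \<Longrightarrow> col p \<le> 2"
  using bij_betw_apply[OF col, of \<sigma> p] by auto

lemma vt_eq:
  assumes "\<sigma> \<in> T" "i \<le> 2" "j \<le> 2"
  shows "vt \<sigma> i = vt \<sigma> j \<longleftrightarrow> i = j"
proof
  assume "vt \<sigma> i = vt \<sigma> j"
  then have "col (vt \<sigma> i) = col (vt \<sigma> j)" by (rule arg_cong)
  then show "i = j" unfolding col_vt[OF assms(1,2)] col_vt[OF assms(1,3)] .
qed (rule arg_cong)

lemma sigma_vt: "\<sigma> \<in> T \<Longrightarrow> \<sigma> = vt \<sigma> ` {..2}"
proof (intro equalityI subsetI)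
  fix p assume "\<sigma> \<in> T" "p \<in> \<sigma>"
  then have "p = vt \<sigma> (col p)" "col p \<le> 2" using vt_col col_le by auto
  then show "p \<in> vt \<sigma> ` {..2}" by blast
qed (use vt_in in auto)

definition smp :: "nat set \<Rightarrow> (nat \<Rightarrow> real) \<Rightarrow> nat \<Rightarrow> real" where
  "smp \<sigma> = oriented_simplex 2 (\<lambda>j. ev (vt \<sigma> j))"

definition bs :: "nat set \<Rightarrow> nat \<Rightarrow> real" where
  "bs \<sigma> = (\<lambda>i. if i \<in> \<sigma> then 1 / 3 else 0)"

abbreviation sc :: "nat set \<Rightarrow> (nat \<Rightarrow> real) chain" where
  "sc \<sigma> \<equiv> frag_of (smp \<sigma>)"

lemma smp_vt:
  assumes "\<sigma> \<in> T" "x \<in> standard_simplex 2" "j \<le> 2"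
  shows "smp \<sigma> x (vt \<sigma> j) = x j"
proof -
  have "smp \<sigma> x (vt \<sigma> j) = (\<Sum>i\<le>2. ev (vt \<sigma> i) (vt \<sigma> j) * x i)"
    using assms by (simp add: smp_def oriented_simplex_def)
  also have "\<dots> = (\<Sum>i\<le>2. if i = j then x i else 0)"
    by (rule sum.cong) (use assms vt_eq in \<open>auto simp: ev_def\<close>)
  finally show ?thesis using assms by simp
qed

lemma smp_0: "\<sigma> \<in> T \<Longrightarrow> x \<in> standard_simplex 2 \<Longrightarrow> p \<notin> \<sigma> \<Longrightarrow> smp \<sigma> x p = 0"
  using vt_in by (auto simp: smp_def oriented_simplex_def ev_def intro!: sum.neutral)

lemma sum_vt: "\<sigma> \<in> T \<Longrightarrow> sum t \<sigma> = (\<Sum>j\<le>2. t (vt \<sigma> j))" for t :: "nat \<Rightarrow> real"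
proof -
  assume s: "\<sigma> \<in> T"
  have "inj_on (vt \<sigma>) {..2}" using vt_eq[OF s] by (auto simp: inj_on_def)
  then have "sum t (vt \<sigma> ` {..2}) = (\<Sum>j\<le>2. t (vt \<sigma> j))" by (simp add: sum.reindex)
  then show ?thesis using sigma_vt[OF s] by simp
qed

lemma smp_fc:
  assumes s: "\<sigma> \<in> T" and x: "x \<in> standard_simplex 2"
  shows "smp \<sigma> x \<in> fc \<sigma>"
proof -
  have "0 \<le> smp \<sigma> x p" for p
  proof (cases "p \<in> \<sigma>")
    case True
    then have "p = vt \<sigma> (col p)" "col p \<le> 2" using vt_col col_le s by auto
    then show ?thesis using smp_vt[OF s x, of "col p"] x by (simp add: standard_simplex_def)
  qed (use smp_0 assms in simp)
  moreover have "sum (smp \<sigma> x) \<sigma> = 1"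
    unfolding sum_vt[OF s] using smp_vt[OF s x] x by (simp add: standard_simplex_def)
  ultimately show ?thesis using smp_0[OF s x] by (auto simp: fc_def)
qed

lemma smp_image: "\<sigma> \<in> T \<Longrightarrow> smp \<sigma> ` standard_simplex 2 = fc \<sigma>"
proof (intro equalityI subsetI)
  fix t assume s: "\<sigma> \<in> T" and t: "t \<in> fc \<sigma>"
  let ?x = "\<lambda>j. if j \<le> 2 then t (vt \<sigma> j) else 0"
  have x: "?x \<in> standard_simplex 2"
    using t fc_le_1[OF finite_T[OF s] t] sum_vt[OF s, of t] by (simp add: standard_simplex_def fc_def)
  have "smp \<sigma> ?x p = t p" for p
  proof (cases "p \<in> \<sigma>")
    case True
    then have "p = vt \<sigma> (col p)" "col p \<le> 2" using vt_col col_le s by auto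
    then show ?thesis using smp_vt[OF s x, of "col p"] by simp
  next
    case False
    then show ?thesis using smp_0[OF s x] t by (simp add: fc_def)
  qed
  then have "t = smp \<sigma> ?x" by (simp add: fun_eq_iff)
  then show "t \<in> smp \<sigma> ` standard_simplex 2" using x by blast
qed (use smp_fc in auto)

lemma smp_inj: "\<sigma> \<in> T \<Longrightarrow> inj_on (smp \<sigma>) (standard_simplex 2)"
proof (rule inj_onI, rule ext)
  fix x y j assume s: "\<sigma> \<in> T" and x: "x \<in> standard_simplex 2" and y: "y \<in> standard_simplex 2"
    and e: "smp \<sigma> x = smp \<sigma> y"
  show "x j = y j"
  proof (cases "j \<le> 2")
    case True then show ?thesis using smp_vt[OF s x, of j] smp_vt[OF s y, of j] e by simp
  next
    case False then show ?thesis using x y by (simp add: standard_simplex_def)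
  qed
qed

lemma singular_smp: "\<sigma> \<in> T \<Longrightarrow> singular_simplex 2 (top_of_set (fc \<sigma>)) (smp \<sigma>)"
proof -
  assume s: "\<sigma> \<in> T"
  have "(\<lambda>x i. \<Sum>j\<le>2. ev (vt \<sigma> j) i * x j) ` standard_simplex 2 = smp \<sigma> ` standard_simplex 2"
    by (rule image_cong) (auto simp: smp_def oriented_simplex_def)
  then have "simplicial_simplex 2 (fc \<sigma>) (smp \<sigma>)"
    using smp_image[OF s] unfolding smp_def by (simp add: simplicial_simplex_oriented_simplex)
  then show ?thesis by (simp add: simplicial_simplex_def euclidean_product_topology)
qed

lemma bs_smp: "\<sigma> \<in> T \<Longrightarrow> smp \<sigma> (bary 2) = bs \<sigma>"
proof
  fix p assume s: "\<sigma> \<in> T"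
  show "smp \<sigma> (bary 2) p = bs \<sigma> p"
  proof (cases "p \<in> \<sigma>")
    case True
    then have "p = vt \<sigma> (col p)" "col p \<le> 2" using vt_col col_le s by auto
    then show ?thesis using smp_vt[OF s bary_in, of "col p"] True by (simp add: bs_def bary_def)
  next
    case False
    then show ?thesis using smp_0[OF s bary_in] by (simp add: bs_def)
  qed
qed

lemma bs_fc: "\<sigma> \<in> T \<Longrightarrow> bs \<sigma> \<in> fc \<sigma>"
  using bs_smp[of \<sigma>] smp_fc[OF _ bary_in, of \<sigma>] by simp

lemma bs_fc_iff: "\<sigma> \<in> T \<Longrightarrow> \<tau> \<in> T \<Longrightarrow> bs \<sigma> \<in> fc \<tau> \<longleftrightarrow> \<sigma> = \<tau>"
proof
  assume s: "\<sigma> \<in> T" "\<tau> \<in> T" and b: "bs \<sigma> \<in> fc \<tau>"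
  have "p \<in> \<tau>" if "p \<in> \<sigma>" for p
    using b that by (cases "p \<in> \<tau>") (auto simp: fc_def bs_def)
  then show "\<sigma> = \<tau>" using sub_T[OF s] by blast
qed (use bs_fc in auto)

lemma bs_K: "\<sigma> \<in> T \<Longrightarrow> bs \<sigma> \<in> K" using bs_fc by (auto simp: K_def)

lemma bs_star: "\<sigma> \<in> T \<Longrightarrow> w \<in> \<sigma> \<Longrightarrow> bs \<sigma> \<in> star w"
  using bs_K by (simp add: star_def bs_def)

abbreviation bcls :: "nat set \<Rightarrow> (nat \<Rightarrow> real) chain \<Rightarrow> (nat \<Rightarrow> real) chain set" where
  "bcls \<sigma> c \<equiv> homologous_rel_set 2 X (topspace X - {bs \<sigma>}) c"

lemma smp_homeo: "\<sigma> \<in> T \<Longrightarrow> homeomorphic_map (top_of_set (standard_simplex 2)) (top_of_set (fc \<sigma>)) (smp \<sigma>)"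
proof (rule continuous_imp_homeomorphic_map)
  assume s: "\<sigma> \<in> T"
  show "compact_space (top_of_set (standard_simplex 2))"
    using compactin_standard_simplex[of 2] by (simp add: compact_space_subtopology euclidean_product_topology)
  show "Hausdorff_space (top_of_set (fc \<sigma>))" by (simp add: Hausdorff_space_subtopology)
  show "continuous_map (top_of_set (standard_simplex 2)) (top_of_set (fc \<sigma>)) (smp \<sigma>)"
    using singular_smp[OF s] by (simp add: singular_simplex_def euclidean_product_topology)
  show "smp \<sigma> ` topspace (top_of_set (standard_simplex 2)) = topspace (top_of_set (fc \<sigma>))"
    using smp_image[OF s] by simp
  show "inj_on (smp \<sigma>) (topspace (top_of_set (standard_simplex 2)))"
    using smp_inj[OF s] by simp
qed

text \<open>The generator for the standard simplex is carried over by two isomorphisms: the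
  homeomorphism onto the closed triangle, then excision of everything outside that triangle.\<close>

lemma bcls_gen:
  assumes s: "\<sigma> \<in> T"
  shows "singular_relcycle 2 X (topspace X - {bs \<sigma>}) (sc \<sigma>)"
    and "infgen (lhom X {bs \<sigma>}) (bcls \<sigma> (sc \<sigma>))"
proof -
  let ?D = "top_of_set (standard_simplex 2)" and ?S = "standard_simplex 2 - {bary 2}"
  let ?F = "top_of_set (fc \<sigma>)" and ?B = "fc \<sigma> - {bs \<sigma>}"
  have e: "topspace ?D \<inter> - {bary 2} = ?S" by auto
  have rc: "singular_relcycle 2 ?D ?S (idc 2)"
    using idc_relcycle[of 2] singular_relcycle_restrict[of 2 ?D "- {bary 2}"] unfolding e by simp
  have g1: "infgen (relative_homology_group (int 2) ?D ?S) (homologous_rel_set 2 ?D ?S (idc 2))"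
    using infgen_idc[of 2] relative_homology_group_restrict[of "int 2" ?D "- {bary 2}"]
      homologous_rel_restrict[of 2 ?D "- {bary 2}"] unfolding e by (simp only:)
  have im: "smp \<sigma> ` ?S = ?B"
  proof -
    have "smp \<sigma> ` ?S = smp \<sigma> ` standard_simplex 2 - smp \<sigma> ` {bary 2}"
      using bary_in by (intro inj_on_image_set_diff[OF smp_inj[OF s]]) auto
    then show ?thesis using smp_image[OF s] bs_smp[OF s] by simp
  qed
  have iso1: "hom_induced (int 2) ?D ?S ?F ?B (smp \<sigma>) \<in> iso (relative_homology_group (int 2) ?D ?S) (relative_homology_group (int 2) ?F ?B)"
    by (rule homeomorphic_map_relative_homology_iso[OF smp_homeo[OF s] _ im]) auto
  have cm: "chain_map 2 (smp \<sigma>) (idc 2) = sc \<sigma>"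
  proof -
    have "simplex_map 2 (smp \<sigma>) (restrict id (standard_simplex 2)) = smp \<sigma>"
      unfolding simplex_map_def by (rule ext) (auto simp: smp_def oriented_simplex_def)
    then show ?thesis by simp
  qed
  have cont: "continuous_map ?D ?F (smp \<sigma>)"
    using smp_homeo[OF s] homeomorphic_imp_continuous_map by blast
  have PiS: "smp \<sigma> \<in> ?S \<rightarrow> ?B" using im by auto
  have rcF: "singular_relcycle 2 ?F ?B (sc \<sigma>)"
    using singular_relcycle_chain_map[OF rc cont PiS] unfolding cm .
  have g2: "infgen (relative_homology_group (int 2) ?F ?B) (homologous_rel_set 2 ?F ?B (sc \<sigma>))"
    using g1 infgen_iso[OF _ _ iso1 cls_carrier[OF rc]]
    unfolding hom_induced_chain_map[OF cont PiS rc] cm by simp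
  \<comment> \<open>Outside the closed triangle some coordinate belonging to \<open>\<sigma>\<close>
    vanishes. This is a closed condition that fails at the barycentre, so even the closure avoids
    it.\<close>
  have cl: "X closure_of (K - fc \<sigma>) \<subseteq> X interior_of (topspace X - {bs \<sigma>})"
  proof -
    let ?C = "K \<inter> (\<Union>p\<in>\<sigma>. {t. t p \<le> 0})"
    have "K - fc \<sigma> \<subseteq> ?C"
    proof
      fix t assume t: "t \<in> K - fc \<sigma>"
      then have "\<exists>\<tau>\<in>T. t \<in> fc \<tau>" by (simp add: K_def)
      then obtain \<tau> where ta: "\<tau> \<in> T" "t \<in> fc \<tau>" by blast
      show "t \<in> ?C"
      proof (rule ccontr)
        assume "t \<notin> ?C"
        then have pos: "0 < t p" if "p \<in> \<sigma>" for p using t that by force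
        have "p \<in> \<tau>" if p: "p \<in> \<sigma>" for p
        proof (rule ccontr)
          assume "p \<notin> \<tau>"
          then have "t p = 0" using ta(2) by (simp add: fc_def)
          then show False using pos[OF p] by simp
        qed
        then have "\<sigma> = \<tau>" using sub_T[OF s ta(1)] by blast
        then show False using ta t by simp
      qed
    qed
    moreover have "closedin X ?C"
    proof -
      have "closed {t::nat \<Rightarrow> real. t p \<le> 0}" for p
        by (intro closed_Collect_le continuous_on_const continuous_on_coord)
      then have "closed (\<Union>p\<in>\<sigma>. {t::nat \<Rightarrow> real. t p \<le> 0})" using finite_T[OF s] by (intro closed_UN) auto
      then show ?thesis by (rule closedin_closed_Int)
    qed
    ultimately have "X closure_of (K - fc \<sigma>) \<subseteq> ?C" by (rule closure_of_minimal)
    also have "\<dots> \<subseteq> topspace X - {bs \<sigma>}" by (auto simp: bs_def)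
    also have "\<dots> = X interior_of (topspace X - {bs \<sigma>})"
    proof -
      have "closedin X {bs \<sigma>}" using closedin_Hausdorff_singleton[OF Hausdorff_X] bs_K[OF s] by simp
      then have "openin X (topspace X - {bs \<sigma>})" by blast
      then show ?thesis by (simp add: interior_of_openin)
    qed
    finally show ?thesis .
  qed
  have fK: "fc \<sigma> \<subseteq> K" using s by (auto simp: K_def)
  have 1: "subtopology X (K - (K - fc \<sigma>)) = ?F" using fK by (simp add: subtopology_subtopology double_diff Int_absorb1)
  have 2: "topspace X - {bs \<sigma>} - (K - fc \<sigma>) = ?B" using fK by auto
  have 3: "subtopology X K = X" by (simp add: subtopology_subtopology)
  have iso2: "hom_induced (int 2) ?F ?B X (topspace X - {bs \<sigma>}) id
      \<in> iso (relative_homology_group (int 2) ?F ?B) (relative_homology_group (int 2) X (topspace X - {bs \<sigma>}))"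
    using homology_excision_axiom[OF cl, of K "int 2"] unfolding 1 2 3 by auto
  have cid: "continuous_map ?F X id" using fK by auto
  have Pid: "id \<in> ?B \<rightarrow> topspace X - {bs \<sigma>}" using fK by auto
  have cmi: "chain_map 2 id (sc \<sigma>) = sc \<sigma>"
    using singular_smp[OF s] by (intro chain_map_ident[of 2 ?F]) (simp only: singular_chain_of)
  show rcX: "singular_relcycle 2 X (topspace X - {bs \<sigma>}) (sc \<sigma>)"
    using singular_relcycle_chain_map[OF rcF cid Pid] unfolding cmi .
  show "infgen (lhom X {bs \<sigma>}) (bcls \<sigma> (sc \<sigma>))"
    using g2 infgen_iso[OF _ _ iso2 cls_carrier[OF rcF]]
    unfolding hom_induced_chain_map[OF cid Pid rcF] cmi by simp
qed

end

lemma infgen_inv: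
  assumes "group G" "infgen G g"
  shows "infgen G (inv\<^bsub>G\<^esub> g)"
proof -
  interpret group G by fact
  have g: "g \<in> carrier G" using assms by (simp add: infgen_def)
  have *: "inv\<^bsub>G\<^esub> g [^]\<^bsub>G\<^esub> (k::int) = g [^]\<^bsub>G\<^esub> (- k)" for k using g by (simp add: int_pow_neg int_pow_inv)
  show ?thesis
    unfolding infgen_def *
  proof (intro conjI ballI allI impI)
    fix x assume "x \<in> carrier G"
    then obtain k :: int where "x = g [^]\<^bsub>G\<^esub> k" using assms(2) by (auto simp: infgen_def)
    then show "\<exists>k::int. x = g [^]\<^bsub>G\<^esub> (- k)" by (intro exI[of _ "- k"]) simp
  next
    fix k :: int assume "g [^]\<^bsub>G\<^esub> (- k) = \<one>\<^bsub>G\<^esub>"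
    then have "- k = 0" using assms(2) unfolding infgen_def by blast
    then show "k = 0" by simp
  qed (use g in simp)
qed

lemma chart_ball:
  assumes ch: "chart X U h" and P: "finite P" "P \<subseteq> U"
  obtains r where "0 < r" "P \<subseteq> h ` ball 0 r"
proof -
  have "\<forall>x\<in>P. \<exists>z. h z = x" using chart_range[OF ch] P by (metis image_iff subsetD)
  then obtain f where f: "\<And>x. x \<in> P \<Longrightarrow> h (f x) = x" by metis
  have "bounded (f ` P)" using P by (simp add: finite_imp_bounded)
  then obtain r where r: "0 < r" "\<And>x. x \<in> P \<Longrightarrow> norm (f x) < r"
    unfolding bounded_pos_less by blast
  have "P \<subseteq> h ` ball 0 r"
  proof
    fix x assume x: "x \<in> P"
    then have "f x \<in> ball 0 r" using r by simp
    then show "x \<in> h ` ball 0 r" using f[OF x] by force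
  qed
  then show ?thesis using r that by blast
qed

section \<open>Adjacent triangles and cancellation of sides\<close>

context surf
begin

text \<open>Write the side as {w, q}. In the link cycle of w exactly two edges meet at q; one comes
  from \<open>\<sigma>\<close>, the other from the triangle sought.\<close>

lemma ridge_unique:
  assumes s: "\<sigma> \<in> T" and p: "p \<in> \<sigma>"
  shows "\<exists>!\<tau>. \<tau> \<in> T \<and> \<tau> \<noteq> \<sigma> \<and> \<sigma> - {p} \<subseteq> \<tau>"
proof -
  have "card (\<sigma> - {p}) = 2" using card_T[OF s] p by simp
  then obtain w q where wq: "\<sigma> - {p} = {w, q}" "w \<noteq> q" by (auto simp: card_2_iff)
  then have ws: "w \<in> \<sigma>" "q \<in> \<sigma>" by auto
  then have "w \<in> \<Union>T" using s by blast
  then obtain xs where c: "cycle_cone w xs" and tr: "cycle_cone.tri w xs ` {..<length xs} = {\<sigma> \<in> T. w \<in> \<sigma>}"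
    by (rule cone_at)
  interpret cycle_cone w xs by (rule c)
  have "\<sigma> \<in> tri ` {..<n}" using tr s ws by blast
  then obtain i where i: "i < n" "\<sigma> = tri i" by blast
  have sub: "\<sigma> - {p} \<subseteq> \<tau> \<longleftrightarrow> w \<in> \<tau> \<and> q \<in> \<tau>" for \<tau> using wq by auto
  have qi: "q \<in> tri i" using i ws by simp
  then have "q = xs ! i \<or> q = xs ! (Suc i mod n)" using wq(2) by (auto simp: tri_def)
  then obtain j where j: "j < n" "j \<noteq> i" "q \<in> tri j" using tri_prev[OF i(1)] tri_next[OF i(1)] by blast
  have inT: "tri k \<in> T \<and> w \<in> tri k" if "k < n" for k using tr that by blast
  show ?thesis
  proof (rule ex1I[of _ "tri j"])
    show "tri j \<in> T \<and> tri j \<noteq> \<sigma> \<and> \<sigma> - {p} \<subseteq> tri j"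
      using inT[OF j(1)] j tri_inj[OF j(1) i(1)] i(2) unfolding sub by auto
    fix \<tau> assume ta: "\<tau> \<in> T \<and> \<tau> \<noteq> \<sigma> \<and> \<sigma> - {p} \<subseteq> \<tau>"
    then have t1: "w \<in> \<tau>" "q \<in> \<tau>" unfolding sub by auto
    then have "\<tau> \<in> tri ` {..<n}" using tr ta by blast
    then obtain k where k: "k < n" "\<tau> = tri k" by blast
    have ki: "k \<noteq> i" using k ta i by auto
    have nth: "xs ! a = xs ! b \<Longrightarrow> a = b" if "a < n" "b < n" for a b
      using dist that by (simp add: nth_eq_iff_index_eq)
    have 1: "(j = Suc i mod n \<and> q = xs ! j) \<or> (i = Suc j mod n \<and> q = xs ! i)"
      by (rule tri_share[OF i(1) j(1)]) (use j qi wq in auto)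
    have 2: "(k = Suc i mod n \<and> q = xs ! k) \<or> (i = Suc k mod n \<and> q = xs ! i)"
      by (rule tri_share[OF i(1) k(1)]) (use ki k t1 qi wq in auto)
    have "j = k"
      using 1 2
    proof (elim disjE conjE)
      assume "i = Suc j mod n" "i = Suc k mod n"
      then have "Suc j mod n = Suc k mod n" by simp
      then show "j = k" using j(1) k(1) by (auto simp: mod_Suc split: if_splits)
    next
      assume "q = xs ! j" "q = xs ! i" then show "j = k" using nth[OF j(1) i(1)] j(2) by simp
    next
      assume "q = xs ! i" "q = xs ! k" then show "j = k" using nth[OF k(1) i(1)] ki by simp
    qed simp
    then show "\<tau> = tri j" using k by simp
  qed
qed

text \<open>The triangle across the side opposite to the vertex of colour k. The two remaining
  vertices keep their colours, so crossing the same side again leads back.\<close>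

definition nb :: "nat \<Rightarrow> nat set \<Rightarrow> nat set" where
  "nb k \<sigma> = (THE \<tau>. \<tau> \<in> T \<and> \<tau> \<noteq> \<sigma> \<and> \<sigma> - {vt \<sigma> k} \<subseteq> \<tau>)"

lemma nb:
  assumes "\<sigma> \<in> T" "k \<le> 2"
  shows "nb k \<sigma> \<in> T" "nb k \<sigma> \<noteq> \<sigma>" "\<sigma> - {vt \<sigma> k} \<subseteq> nb k \<sigma>"
  using theI'[OF ridge_unique[OF assms(1) vt_in[OF assms]]] unfolding nb_def by blast+

lemma nb_eqI:
  assumes "\<sigma> \<in> T" "k \<le> 2" "\<tau> \<in> T" "\<tau> \<noteq> \<sigma>" "\<sigma> - {vt \<sigma> k} \<subseteq> \<tau>"
  shows "nb k \<sigma> = \<tau>"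
  using ridge_unique[OF assms(1) vt_in[OF assms(1,2)]] nb[OF assms(1,2)] assms(3-5) by blast

lemma vt_nb:
  assumes s: "\<sigma> \<in> T" and k: "k \<le> 2" and j: "j \<le> 2" "j \<noteq> k"
  shows "vt (nb k \<sigma>) j = vt \<sigma> j"
proof -
  have "vt \<sigma> j \<noteq> vt \<sigma> k" using vt_eq[OF s j(1) k] j(2) by simp
  then have "vt \<sigma> j \<in> nb k \<sigma>" using vt_in[OF s j(1)] nb(3)[OF s k] by blast
  then have "vt (nb k \<sigma>) (col (vt \<sigma> j)) = vt \<sigma> j" by (rule vt_col[OF nb(1)[OF s k]])
  then show ?thesis unfolding col_vt[OF s j(1)] .
qed

lemma nb_nb:
  assumes s: "\<sigma> \<in> T" and k: "k \<le> 2"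
  shows "nb k (nb k \<sigma>) = \<sigma>"
proof (rule nb_eqI[OF nb(1)[OF s k] k s])
  show "\<sigma> \<noteq> nb k \<sigma>" using nb(2)[OF s k] by simp
  show "nb k \<sigma> - {vt (nb k \<sigma>) k} \<subseteq> \<sigma>"
  proof
    fix p assume p: "p \<in> nb k \<sigma> - {vt (nb k \<sigma>) k}"
    then have e: "vt (nb k \<sigma>) (col p) = p" and l: "col p \<le> 2"
      using vt_col[OF nb(1)[OF s k]] col_le[OF nb(1)[OF s k]] by auto
    then have "col p \<noteq> k" using p by auto
    then have "p = vt \<sigma> (col p)" using vt_nb[OF s k l] e by simp
    then show "p \<in> \<sigma>" using vt_in[OF s l] by simp
  qed
qed

definition face :: "nat \<Rightarrow> nat set \<Rightarrow> (nat \<Rightarrow> real) \<Rightarrow> nat \<Rightarrow> real" where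
  "face k \<sigma> = singular_face 2 k (smp \<sigma>)"

text \<open>Both triangles list their vertices by colour, so the common side is the same singular
  simplex for both, never the reversed one.\<close>

lemma face_nb:
  assumes "\<sigma> \<in> T" "k \<le> 2"
  shows "face k (nb k \<sigma>) = face k \<sigma>"
  using assms vt_nb[OF assms]
  unfolding face_def smp_def by (simp add: singular_face_oriented_simplex oriented_simplex_eq)

lemma boundary_sc: "chain_boundary 2 (sc \<sigma>) = (\<Sum>k\<le>2. frag_cmul ((-1) ^ k) (frag_of (face k \<sigma>)))"
  by (simp add: chain_boundary_of face_def)

lemma singular_face_sc:
  assumes "\<sigma> \<in> T" "k \<le> 2"
  shows "singular_simplex 1 (subtopology X {t. t (vt \<sigma> k) = 0}) (face k \<sigma>)"
proof (rule iffD2[OF singular_simplex_subtopology[of 1 X]], rule conjI)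
  have "fc \<sigma> \<subseteq> K" using assms by (auto simp: K_def)
  then have s: "singular_simplex 2 X (smp \<sigma>)"
    using singular_simplex_mono[of 2 euclidean] singular_smp[OF assms(1)] by blast
  show "singular_simplex 1 X (face k \<sigma>)"
    using singular_simplex_singular_face[OF s, of k] assms by (simp add: face_def)
  show "face k \<sigma> ` standard_simplex 1 \<subseteq> {t. t (vt \<sigma> k) = 0}"
  proof clarify
    fix x :: "nat \<Rightarrow> real" assume x: "x \<in> standard_simplex 1"
    then have f: "simplical_face k x \<in> standard_simplex 2"
      using simplical_face_in_standard_simplex[of 2 k x] assms by (simp add: numeral_2_eq_2)
    have "face k \<sigma> x (vt \<sigma> k) = smp \<sigma> (simplical_face k x) (vt \<sigma> k)"
      using x by (simp add: face_def singular_face_def)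
    also have "\<dots> = simplical_face k x k" by (rule smp_vt[OF assms(1) f assms(2)])
    finally show "face k \<sigma> x (vt \<sigma> k) = 0" by (simp add: simplical_face_def)
  qed
qed

text \<open>The involution \<open>nb k\<close> shows that the sum is its own negative, and the chain
  group has no torsion.\<close>

lemma paired_sum_zero:
  assumes T': "T' \<subseteq> T" "k \<le> 2" and p: "\<And>\<sigma>. \<sigma> \<in> T' \<Longrightarrow> nb k \<sigma> \<in> T' \<and> S (nb k \<sigma>) = - S \<sigma>"
  shows "(\<Sum>\<sigma>\<in>T'. frag_cmul (S \<sigma>) (frag_of (face k \<sigma>))) = 0"
proof -
  let ?A = "\<Sum>\<sigma>\<in>T'. frag_cmul (S \<sigma>) (frag_of (face k \<sigma>))"
  have "bij_betw (nb k) T' T'"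
    by (rule bij_betw_byWitness[where f' = "nb k"]) (use p T' nb_nb in auto)
  then have "?A = (\<Sum>\<sigma>\<in>T'. frag_cmul (S (nb k \<sigma>)) (frag_of (face k (nb k \<sigma>))))"
    by (rule sum.reindex_bij_betw[symmetric])
  also have "\<dots> = (\<Sum>\<sigma>\<in>T'. - frag_cmul (S \<sigma>) (frag_of (face k \<sigma>)))"
    by (rule sum.cong) (use p T' face_nb in auto)
  also have "\<dots> = - ?A" by (rule sum_negf)
  finally have "?A + ?A = 0" by (rule iffD2[OF add_eq_0_iff])
  then have "frag_cmul (1 + 1) ?A = 0" by (simp only: frag_cmul_distrib frag_cmul_one)
  then show ?thesis by (simp only: frag_cmul_eq_0_iff) simp
qed

definition tchain :: "nat set set \<Rightarrow> (nat set \<Rightarrow> int) \<Rightarrow> (nat \<Rightarrow> real) chain" where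
  "tchain T' S = (\<Sum>\<sigma>\<in>T'. frag_cmul (S \<sigma>) (sc \<sigma>))"

lemma singular_sc: "\<sigma> \<in> T \<Longrightarrow> singular_chain 2 X (sc \<sigma>)"
  using singular_simplex_mono[of 2 euclidean "fc \<sigma>" "smp \<sigma>" K] singular_smp[of \<sigma>]
  unfolding singular_chain_of by (auto simp: K_def)

text \<open>Sides are treated one colour at a time: those opposite to colour k either cancel in
  pairs or all lie in \<open>B\<close>. On the whole complex the first alternative always holds; in
  a vertex star the second occurs for the colour of the centre, whose opposite sides form the
  rim.\<close>

lemma tchain_relcycle:
  assumes T': "T' \<subseteq> T"
    and k: "\<And>k. k \<le> 2 \<Longrightarrow> (\<forall>\<sigma>\<in>T'. nb k \<sigma> \<in> T' \<and> S (nb k \<sigma>) = - S \<sigma>) \<or> (\<forall>\<sigma>\<in>T'. K \<inter> {t. t (vt \<sigma> k) = 0} \<inter> fc \<sigma> \<subseteq> B)"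
  shows "singular_relcycle 2 X B (tchain T' S)"
  unfolding singular_relcycle
proof
  show "singular_chain 2 X (tchain T' S)"
    unfolding tchain_def using T' singular_sc by (intro singular_chain_sum singular_chain_cmul) blast
  have "chain_boundary 2 (tchain T' S) = (\<Sum>\<sigma>\<in>T'. \<Sum>k\<le>2. frag_cmul ((-1) ^ k) (frag_cmul (S \<sigma>) (frag_of (face k \<sigma>))))"
    unfolding tchain_def chain_boundary_sum o_def chain_boundary_cmul boundary_sc
    by (rule sum.cong) (auto simp: frag_cmul_sum mult.commute)
  also have "\<dots> = (\<Sum>k\<le>2. frag_cmul ((-1) ^ k) (\<Sum>\<sigma>\<in>T'. frag_cmul (S \<sigma>) (frag_of (face k \<sigma>))))"
    by (subst sum.swap) (simp only: frag_cmul_sum o_def)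
  finally have e: "chain_boundary 2 (tchain T' S) = \<dots>" .
  have "singular_chain 1 (subtopology X B) (\<Sum>\<sigma>\<in>T'. frag_cmul (S \<sigma>) (frag_of (face k \<sigma>)))" if k2: "k \<le> 2" for k
    using k[OF k2]
  proof
    assume "\<forall>\<sigma>\<in>T'. nb k \<sigma> \<in> T' \<and> S (nb k \<sigma>) = - S \<sigma>"
    then have "(\<Sum>\<sigma>\<in>T'. frag_cmul (S \<sigma>) (frag_of (face k \<sigma>))) = 0"
      by (intro paired_sum_zero[OF T' k2]) blast
    then show ?thesis by simp
  next
    assume a: "\<forall>\<sigma>\<in>T'. K \<inter> {t. t (vt \<sigma> k) = 0} \<inter> fc \<sigma> \<subseteq> B"
    show ?thesis
    proof (intro singular_chain_sum singular_chain_cmul, unfold singular_chain_of)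
      fix \<sigma> assume s: "\<sigma> \<in> T'"
      then have sT: "\<sigma> \<in> T" using T' by blast
      have f1: "singular_simplex 1 X (face k \<sigma>)" "face k \<sigma> ` standard_simplex 1 \<subseteq> {t. t (vt \<sigma> k) = 0}"
        using iffD1[OF singular_simplex_subtopology[of 1 X] singular_face_sc[OF sT k2]] by auto
      have f2: "face k \<sigma> ` standard_simplex 1 \<subseteq> fc \<sigma>"
        using singular_simplex_singular_face[OF singular_smp[OF sT], of k] k2
        by (simp add: face_def singular_simplex_subtopology)
      have "face k \<sigma> ` standard_simplex 1 \<subseteq> B"
        using f1(2) f2 a s sT by (fastforce simp: K_def)
      then show "singular_simplex 1 (subtopology X B) (face k \<sigma>)"
        using f1(1) by (simp only: singular_simplex_subtopology[of 1 X])
    qed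
  qed
  then have "singular_chain 1 (subtopology X B) (chain_boundary 2 (tchain T' S))"
    unfolding e by - (rule singular_chain_sum, rule singular_chain_cmul, simp only: atMost_iff)
  then show "singular_chain (2 - 1) (subtopology X B) (chain_boundary 2 (tchain T' S))" by simp
qed

text \<open>All other triangles miss the barycentre of \<open>\<sigma>\<close>, so their part of the
  chain is invisible there.\<close>

lemma bcls_tchain:
  assumes T': "T' \<subseteq> T" and s: "\<sigma> \<in> T'"
  shows "bcls \<sigma> (tchain T' S) = bcls \<sigma> (sc \<sigma>) [^]\<^bsub>lhom X {bs \<sigma>}\<^esub> S \<sigma>"
proof -
  have sT: "\<sigma> \<in> T" using assms by blast
  have fT: "finite T'" using T' fin finite_subset by blast
  have "tchain T' S - frag_cmul (S \<sigma>) (sc \<sigma>) = (\<Sum>\<tau>\<in>T' - {\<sigma>}. frag_cmul (S \<tau>) (sc \<tau>))"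
    unfolding tchain_def by (simp add: sum_diff1 fT s)
  moreover have "singular_chain 2 (subtopology X (topspace X - {bs \<sigma>})) (\<Sum>\<tau>\<in>T' - {\<sigma>}. frag_cmul (S \<tau>) (sc \<tau>))"
  proof (intro singular_chain_sum singular_chain_cmul)
    fix \<tau> assume t: "\<tau> \<in> T' - {\<sigma>}"
    then have tT: "\<tau> \<in> T" using T' by blast
    have "bs \<sigma> \<notin> fc \<tau>" using bs_fc_iff[OF sT tT] t by auto
    then have "fc \<tau> \<subseteq> K \<inter> (K - {bs \<sigma>})" using tT by (auto simp: K_def)
    then have "singular_simplex 2 (top_of_set (K \<inter> (K - {bs \<sigma>}))) (smp \<tau>)"
      using singular_simplex_mono[of 2 euclidean] singular_smp[OF tT] by blast
    then show "singular_chain 2 (subtopology X (topspace X - {bs \<sigma>})) (sc \<tau>)"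
      unfolding singular_chain_of by (simp add: subtopology_subtopology)
  qed
  ultimately have "bcls \<sigma> (tchain T' S) = bcls \<sigma> (frag_cmul (S \<sigma>) (sc \<sigma>))"
    by (intro cls_cong) simp
  also have "\<dots> = bcls \<sigma> (sc \<sigma>) [^]\<^bsub>lhom X {bs \<sigma>}\<^esub> S \<sigma>"
    using cls_cmul[OF bcls_gen(1)[OF sT], of "S \<sigma>"] by simp
  finally show ?thesis .
qed

lemma bcls_pow_gen:
  assumes "\<sigma> \<in> T" "s \<in> {1, -1}"
  shows "infgen (lhom X {bs \<sigma>}) (bcls \<sigma> (sc \<sigma>) [^]\<^bsub>lhom X {bs \<sigma>}\<^esub> (s::int))"
proof -
  interpret group "lhom X {bs \<sigma>}" by simp
  have g: "infgen (lhom X {bs \<sigma>}) (bcls \<sigma> (sc \<sigma>))" by (rule bcls_gen(2)[OF assms(1)])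
  then have c: "bcls \<sigma> (sc \<sigma>) \<in> carrier (lhom X {bs \<sigma>})" by (simp add: infgen_def)
  from assms(2) consider "s = 1" | "s = -1" by blast
  then show ?thesis
  proof cases
    case 1 then show ?thesis using g by (simp only: int_pow_1[OF c])
  next
    case 2
    show ?thesis using infgen_inv[OF is_group g] 2 by (simp only: int_pow_neg[OF c] int_pow_1[OF c])
  qed
qed

section \<open>Orientations as alternating signs\<close>

definition alternating :: "(nat set \<Rightarrow> int) \<Rightarrow> bool" where
  "alternating S \<longleftrightarrow> (\<forall>\<sigma>\<in>T. S \<sigma> \<in> {1, -1} \<and> (\<forall>k\<le>2. S (nb k \<sigma>) = - S \<sigma>))"

text \<open>The signed sum of all triangles is a cycle, and at the barycentre of a triangle only
  that triangle counts, giving a generator or its inverse. Each point lies in a vertex star that is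
  a chart and contains such a barycentre.\<close>

lemma alternating_imp_orientable:
  assumes S: "alternating S"
  shows "orientable X"
proof -
  have rc: "singular_relcycle 2 X {} (tchain T S)"
    by (rule tchain_relcycle) (use S nb in \<open>auto simp: alternating_def\<close>)
  let ?m = "homologous_rel_set 2 X {} (tchain T S)"
  show ?thesis
  proof (rule orientableI[OF Hausdorff_X])
    show "?m \<in> carrier (homology_group 2 X)" using cls_carrier[OF rc] by simp
    fix x assume "x \<in> topspace X"
    then have "x \<in> K" by simp
    then obtain w where w: "w \<in> \<Union>T" "x \<in> star w" by (rule in_some_star)
    obtain \<sigma> where s: "\<sigma> \<in> T" "w \<in> \<sigma>" using w by blast
    obtain h where h: "chart X (star w) h" using w(1) by (rule star_chart)
    have "finite {x, bs \<sigma>}" "{x, bs \<sigma>} \<subseteq> star w" using w bs_star[OF s] by auto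
    then obtain r where r: "0 < r" "{x, bs \<sigma>} \<subseteq> h ` ball 0 r" by (rule chart_ball[OF h])
    have "hom_induced (int 2) X {} X (topspace X - {bs \<sigma>}) id ?m = bcls \<sigma> (chain_map 2 id (tchain T S))"
      by (rule hom_induced_chain_map[OF _ _ rc]) auto
    also have "chain_map 2 id (tchain T S) = tchain T S"
      using rc by (intro chain_map_ident[of 2 X]) (simp add: singular_relcycle)
    also have "bcls \<sigma> (tchain T S) = bcls \<sigma> (sc \<sigma>) [^]\<^bsub>lhom X {bs \<sigma>}\<^esub> S \<sigma>"
      by (rule bcls_tchain[OF subset_refl s(1)])
    finally have e: "hom_induced 2 X {} X (topspace X - {bs \<sigma>}) id ?m = bcls \<sigma> (sc \<sigma>) [^]\<^bsub>lhom X {bs \<sigma>}\<^esub> S \<sigma>"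
      by (simp only: of_nat_numeral)
    have "S \<sigma> \<in> {1, -1}" using S s(1) unfolding alternating_def by blast
    then have inf: "infgen (lhom X {bs \<sigma>}) (hom_induced 2 X {} X (topspace X - {bs \<sigma>}) id ?m)"
      unfolding e by (rule bcls_pow_gen[OF s(1)])
    have xb: "x \<in> h ` ball 0 r" "bs \<sigma> \<in> h ` ball 0 r" using r(2) by simp_all
    show "\<exists>U h a r z. chart X U h \<and> x \<in> h ` ball a r \<and> z \<in> h ` ball a r \<and>
       infgen (lhom X {z}) (hom_induced 2 X {} X (topspace X - {z}) id ?m)"
      by (rule exI[of _ "star w"], rule exI[of _ h], rule exI[of _ 0], rule exI[of _ r], rule exI[of _ "bs \<sigma>"])
        (intro conjI h xb inf)
  qed
qed


text \<open>The vertices of the link cycle alternate between the two colours other than that of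
  \<open>w\<close>. Hence the colour rises and falls alternately along the cycle, and
  \<open>L\<close> records which of the two happens in each triangle.\<close>

lemma star_sign:
  assumes w: "w \<in> \<Union>T"
  obtains L :: "nat set \<Rightarrow> int" where
    "\<And>\<sigma>. \<sigma> \<in> T \<Longrightarrow> w \<in> \<sigma> \<Longrightarrow> L \<sigma> \<in> {1, -1}"
    "\<And>\<sigma> k. \<sigma> \<in> T \<Longrightarrow> w \<in> \<sigma> \<Longrightarrow> k \<le> 2 \<Longrightarrow> k \<noteq> col w \<Longrightarrow> L (nb k \<sigma>) = - L \<sigma>"
proof -
  obtain xs where c: "cycle_cone w xs" and tr: "cycle_cone.tri w xs ` {..<length xs} = {\<sigma> \<in> T. w \<in> \<sigma>}"
    using w by (rule cone_at)
  interpret cycle_cone w xs by (rule c)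
  define L :: "nat set \<Rightarrow> int" where "L \<sigma> = (if \<exists>i<n. \<sigma> = tri i \<and> col (xs ! i) < col (xs ! (Suc i mod n)) then 1 else -1)" for \<sigma>
  have L: "L (tri i) = (if col (xs ! i) < col (xs ! (Suc i mod n)) then 1 else -1)" if "i < n" for i
    using tri_inj that unfolding L_def by metis
  have inT: "tri i \<in> T" "w \<in> tri i" if "i < n" for i using tr that by blast+
  have mem: "w \<in> tri i" "xs ! i \<in> tri i" "xs ! (Suc i mod n) \<in> tri i" for i by (auto simp: tri_def)
  have colinj: "col a \<noteq> col b" if "i < n" "a \<in> tri i" "b \<in> tri i" "a \<noteq> b" for i a b
    using col[OF inT(1)[OF that(1)]] that by (auto simp: bij_betw_def inj_on_def)
  have coll: "col a \<le> 2" if "i < n" "a \<in> tri i" for i a using col_le inT(1) that by blast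
  have step: "L (tri j) = - L (tri i)" if i: "i < n" and j: "j < n" and ji: "j = Suc i mod n" for i j
  proof -
    let ?a = "xs ! i" and ?b = "xs ! j" and ?d = "xs ! (Suc j mod n)"
    have i3: "w \<in> tri i" "?a \<in> tri i" "?b \<in> tri i" using mem[of i] ji by auto
    have j3: "w \<in> tri j" "?b \<in> tri j" "?d \<in> tri j" using mem[of j] by auto
    have n1: "?a \<noteq> w" "?b \<noteq> w" "?d \<noteq> w" using nth_w(1)[OF i] nth_w(1)[OF j] nth_w(2)[of j] by auto
    have n2: "?a \<noteq> ?b" "?b \<noteq> ?d" using nth_neq[OF i] nth_neq[OF j] ji by auto
    have 1: "col ?a \<noteq> col ?b" "col ?a \<noteq> col w" "col ?b \<noteq> col w"
      using colinj[OF i i3(2,3) n2(1)] colinj[OF i i3(2,1) n1(1)] colinj[OF i i3(3,1) n1(2)] by auto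
    have 2: "col ?b \<noteq> col ?d" "col ?d \<noteq> col w"
      using colinj[OF j j3(2,3) n2(2)] colinj[OF j j3(3,1) n1(3)] by auto
    have 3: "col ?a \<le> 2" "col ?b \<le> 2" "col w \<le> 2" "col ?d \<le> 2"
      using coll[OF i i3(2)] coll[OF i i3(3)] coll[OF i i3(1)] coll[OF j j3(3)] by auto
    have "col ?d = col ?a" using 1 2 3 by linarith
    then show ?thesis using 1 unfolding L[OF i] L[OF j] ji[symmetric] by auto
  qed
  show ?thesis
  proof (rule that[of L])
    show "L \<sigma> \<in> {1, -1}" for \<sigma> by (simp add: L_def)
    fix \<sigma> k assume s: "\<sigma> \<in> T" "w \<in> \<sigma>" and k: "k \<le> 2" "k \<noteq> col w"
    have "\<sigma> \<in> tri ` {..<n}" using tr s by blast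
    then obtain i where i: "i < n" "\<sigma> = tri i" by blast
    have wk: "w \<noteq> vt \<sigma> k" using col_vt[OF s(1) k(1)] k(2) by auto
    then have wn: "w \<in> nb k \<sigma>" using nb(3)[OF s(1) k(1)] s(2) by blast
    have "card (\<sigma> - {vt \<sigma> k, w}) = 1"
      using card_T[OF s(1)] vt_in[OF s(1) k(1)] s(2) wk finite_T[OF s(1)] by (simp add: card_Diff_subset)
    then obtain q where q: "\<sigma> - {vt \<sigma> k, w} = {q}" by (auto simp: card_1_singleton_iff)
    then have qs: "q \<in> \<sigma>" "q \<noteq> w" "q \<in> nb k \<sigma>" using nb(3)[OF s(1) k(1)] by auto
    have "nb k \<sigma> \<in> tri ` {..<n}" using tr nb(1)[OF s(1) k(1)] wn by blast
    then obtain j where j: "j < n" "nb k \<sigma> = tri j" by blast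
    have ij: "i \<noteq> j" using i j nb(2)[OF s(1) k(1)] by auto
    have "j = Suc i mod n \<or> i = Suc j mod n"
      using tri_share[OF i(1) j(1) ij, of q] qs i j by auto
    then show "L (nb k \<sigma>) = - L \<sigma>"
      using step[OF i(1) j(1)] step[OF j(1) i(1)] unfolding i(2)[symmetric] j(2)[symmetric] by auto
  qed
qed

text \<open>\<open>S\<close> compares the orientation with the class of each triangle. Two adjacent
  triangles lie in the star of a vertex w of their common side. There the chain with the signs of
  \<open>star_sign\<close> is a relative cycle that also gives a class on a chart ball, so the
  orientation must agree with these signs up to one global factor.\<close>

lemma orientable_imp_alternating:
  assumes "orientable X"
  obtains S where "alternating S"
proof -
  obtain \<mu> where \<mu>: "surface_orientation X \<mu>" using assms by (auto simp: orientable_def)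
  let ?g = "\<lambda>\<sigma>. bcls \<sigma> (sc \<sigma>)"
  let ?G = "\<lambda>\<sigma>. lhom X {bs \<sigma>}"
  \<comment> \<open>The value -1 stands for the inverse class, which by
    \<open>infgen_generated_cases\<close> is the only other generator.\<close>
  define S :: "nat set \<Rightarrow> int" where "S \<sigma> = (if \<mu> (bs \<sigma>) = ?g \<sigma> then 1 else -1)" for \<sigma>
  have gc: "?g \<sigma> \<in> carrier (?G \<sigma>)" if "\<sigma> \<in> T" for \<sigma>
    using bcls_gen(2)[OF that] by (simp add: infgen_def)
  have pow1: "?g \<sigma> [^]\<^bsub>?G \<sigma>\<^esub> (1::int) = ?g \<sigma>" "?g \<sigma> [^]\<^bsub>?G \<sigma>\<^esub> (-1::int) = inv\<^bsub>?G \<sigma>\<^esub> ?g \<sigma>" if "\<sigma> \<in> T" for \<sigma>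
  proof -
    interpret group "?G \<sigma>" by simp
    show "?g \<sigma> [^]\<^bsub>?G \<sigma>\<^esub> (1::int) = ?g \<sigma>" by (rule int_pow_1[OF gc[OF that]])
    then show "?g \<sigma> [^]\<^bsub>?G \<sigma>\<^esub> (-1::int) = inv\<^bsub>?G \<sigma>\<^esub> ?g \<sigma>"
      using int_pow_neg[OF gc[OF that], of 1] by (simp only:)
  qed
  have S1: "S \<sigma> \<in> {1, -1}" for \<sigma> by (simp add: S_def)
  have \<mu>S: "\<mu> (bs \<sigma>) = ?g \<sigma> [^]\<^bsub>?G \<sigma>\<^esub> S \<sigma>" if s: "\<sigma> \<in> T" for \<sigma>
  proof -
    have "bs \<sigma> \<in> topspace X" using bs_K[OF s] by simp
    then have "\<mu> (bs \<sigma>) \<in> carrier (?G \<sigma>)" "subgroup_generated (?G \<sigma>) {\<mu> (bs \<sigma>)} = ?G \<sigma>"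
      using \<mu> unfolding surface_orientation_def by blast+
    then have "\<mu> (bs \<sigma>) = ?g \<sigma> \<or> \<mu> (bs \<sigma>) = inv\<^bsub>?G \<sigma>\<^esub> ?g \<sigma>"
      using infgen_generated_cases[OF _ bcls_gen(2)[OF s]] group_relative_homology_group by blast
    then show ?thesis using pow1[OF s] unfolding S_def by auto
  qed
  have pinj: "a = b" if s: "\<sigma> \<in> T" and e: "?g \<sigma> [^]\<^bsub>?G \<sigma>\<^esub> (a::int) = ?g \<sigma> [^]\<^bsub>?G \<sigma>\<^esub> b" for \<sigma> a b
  proof -
    interpret group "?G \<sigma>" by simp
    have "?g \<sigma> [^]\<^bsub>?G \<sigma>\<^esub> (a - b) = \<one>\<^bsub>?G \<sigma>\<^esub>"
      unfolding int_pow_diff[OF gc[OF s]] e by (rule r_inv) (rule int_pow_closed[OF gc[OF s]])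
    then have "a - b = 0" using bcls_gen(2)[OF s] unfolding infgen_def by blast
    then show ?thesis by simp
  qed
  have "S (nb k \<sigma>) = - S \<sigma>" if s: "\<sigma> \<in> T" and k: "k \<le> 2" for \<sigma> k
  proof -
    have "card (\<sigma> - {vt \<sigma> k}) = 2" using card_T[OF s] vt_in[OF s k] by simp
    then obtain w where ws: "w \<in> \<sigma>" "w \<noteq> vt \<sigma> k" by (metis DiffE card.empty ex_in_conv singletonI zero_neq_numeral)
    have kw: "k \<noteq> col w" using vt_col[OF s ws(1)] ws(2) by auto
    have wT: "w \<in> \<Union>T" using s ws by blast
    let ?T' = "{\<tau> \<in> T. w \<in> \<tau>}"
    have fT: "finite ?T'" using fin by simp
    obtain L :: "nat set \<Rightarrow> int" where L1: "\<And>\<tau>. \<tau> \<in> T \<Longrightarrow> w \<in> \<tau> \<Longrightarrow> L \<tau> \<in> {1, -1}"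
      and L2: "\<And>\<tau> j. \<tau> \<in> T \<Longrightarrow> w \<in> \<tau> \<Longrightarrow> j \<le> 2 \<Longrightarrow> j \<noteq> col w \<Longrightarrow> L (nb j \<tau>) = - L \<tau>"
      using star_sign[OF wT] by blast
    obtain h where h: "chart X (star w) h" using wT by (rule star_chart)
    have "finite (bs ` ?T')" "bs ` ?T' \<subseteq> star w" using fT bs_star by auto
    then obtain r where r: "0 < r" "bs ` ?T' \<subseteq> h ` ball 0 r" by (rule chart_ball[OF h])
    let ?W = "h ` ball 0 r"
    have Ws: "?W \<subseteq> star w" using chart_range[OF h] by auto
    \<comment> \<open>Sides through w cancel in pairs, and sides opposite to w lie outside the open
      star.\<close>
    have rc: "singular_relcycle 2 X (topspace X - ?W) (tchain ?T' L)"
    proof (rule tchain_relcycle)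
      fix j :: nat assume j: "j \<le> 2"
      show "(\<forall>\<tau>\<in>?T'. nb j \<tau> \<in> ?T' \<and> L (nb j \<tau>) = - L \<tau>) \<or> (\<forall>\<tau>\<in>?T'. K \<inter> {t. t (vt \<tau> j) = 0} \<inter> fc \<tau> \<subseteq> topspace X - ?W)"
      proof (cases "j = col w")
        case True
        have "vt \<tau> j = w" if "\<tau> \<in> ?T'" for \<tau> using vt_col that True by simp
        moreover have "K \<inter> {t. t w = 0} \<subseteq> topspace X - ?W" using Ws by (auto simp: star_def)
        ultimately show ?thesis by blast
      next
        case False
        have "w \<in> nb j \<tau>" if "\<tau> \<in> T" "w \<in> \<tau>" for \<tau>
        proof -
          have "w \<noteq> vt \<tau> j" using col_vt[OF that(1) j] False by auto
          then show ?thesis using nb(3)[OF that(1) j] that(2) by blast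
        qed
        then show ?thesis using L2 nb(1) j False by blast
      qed
    qed auto
    let ?c = "homologous_rel_set 2 X (topspace X - ?W) (tchain ?T' L)"
    have cc: "?c \<in> carrier (lhom X ?W)" using cls_carrier[OF rc] by simp
    have resc: "res X ?W {bs \<tau>} ?c = ?g \<tau> [^]\<^bsub>?G \<tau>\<^esub> L \<tau>" if t: "\<tau> \<in> ?T'" for \<tau>
    proof -
      have "hom_induced (int 2) X (topspace X - ?W) X (topspace X - {bs \<tau>}) id ?c = bcls \<tau> (chain_map 2 id (tchain ?T' L))"
        by (rule hom_induced_chain_map[OF _ _ rc]) (use r t in auto)
      also have "chain_map 2 id (tchain ?T' L) = tchain ?T' L"
        using rc by (intro chain_map_ident[of 2 X]) (simp add: singular_relcycle)
      also have "bcls \<tau> (tchain ?T' L) = ?g \<tau> [^]\<^bsub>?G \<tau>\<^esub> L \<tau>"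
        by (rule bcls_tchain) (use t in auto)
      finally show ?thesis by (simp only: of_nat_numeral)
    qed
    obtain m where m: "m \<in> carrier (lhom X ?W)" "\<And>y. y \<in> ?W \<Longrightarrow> res X ?W {y} m = \<mu> y"
      using orientation_on_chart[OF Hausdorff_X \<mu> h r(1), of 0] by blast
    have iso: "res X ?W {bs \<tau>} \<in> iso (lhom X ?W) (?G \<tau>)" if "\<tau> \<in> ?T'" for \<tau>
    proof -
      have "bs \<tau> \<in> ?W" using r(2) that by blast
      then obtain y where "y \<in> ball 0 r" "bs \<tau> = h y" by blast
      then show ?thesis using iso_res[OF Hausdorff_X h] by simp
    qed
    have s': "\<sigma> \<in> ?T'" using s ws by simp
    \<comment> \<open>Both classes restrict to the same one at the barycentre of
      \<open>\<sigma>\<close>, where restriction is injective; the exponent is right because the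
      square of \<open>L \<sigma>\<close> is 1. Evaluating at the other barycentres of the star then
      gives \<open>all\<close>.\<close>
    have "m = ?c [^]\<^bsub>lhom X ?W\<^esub> (S \<sigma> * L \<sigma>)"
    proof (rule inj_onD)
      show "inj_on (res X ?W {bs \<sigma>}) (carrier (lhom X ?W))"
        using iso[OF s'] by (auto simp: iso_def bij_betw_def)
      interpret W: group "lhom X ?W" by simp
      interpret group "?G \<sigma>" by simp
      interpret gh: group_hom "lhom X ?W" "?G \<sigma>" "res X ?W {bs \<sigma>}"
        using iso[OF s'] by unfold_locales (auto simp: iso_def)
      have ll: "L \<sigma> * (S \<sigma> * L \<sigma>) = S \<sigma>" using L1[OF s ws(1)] by auto
      have "res X ?W {bs \<sigma>} (?c [^]\<^bsub>lhom X ?W\<^esub> (S \<sigma> * L \<sigma>)) = ?g \<sigma> [^]\<^bsub>?G \<sigma>\<^esub> S \<sigma>"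
        unfolding gh.hom_int_pow[OF cc] resc[OF s'] int_pow_pow[OF gc[OF s]] ll ..
      moreover have "res X ?W {bs \<sigma>} m = \<mu> (bs \<sigma>)" using m(2) r(2) s' by blast
      ultimately show "res X ?W {bs \<sigma>} m = res X ?W {bs \<sigma>} (?c [^]\<^bsub>lhom X ?W\<^esub> (S \<sigma> * L \<sigma>))"
        using \<mu>S[OF s] by (simp only:)
      show "?c [^]\<^bsub>lhom X ?W\<^esub> (S \<sigma> * L \<sigma>) \<in> carrier (lhom X ?W)" by (rule W.int_pow_closed[OF cc])
    qed (rule m(1))
    note mc = this
    have all: "S \<tau> = L \<tau> * (S \<sigma> * L \<sigma>)" if t: "\<tau> \<in> ?T'" for \<tau>
    proof -
      have tT: "\<tau> \<in> T" using t by simp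
      interpret W: group "lhom X ?W" by simp
      interpret group "?G \<tau>" by simp
      interpret gh: group_hom "lhom X ?W" "?G \<tau>" "res X ?W {bs \<tau>}"
        using iso[OF t] by unfold_locales (auto simp: iso_def)
      have "res X ?W {bs \<tau>} m = ?g \<tau> [^]\<^bsub>?G \<tau>\<^esub> (L \<tau> * (S \<sigma> * L \<sigma>))"
        unfolding mc gh.hom_int_pow[OF cc] resc[OF t] int_pow_pow[OF gc[OF tT]] ..
      moreover have "res X ?W {bs \<tau>} m = \<mu> (bs \<tau>)" using m(2) r(2) t by blast
      ultimately show ?thesis using \<mu>S[OF tT] by (intro pinj[OF tT]) (simp only:)
    qed
    have "nb k \<sigma> \<in> ?T'" using nb[OF s k] ws by auto
    then have "S (nb k \<sigma>) = L (nb k \<sigma>) * (S \<sigma> * L \<sigma>)" by (rule all)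
    also have "\<dots> = - (L \<sigma> * (S \<sigma> * L \<sigma>))" using L2[OF s ws(1) k kw] by simp
    also have "\<dots> = - S \<sigma>" using all[OF s'] by simp
    finally show ?thesis .
  qed
  then have "alternating S" unfolding alternating_def using S1 by blast
  then show ?thesis by (rule that)
qed

end

subsection \<open>The flag complex of a quadrangulation\<close>

text \<open>Says that \<open>s\<close> is a proper 2-colouring of the flag graph, whose moves change
  exactly one of vertex, edge and face.\<close>

definition flag_sign :: "'a set set set \<Rightarrow> ('a \<Rightarrow> 'a set \<Rightarrow> 'a set set \<Rightarrow> bool) \<Rightarrow> bool" where
  "flag_sign Q s \<longleftrightarrow> (\<forall>f\<in>Q. \<forall>e\<in>f. \<forall>v\<in>e.
     (\<forall>v'\<in>e. v' \<noteq> v \<longrightarrow> s v' e f = (\<not> s v e f)) \<and>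
     (\<forall>e'\<in>f. e' \<noteq> e \<longrightarrow> v \<in> e' \<longrightarrow> s v e' f = (\<not> s v e f)) \<and>
     (\<forall>f'\<in>Q. f' \<noteq> f \<longrightarrow> e \<in> f' \<longrightarrow> s v e f' = (\<not> s v e f)))"

text \<open>Faces are kept as edge sets, which loses nothing: the last clause, face-simplicity,
  rules out two faces on one cycle anyway. The list of edges in the third clause makes the link of a
  vertex a single cycle.\<close>

definition quad_system :: "'a graph \<Rightarrow> 'a set set set \<Rightarrow> bool" where
  "quad_system G Q \<longleftrightarrow>
     (\<forall>f\<in>Q. \<exists>vs. cycle_in G vs \<and> length vs = 4 \<and> f = cycle_edges vs) \<and>
     (\<forall>e\<in>edges G. \<exists>f f'. f \<noteq> f' \<and> {f \<in> Q. e \<in> f} = {f, f'}) \<and>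
     (\<forall>v\<in>verts G. \<exists>es. distinct es \<and> 3 \<le> length es \<and> set es = {e \<in> edges G. v \<in> e} \<and>
        (\<forall>i<length es. \<exists>f\<in>Q. es ! i \<in> f \<and> es ! (Suc i mod length es) \<in> f)) \<and>
     (\<forall>f\<in>Q. \<forall>f'\<in>Q. f \<noteq> f' \<longrightarrow> (\<forall>e\<in>f \<inter> f'. \<forall>e'\<in>f \<inter> f'. e = e'))"

lemma cycle_edges_image:
  "cycle_edges vs = (\<lambda>i. {vs ! i, vs ! (Suc i mod length vs)}) ` {..<length vs}"
  unfolding cycle_edges_def by blast

lemma cycle_edges_4: "cycle_edges [a, b, c, d] = {{a, b}, {b, c}, {c, d}, {d, a}}"
  by (simp add: cycle_edges_image lessThan_Suc insert_commute)

lemma cycle_edges_8: "cycle_edges [a, b, c, d, a', b', c', d'] =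
  {{a, b}, {b, c}, {c, d}, {d, a'}, {a', b'}, {b', c'}, {c', d'}, {d', a}}"
  by (simp add: cycle_edges_image lessThan_Suc insert_commute)

lemma length_4_cases: "length vs = 4 \<Longrightarrow> \<exists>a b c d. vs = [a, b, c, d]"
  by (auto simp: numeral_eq_Suc length_Suc_conv)

text \<open>Vertices, edges and faces of the quadrangulation become the vertices of one complex
  through the three numberings; \<open>col\<close> recovers the kind and so keeps their ranges
  apart.\<close>

locale quads =
  fixes G :: "'a graph" and Q :: "'a set set set"
    and nV :: "'a \<Rightarrow> nat" and nE :: "'a set \<Rightarrow> nat" and nF :: "'a set set \<Rightarrow> nat" and col :: "nat \<Rightarrow> nat"
  assumes simple: "simple_graph G" and connd: "connected_graph G" and qs: "quad_system G Q"
    and injV: "inj_on nV (verts G)" and injE: "inj_on nE (edges G)" and injF: "inj_on nF Q"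
    and colV: "\<And>v. col (nV v) = 0" and colE: "\<And>e. col (nE e) = 1" and colF: "\<And>f. col (nF f) = 2"
begin

lemma ne [simp]: "nV v \<noteq> nE e" "nE e \<noteq> nV v" "nV v \<noteq> nF f" "nF f \<noteq> nV v" "nE e \<noteq> nF f" "nF f \<noteq> nE e"
  using colV[of v] colE[of e] colF[of f] by (metis zero_neq_numeral zero_neq_one one_eq_numeral_iff num.distinct(1))+

lemmas qs_quad = qs[unfolded quad_system_def, THEN conjunct1, THEN bspec]
lemmas qs_two = qs[unfolded quad_system_def, THEN conjunct2, THEN conjunct1, THEN bspec]
lemmas qs_rot = qs[unfolded quad_system_def, THEN conjunct2, THEN conjunct2, THEN conjunct1, THEN bspec]
lemmas qs_share = qs[unfolded quad_system_def, THEN conjunct2, THEN conjunct2, THEN conjunct2, rule_format]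

lemma quadE:
  assumes "f \<in> Q"
  obtains a b c d where "distinct [a, b, c, d]" "f = {{a, b}, {b, c}, {c, d}, {d, a}}" "f \<subseteq> edges G"
    "cycle_in G [a, b, c, d]" "f = cycle_edges [a, b, c, d]"
proof -
  obtain vs where vs: "cycle_in G vs" "length vs = 4" "f = cycle_edges vs"
    using qs_quad[OF assms] by blast
  obtain a b c d where abcd: "vs = [a, b, c, d]" using length_4_cases[OF vs(2)] by blast
  show ?thesis
  proof (rule that[of a b c d])
    show "distinct [a, b, c, d]" "cycle_in G [a, b, c, d]" "f = cycle_edges [a, b, c, d]"
      using vs abcd by (simp_all add: cycle_in_def)
    then show "f = {{a, b}, {b, c}, {c, d}, {d, a}}" "f \<subseteq> edges G"
      by (simp_all only: cycle_edges_4 cycle_in_def)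
  qed
qed

lemma face_edges: "f \<in> Q \<Longrightarrow> e \<in> f \<Longrightarrow> e \<in> edges G"
  by (erule quadE) blast

lemma edgeE:
  assumes "e \<in> edges G"
  obtains u v where "u \<in> verts G" "v \<in> verts G" "u \<noteq> v" "e = {u, v}"
  using assms simple unfolding simple_graph_def by blast

lemma edge_verts: "e \<in> edges G \<Longrightarrow> v \<in> e \<Longrightarrow> v \<in> verts G"
  by (erule edgeE) blast

lemma finite_verts: "finite (verts G)" using simple by (simp add: simple_graph_def)

lemma finite_edges: "finite (edges G)"
proof (rule finite_subset)
  show "edges G \<subseteq> Pow (verts G)" using edge_verts by blast
qed (simp add: finite_verts)

lemma finite_Q: "finite Q"
proof (rule finite_subset)
  show "Q \<subseteq> Pow (edges G)" using face_edges by blast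
qed (simp add: finite_edges)

lemma two_faces:
  assumes "e \<in> edges G"
  obtains f f' where "f \<noteq> f'" "{f \<in> Q. e \<in> f} = {f, f'}"
proof -
  from qs_two[OF assms] show ?thesis by (elim exE conjE) (rule that)
qed

lemma edge_face: "e \<in> edges G \<Longrightarrow> \<exists>f\<in>Q. e \<in> f"
  by (rule two_faces) (assumption, blast)

lemma vertex_edge: "v \<in> verts G \<Longrightarrow> \<exists>e\<in>edges G. v \<in> e"
proof -
  assume "v \<in> verts G"
  then obtain es where es: "3 \<le> length es" "set es = {e \<in> edges G. v \<in> e}"
    using qs_rot by meson
  then have "es ! 0 \<in> set es" by (intro nth_mem) linarith
  then show ?thesis using es(2) by blast
qed

lemma face_two_edges:
  assumes "f \<in> Q" "e1 \<in> f" "e2 \<in> f" "e3 \<in> f" "v \<in> e1" "v \<in> e2" "v \<in> e3" "e1 \<noteq> e2" "e1 \<noteq> e3"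
  shows "e2 = e3"
  using assms(1)
proof (rule quadE)
  fix a b c d assume "distinct [a, b, c, d]" "f = {{a, b}, {b, c}, {c, d}, {d, a}}"
  then show "e2 = e3" using assms by auto
qed

definition T :: "nat set set" where
  "T = {{nV v, nE e, nF f} | v e f. f \<in> Q \<and> e \<in> f \<and> v \<in> e}"

lemma TI: "f \<in> Q \<Longrightarrow> e \<in> f \<Longrightarrow> v \<in> e \<Longrightarrow> {nV v, nE e, nF f} \<in> T"
  by (auto simp: T_def)

lemma TE:
  assumes "\<sigma> \<in> T"
  obtains v e f where "\<sigma> = {nV v, nE e, nF f}" "f \<in> Q" "e \<in> f" "v \<in> e" "e \<in> edges G" "v \<in> verts G"
proof -
  obtain v e f where *: "\<sigma> = {nV v, nE e, nF f}" "f \<in> Q" "e \<in> f" "v \<in> e" using assms by (auto simp: T_def)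
  have e: "e \<in> edges G" by (rule face_edges[OF *(2,3)])
  show ?thesis by (rule that[OF * e edge_verts[OF e *(4)]])
qed

lemma eqV: "v \<in> verts G \<Longrightarrow> v' \<in> verts G \<Longrightarrow> nV v = nV v' \<longleftrightarrow> v = v'" using injV by (auto simp: inj_on_def)
lemma eqE: "e \<in> edges G \<Longrightarrow> e' \<in> edges G \<Longrightarrow> nE e = nE e' \<longleftrightarrow> e = e'" using injE by (auto simp: inj_on_def)
lemma eqF: "f \<in> Q \<Longrightarrow> f' \<in> Q \<Longrightarrow> nF f = nF f' \<longleftrightarrow> f = f'" using injF by (auto simp: inj_on_def)

lemma link_V:
  assumes v: "v \<in> verts G"
  shows "(\<lambda>\<sigma>. \<sigma> - {nV v}) ` {\<sigma> \<in> T. nV v \<in> \<sigma>} = {{nE e, nF f} | e f. f \<in> Q \<and> e \<in> f \<and> v \<in> e}"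
proof (intro equalityI subsetI)
  fix \<epsilon> assume "\<epsilon> \<in> (\<lambda>\<sigma>. \<sigma> - {nV v}) ` {\<sigma> \<in> T. nV v \<in> \<sigma>}"
  then obtain \<sigma> where s: "\<sigma> \<in> T" "nV v \<in> \<sigma>" "\<epsilon> = \<sigma> - {nV v}" by blast
  from s(1) obtain v' e f where *: "\<sigma> = {nV v', nE e, nF f}" "f \<in> Q" "e \<in> f" "v' \<in> e" "e \<in> edges G" "v' \<in> verts G" by (rule TE)
  then have "v = v'" using s(2) eqV[OF v] by auto
  then have "\<epsilon> = {nE e, nF f}" using s(3) * by auto
  then show "\<epsilon> \<in> {{nE e, nF f} | e f. f \<in> Q \<and> e \<in> f \<and> v \<in> e}" using * \<open>v = v'\<close> by blast
next
  fix \<epsilon> assume "\<epsilon> \<in> {{nE e, nF f} | e f. f \<in> Q \<and> e \<in> f \<and> v \<in> e}"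
  then obtain e f where *: "\<epsilon> = {nE e, nF f}" "f \<in> Q" "e \<in> f" "v \<in> e" by blast
  then have "\<epsilon> = {nV v, nE e, nF f} - {nV v}" by auto
  then show "\<epsilon> \<in> (\<lambda>\<sigma>. \<sigma> - {nV v}) ` {\<sigma> \<in> T. nV v \<in> \<sigma>}" using TI[OF *(2,3,4)] by blast
qed

lemma link_E:
  assumes e: "e \<in> edges G"
  shows "(\<lambda>\<sigma>. \<sigma> - {nE e}) ` {\<sigma> \<in> T. nE e \<in> \<sigma>} = {{nV v, nF f} | v f. f \<in> Q \<and> e \<in> f \<and> v \<in> e}"
proof (intro equalityI subsetI)
  fix \<epsilon> assume "\<epsilon> \<in> (\<lambda>\<sigma>. \<sigma> - {nE e}) ` {\<sigma> \<in> T. nE e \<in> \<sigma>}"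
  then obtain \<sigma> where s: "\<sigma> \<in> T" "nE e \<in> \<sigma>" "\<epsilon> = \<sigma> - {nE e}" by blast
  from s(1) obtain v e' f where *: "\<sigma> = {nV v, nE e', nF f}" "f \<in> Q" "e' \<in> f" "v \<in> e'" "e' \<in> edges G" "v \<in> verts G" by (rule TE)
  then have "e = e'" using s(2) eqE[OF e] by auto
  then have "\<epsilon> = {nV v, nF f}" using s(3) * by auto
  then show "\<epsilon> \<in> {{nV v, nF f} | v f. f \<in> Q \<and> e \<in> f \<and> v \<in> e}" using * \<open>e = e'\<close> by blast
next
  fix \<epsilon> assume "\<epsilon> \<in> {{nV v, nF f} | v f. f \<in> Q \<and> e \<in> f \<and> v \<in> e}"
  then obtain v f where *: "\<epsilon> = {nV v, nF f}" "f \<in> Q" "e \<in> f" "v \<in> e" by blast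
  then have "\<epsilon> = {nV v, nE e, nF f} - {nE e}" by auto
  then show "\<epsilon> \<in> (\<lambda>\<sigma>. \<sigma> - {nE e}) ` {\<sigma> \<in> T. nE e \<in> \<sigma>}" using TI[OF *(2,3,4)] by blast
qed

lemma link_F:
  assumes f: "f \<in> Q"
  shows "(\<lambda>\<sigma>. \<sigma> - {nF f}) ` {\<sigma> \<in> T. nF f \<in> \<sigma>} = {{nV v, nE e} | v e. e \<in> f \<and> v \<in> e}"
proof (intro equalityI subsetI)
  fix \<epsilon> assume "\<epsilon> \<in> (\<lambda>\<sigma>. \<sigma> - {nF f}) ` {\<sigma> \<in> T. nF f \<in> \<sigma>}"
  then obtain \<sigma> where s: "\<sigma> \<in> T" "nF f \<in> \<sigma>" "\<epsilon> = \<sigma> - {nF f}" by blast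
  from s(1) obtain v e f' where *: "\<sigma> = {nV v, nE e, nF f'}" "f' \<in> Q" "e \<in> f'" "v \<in> e" "e \<in> edges G" "v \<in> verts G" by (rule TE)
  then have "f = f'" using s(2) eqF[OF f] by auto
  then have "\<epsilon> = {nV v, nE e}" using s(3) * by auto
  then show "\<epsilon> \<in> {{nV v, nE e} | v e. e \<in> f \<and> v \<in> e}" using * \<open>f = f'\<close> by blast
next
  fix \<epsilon> assume "\<epsilon> \<in> {{nV v, nE e} | v e. e \<in> f \<and> v \<in> e}"
  then obtain v e where *: "\<epsilon> = {nV v, nE e}" "e \<in> f" "v \<in> e" by blast
  then have "\<epsilon> = {nV v, nE e, nF f} - {nF f}" by auto
  then show "\<epsilon> \<in> (\<lambda>\<sigma>. \<sigma> - {nF f}) ` {\<sigma> \<in> T. nF f \<in> \<sigma>}" using TI[OF f *(2,3)] by blast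
qed

text \<open>Each consecutive pair of edges in the rotation lies in a face, and inserting these faces
  between the edges gives the link. The faces are distinct because a 4-cycle has only two edges at
  v, and none is missing because each edge lies in only two faces.\<close>

lemma cycle_at_vertex:
  assumes v: "v \<in> verts G"
  shows "\<exists>xs. distinct xs \<and> 3 \<le> length xs \<and> {{nE e, nF f} | e f. f \<in> Q \<and> e \<in> f \<and> v \<in> e} = cycle_edges xs"
proof -
  obtain es where es: "distinct es" "3 \<le> length es" "set es = {e \<in> edges G. v \<in> e}"
    "\<forall>i<length es. \<exists>f\<in>Q. es ! i \<in> f \<and> es ! (Suc i mod length es) \<in> f"
    using qs_rot[OF v] by blast
  let ?k = "length es"
  have k0: "0 < ?k" using es(2) by linarith
  obtain F where F: "\<And>i. i < ?k \<Longrightarrow> F i \<in> Q \<and> es ! i \<in> F i \<and> es ! (Suc i mod ?k) \<in> F i"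
    using es(4) by metis
  have esE: "es ! i \<in> edges G" "v \<in> es ! i" if "i < ?k" for i
    using nth_mem[OF that] es(3) by auto
  have esq: "es ! i = es ! j \<longleftrightarrow> i = j" if "i < ?k" "j < ?k" for i j
    using es(1) that by (simp add: nth_eq_iff_index_eq)
  have sk: "Suc i mod ?k < ?k" for i using k0 by simp
  have sne: "i \<noteq> Suc i mod ?k" if "i < ?k" for i
    using that es(2) by (cases "Suc i = ?k") auto
  have only: "j = i \<or> j = Suc i mod ?k" if i: "i < ?k" and j: "j < ?k" and "es ! j \<in> F i" for i j
  proof (rule ccontr)
    assume "\<not> (j = i \<or> j = Suc i mod ?k)"
    then have "es ! i \<noteq> es ! j" "es ! i \<noteq> es ! (Suc i mod ?k)" "es ! (Suc i mod ?k) \<noteq> es ! j"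
      using esq[OF i j] esq[OF i sk] esq[OF sk j] sne[OF i] by auto
    then show False
      using face_two_edges[of "F i" "es ! i" "es ! (Suc i mod ?k)" "es ! j" v] F[OF i] that esE sk by blast
  qed
  have Finj: "i = j" if i: "i < ?k" and j: "j < ?k" and e: "F i = F j" for i j
  proof (rule ccontr)
    assume n: "i \<noteq> j"
    have a: "j = Suc i mod ?k" using only[OF i j] F[OF j] e n by auto
    have b: "i = Suc j mod ?k" using only[OF j i] F[OF i] e n by auto
    show False by (rule mod_cycle_asym[OF es(2) i j b a])
  qed
  \<comment> \<open>Even positions hold edges, odd positions the face between the edges before and
    after.\<close>
  define xs where "xs = map (\<lambda>j. if even j then nE (es ! (j div 2)) else nF (F (j div 2))) [0..<2 * ?k]"
  have len: "length xs = 2 * ?k" by (simp add: xs_def)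
  have ev: "xs ! (2 * i) = nE (es ! i)" and od: "xs ! Suc (2 * i) = nF (F i)" if "i < ?k" for i
    using that by (auto simp: xs_def)
  have "distinct xs"
    unfolding distinct_conv_nth len
  proof (intro allI impI)
    fix i j assume ij: "i < 2 * ?k" "j < 2 * ?k" "i \<noteq> j"
    have ij2: "i div 2 < ?k" "j div 2 < ?k" using ij by auto
    have d: "i div 2 \<noteq> j div 2" if "even i = even j"
      using that ij(3) by (metis dvd_mult_div_cancel odd_two_times_div_two_succ)
    show "xs ! i \<noteq> xs ! j"
      using ij ij2 d esq[OF ij2] eqE[OF esE(1)[OF ij2(1)] esE(1)[OF ij2(2)]]
        eqF[of "F (i div 2)" "F (j div 2)"] F[OF ij2(1)] F[OF ij2(2)] Finj[OF ij2]
      by (auto simp: xs_def)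
  qed
  moreover have "{{nE e, nF f} | e f. f \<in> Q \<and> e \<in> f \<and> v \<in> e} = cycle_edges xs"
  proof (intro equalityI subsetI)
    fix \<epsilon> assume "\<epsilon> \<in> {{nE e, nF f} | e f. f \<in> Q \<and> e \<in> f \<and> v \<in> e}"
    then obtain e f where ef: "\<epsilon> = {nE e, nF f}" "f \<in> Q" "e \<in> f" "v \<in> e" by blast
    then have "e \<in> set es" using es(3) face_edges by blast
    then obtain j where j: "j < ?k" "e = es ! j" by (auto simp: in_set_conv_nth)
    obtain i where i: "i < ?k" "Suc i mod ?k = j"
    proof (cases j)
      case 0 then show ?thesis using k0 that[of "?k - 1"] by simp
    next
      case (Suc l) then show ?thesis using j that[of l] by simp
    qed
    obtain g g' where g: "g \<noteq> g'" "{f \<in> Q. e \<in> f} = {g, g'}"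
      using two_faces[OF esE(1)[OF j(1)]] j(2) by metis
    have "F i \<in> {f \<in> Q. e \<in> f}" "F j \<in> {f \<in> Q. e \<in> f}" "f \<in> {f \<in> Q. e \<in> f}"
      using F[OF i(1)] F[OF j(1)] ef i(2) j(2) by auto
    moreover have "F i \<noteq> F j" using Finj[OF i(1) j(1)] sne[OF i(1)] i(2) by auto
    ultimately have "f = F i \<or> f = F j" unfolding g(2) by auto
    then show "\<epsilon> \<in> cycle_edges xs"
    proof
      assume f: "f = F j"
      have "\<epsilon> = {xs ! (2 * j), xs ! (Suc (2 * j) mod length xs)}"
        using ef(1) f j ev[OF j(1)] od[OF j(1)] by (simp add: len)
      moreover have "2 * j < length xs" using j by (simp add: len)
      ultimately show ?thesis unfolding cycle_edges_def by blast
    next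
      assume f: "f = F i"
      have "Suc (Suc (2 * i)) mod (2 * ?k) = 2 * j"
        using i mult_mod_right[of 2 "Suc i" ?k] by simp
      then have "\<epsilon> = {xs ! Suc (2 * i), xs ! (Suc (Suc (2 * i)) mod length xs)}"
        using ef(1) f j ev[OF j(1)] od[OF i(1)] by (auto simp: len)
      moreover have "Suc (2 * i) < length xs" using i by (simp add: len)
      ultimately show ?thesis unfolding cycle_edges_def by blast
    qed
  next
    fix \<epsilon> assume "\<epsilon> \<in> cycle_edges xs"
    then obtain m where m: "m < 2 * ?k" "\<epsilon> = {xs ! m, xs ! (Suc m mod (2 * ?k))}"
      unfolding cycle_edges_def len by blast
    define i where "i = m div 2"
    have i: "i < ?k" using m by (auto simp: i_def)
    show "\<epsilon> \<in> {{nE e, nF f} | e f. f \<in> Q \<and> e \<in> f \<and> v \<in> e}"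
    proof (cases "even m")
      case True
      then have "m = 2 * i" by (simp add: i_def)
      then have "\<epsilon> = {nE (es ! i), nF (F i)}" using m i ev od by simp
      then show ?thesis using F[OF i] esE[OF i] by blast
    next
      case False
      then have mi: "m = Suc (2 * i)" by (simp add: i_def)
      have "Suc m mod (2 * ?k) = 2 * (Suc i mod ?k)"
        using mult_mod_right[of 2 "Suc i" ?k] mi by simp
      then have "\<epsilon> = {nE (es ! (Suc i mod ?k)), nF (F i)}" using m(2) mi ev[OF sk] od[OF i] by auto
      then show ?thesis using F[OF i] esE[OF sk] by blast
    qed
  qed
  moreover have "3 \<le> length xs" using es(2) by (simp add: len)
  ultimately show ?thesis by blast
qed

lemma cycle_at_edge:
  assumes e: "e \<in> edges G"
  shows "\<exists>xs. distinct xs \<and> 3 \<le> length xs \<and> {{nV v, nF f} | v f. f \<in> Q \<and> e \<in> f \<and> v \<in> e} = cycle_edges xs"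
proof -
  obtain u v where uv: "u \<in> verts G" "v \<in> verts G" "u \<noteq> v" "e = {u, v}" using e by (rule edgeE)
  obtain f g where fg: "f \<noteq> g" "{f \<in> Q. e \<in> f} = {f, g}" using e by (rule two_faces)
  have Q: "f \<in> Q" "g \<in> Q" using fg(2) by auto
  let ?xs = "[nV u, nF f, nV v, nF g]"
  have "distinct ?xs" using eqV[OF uv(1,2)] eqF[OF Q] uv(3) fg(1) by simp
  moreover have "{{nV v, nF f} | v f. f \<in> Q \<and> e \<in> f \<and> v \<in> e} = {{nV x, nF h} | x h. h \<in> {f, g} \<and> x \<in> {u, v}}"
    using fg(2) uv(4) by blast
  then have "{{nV v, nF f} | v f. f \<in> Q \<and> e \<in> f \<and> v \<in> e} = cycle_edges ?xs"
    unfolding cycle_edges_4 by auto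
  ultimately show ?thesis by (intro exI[of _ ?xs]) simp
qed

lemma cycle_at_face:
  assumes f: "f \<in> Q"
  shows "\<exists>xs. distinct xs \<and> 3 \<le> length xs \<and> {{nV v, nE e} | v e. e \<in> f \<and> v \<in> e} = cycle_edges xs"
proof -
  obtain a b c d where q: "distinct [a, b, c, d]" "f = {{a, b}, {b, c}, {c, d}, {d, a}}" "f \<subseteq> edges G"
    using f by (rule quadE)
  have E: "{a, b} \<in> edges G" "{b, c} \<in> edges G" "{c, d} \<in> edges G" "{d, a} \<in> edges G" using q by auto
  have V: "a \<in> verts G" "b \<in> verts G" "c \<in> verts G" "d \<in> verts G" using E edge_verts by blast+
  have d4: "{a, b} \<noteq> {b, c}" "{a, b} \<noteq> {c, d}" "{a, b} \<noteq> {d, a}" "{b, c} \<noteq> {c, d}" "{b, c} \<noteq> {d, a}" "{c, d} \<noteq> {d, a}"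
    using q(1) by (auto simp: doubleton_eq_iff)
  let ?xs = "[nV a, nE {a, b}, nV b, nE {b, c}, nV c, nE {c, d}, nV d, nE {d, a}]"
  have "distinct (map nV [a, b, c, d])"
    unfolding distinct_map using q(1) V by (intro conjI inj_on_subset[OF injV]) auto
  moreover have "distinct (map nE [{a, b}, {b, c}, {c, d}, {d, a}])"
    unfolding distinct_map using d4 E by (intro conjI inj_on_subset[OF injE]) auto
  ultimately have "distinct ?xs" by simp
  moreover have "{{nV v, nE e} | v e. e \<in> f \<and> v \<in> e} = (\<Union>e\<in>f. (\<lambda>v. {nV v, nE e}) ` e)"
    by blast
  then have "{{nV v, nE e} | v e. e \<in> f \<and> v \<in> e} = cycle_edges ?xs"
    unfolding cycle_edges_8 q(2) by (simp add: insert_commute)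
  ultimately show ?thesis by (intro exI[of _ ?xs]) simp
qed

end

lemmas flag_signD = iffD1[OF flag_sign_def, THEN bspec, THEN bspec, THEN bspec]
lemmas flag_sign_V = flag_signD[THEN conjunct1, THEN bspec, THEN mp]
lemmas flag_sign_E = flag_signD[THEN conjunct2, THEN conjunct1, THEN bspec, THEN mp, THEN mp]
lemmas flag_sign_F = flag_signD[THEN conjunct2, THEN conjunct2, THEN bspec, THEN mp, THEN mp]

text \<open>The complement of one piece is the union of the others, so every piece is closed as well
  as open, and connected.\<close>

lemma components_of_disjoint_open:
  assumes U: "topspace Y = (\<Union>i\<in>I. C i)" and op: "\<And>i. i \<in> I \<Longrightarrow> openin Y (C i)"
    and con: "\<And>i. i \<in> I \<Longrightarrow> connectedin Y (C i)" and ne: "\<And>i. i \<in> I \<Longrightarrow> C i \<noteq> {}"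
    and dj: "\<And>i j. i \<in> I \<Longrightarrow> j \<in> I \<Longrightarrow> C i \<inter> C j \<noteq> {} \<Longrightarrow> C i = C j"
  shows "connected_components_of Y = C ` I"
proof -
  have cl: "closedin Y (C i)" if i: "i \<in> I" for i
  proof -
    have "topspace Y - C i = \<Union>(C ` {j \<in> I. C j \<noteq> C i})"
    proof (intro equalityI subsetI)
      fix x assume x: "x \<in> topspace Y - C i"
      then obtain j where "j \<in> I" "x \<in> C j" using U by blast
      then show "x \<in> \<Union>(C ` {j \<in> I. C j \<noteq> C i})" using x by blast
    next
      fix x assume "x \<in> \<Union>(C ` {j \<in> I. C j \<noteq> C i})"
      then obtain j where j: "j \<in> I" "x \<in> C j" "C j \<noteq> C i" by blast
      then show "x \<in> topspace Y - C i" using U dj[OF i j(1)] by blast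
    qed
    moreover have "openin Y (\<Union>(C ` {j \<in> I. C j \<noteq> C i}))" using op by (intro openin_Union) auto
    moreover have "C i \<subseteq> topspace Y" using U i by blast
    ultimately show ?thesis by (simp add: closedin_def)
  qed
  have eq: "connected_component_of_set Y x = C i" if i: "i \<in> I" and x: "x \<in> C i" for i x
  proof (rule antisym)
    show "C i \<subseteq> connected_component_of_set Y x" using connected_component_of_maximal[OF con[OF i] x] .
    have "x \<in> topspace Y" using U i x by blast
    then have "x \<in> connected_component_of_set Y x" by (simp add: connected_component_of_refl)
    moreover have "connected_component_of_set Y x \<subseteq> C i \<or> disjnt (connected_component_of_set Y x) (C i)"
      by (rule connectedin_clopen_cases[OF connectedin_connected_component_of cl[OF i] op[OF i]])
    ultimately show "connected_component_of_set Y x \<subseteq> C i" using x by (auto simp: disjnt_iff)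
  qed
  show ?thesis
  proof (intro equalityI subsetI)
    fix Z assume "Z \<in> connected_components_of Y"
    then obtain x where x: "x \<in> topspace Y" "Z = connected_component_of_set Y x"
      unfolding connected_components_of_def by blast
    then obtain i where "i \<in> I" "x \<in> C i" using U by blast
    then show "Z \<in> C ` I" using eq x by blast
  next
    fix Z assume "Z \<in> C ` I"
    then obtain i where i: "i \<in> I" "Z = C i" by blast
    then obtain x where x: "x \<in> C i" using ne by blast
    then have "x \<in> topspace Y" using U i by blast
    then show "Z \<in> connected_components_of Y"
      unfolding connected_components_of_def using eq[OF i(1) x] i by blast
  qed
qed

section \<open>Closures and frontiers of open stars\<close>

context surf
begin

lemma alternating_nb: "alternating S \<Longrightarrow> \<sigma> \<in> T \<Longrightarrow> k \<le> 2 \<Longrightarrow> S (nb k \<sigma>) = - S \<sigma>"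
  by (simp add: alternating_def)

lemma alternating_val: "alternating S \<Longrightarrow> \<sigma> \<in> T \<Longrightarrow> S \<sigma> \<in> {1, -1}"
  by (simp add: alternating_def)

lemma subtopology_star: "subtopology X (star w) = top_of_set (star w)"
  using star_K by (simp add: subtopology_subtopology Int_absorb1)

lemma star_open_disk: "w \<in> \<Union>T \<Longrightarrow> subtopology X (star w) homeomorphic_space open_disk"
  unfolding subtopology_star
  by (rule homeomorphic_imp_space[OF homeomorphic_sym[THEN iffD1, OF star_homeomorphic]])

lemma connected_star: "w \<in> \<Union>T \<Longrightarrow> connected (star w)"
  using homeomorphic_connectedness[OF star_homeomorphic, of w] by simp

text \<open>The closed star is the image of the closed disk under a continuous map, hence contained
  in the closure of the image of the open disk; it is also compact.\<close>

lemma closure_star: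
  assumes w: "w \<in> \<Union>T"
  shows "X closure_of star w = cstar w"
proof (rule antisym)
  have "closedin X (cstar w)"
    using compact_cstar[of w] cstar_K[of w] by (simp add: closed_subset compact_imp_closed)
  then show "X closure_of star w \<subseteq> cstar w"
    by (rule closure_of_minimal[rotated]) (simp add: star_cstar)
  obtain h g where h: "homeomorphism (cball 0 1) (cstar w) h g" "h ` ball (0::complex) 1 = star w" "h ` sphere 0 1 = lnk w"
    using w by (rule star_disk)
  have "continuous_on (closure (ball (0::complex) 1)) h" using h(1) by (simp add: homeomorphism_def)
  then have "h ` closure (ball 0 1) \<subseteq> closure (star w)"
    by (rule image_closure_subset) (auto simp: h(2) closure_subset[THEN subsetD])
  moreover have "h ` cball 0 1 = cstar w" using h(1) by (simp add: homeomorphism_def)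
  ultimately have "cstar w \<subseteq> closure (star w)" by simp
  moreover have "X closure_of star w = K \<inter> closure (star w)"
    using star_K[of w] by (simp add: closure_of_subtopology Int_absorb1)
  ultimately show "cstar w \<subseteq> X closure_of star w" using cstar_K[of w] by blast
qed

lemma frontier_star:
  assumes "w \<in> \<Union>T"
  shows "X frontier_of star w = lnk w"
proof -
  have "X interior_of star w = star w" using open_star by (simp add: interior_of_eq)
  then have "X frontier_of star w = cstar w - star w" by (simp add: frontier_of_def closure_star[OF assms])
  also have "\<dots> = lnk w"
  proof (intro equalityI subsetI)
    fix t assume t: "t \<in> cstar w - star w"
    then have "0 \<le> t w" "\<not> 0 < t w" using star_nonneg cstar_K by (auto simp: star_cstar)
    then show "t \<in> lnk w" using t by (simp add: lnk_def)
  next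
    fix t assume "t \<in> lnk w"
    then show "t \<in> cstar w - star w" by (simp add: lnk_def star_cstar)
  qed
  finally show ?thesis .
qed

end

context quads
begin

text \<open>The link of a vertex interleaves edges and faces, that of an edge is a 4-cycle and that
  of a face an 8-cycle. Connectedness is inherited from G, passing from one vertex to an adjacent
  one through the point of their edge.\<close>

sublocale surf T col
proof
  show "finite T"
  proof (rule finite_subset)
    show "T \<subseteq> (\<lambda>(v, e, f). {nV v, nE e, nF f}) ` (verts G \<times> edges G \<times> Q)"
      using face_edges edge_verts unfolding T_def by fastforce
  qed (simp add: finite_verts finite_edges finite_Q)
  obtain v where v: "v \<in> verts G" using connd by (auto simp: connected_graph_def)
  obtain e where e: "e \<in> edges G" "v \<in> e" using vertex_edge[OF v] by blast
  obtain f where "f \<in> Q" "e \<in> f" using edge_face[OF e(1)] by blast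
  then show "T \<noteq> {}" using TI e by blast
  fix \<sigma> assume "\<sigma> \<in> T"
  then obtain v e f where "\<sigma> = {nV v, nE e, nF f}" by (auto simp: T_def)
  then show "bij_betw col \<sigma> {0, 1, 2}" by (auto simp: bij_betw_def colV colE colF)
next
  fix w assume "w \<in> \<Union>T"
  then obtain \<sigma> where "\<sigma> \<in> T" "w \<in> \<sigma>" by blast
  then obtain v e f where "\<sigma> = {nV v, nE e, nF f}" "f \<in> Q" "e \<in> f" "v \<in> e" "e \<in> edges G" "v \<in> verts G" by (rule_tac TE)
  then consider "w = nV v" "v \<in> verts G" | "w = nE e" "e \<in> edges G" | "w = nF f" "f \<in> Q" using \<open>w \<in> \<sigma>\<close> by blast
  then show "\<exists>xs. distinct xs \<and> 3 \<le> length xs \<and> (\<lambda>\<sigma>. \<sigma> - {w}) ` {\<sigma> \<in> T. w \<in> \<sigma>} = cycle_edges xs"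
  proof cases
    case 1 show ?thesis unfolding 1(1) link_V[OF 1(2)] by (rule cycle_at_vertex[OF 1(2)])
  next
    case 2 show ?thesis unfolding 2(1) link_E[OF 2(2)] by (rule cycle_at_edge[OF 2(2)])
  next
    case 3 show ?thesis unfolding 3(1) link_F[OF 3(2)] by (rule cycle_at_face[OF 3(2)])
  qed
next
  let ?R = "{(x, y). \<exists>\<sigma>\<in>T. x \<in> \<sigma> \<and> y \<in> \<sigma>}"
  have RI: "(x, y) \<in> ?R" if "\<sigma> \<in> T" "x \<in> \<sigma>" "y \<in> \<sigma>" for x y \<sigma> using that by blast
  have sym: "sym (?R\<^sup>*)" by (rule sym_rtrancl) (auto simp: sym_def)
  have vv: "(nV u, nV v) \<in> ?R\<^sup>*" if uv: "u \<in> verts G" "v \<in> verts G" for u v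
  proof -
    have "(u, v) \<in> {(x, y). {x, y} \<in> edges G}\<^sup>*" using connd uv by (auto simp: connected_graph_def)
    then show ?thesis
    proof (induction rule: rtrancl_induct)
      case (step y z)
      then have e: "{y, z} \<in> edges G" by simp
      then obtain f where f: "f \<in> Q" "{y, z} \<in> f" using edge_face by blast
      have "{nV y, nE {y, z}, nF f} \<in> T" "{nV z, nE {y, z}, nF f} \<in> T" using TI f by auto
      then have 1: "(nV y, nE {y, z}) \<in> ?R" and 2: "(nE {y, z}, nV z) \<in> ?R"
        using RI[of "{nV y, nE {y, z}, nF f}" "nV y" "nE {y, z}"] RI[of "{nV z, nE {y, z}, nF f}" "nE {y, z}" "nV z"] by simp_all
      show ?case by (rule rtrancl_into_rtrancl[OF rtrancl_into_rtrancl[OF step.IH 1] 2])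
    qed simp
  qed
  have wv: "\<exists>v\<in>verts G. (w, nV v) \<in> ?R\<^sup>*" if w: "w \<in> \<Union>T" for w
  proof -
    obtain \<sigma> where s: "\<sigma> \<in> T" "w \<in> \<sigma>" using w by blast
    from s(1) obtain v e f where v: "\<sigma> = {nV v, nE e, nF f}" "f \<in> Q" "e \<in> f" "v \<in> e" "e \<in> edges G" "v \<in> verts G" by (rule TE)
    then have "(w, nV v) \<in> ?R" using RI[OF s(1,2), of "nV v"] by simp
    then have "(w, nV v) \<in> ?R\<^sup>*" by (rule r_into_rtrancl)
    then show ?thesis using v(6) by (rule_tac bexI)
  qed
  fix w w' assume "w \<in> \<Union>T" "w' \<in> \<Union>T"
  obtain v where v: "v \<in> verts G" "(w, nV v) \<in> ?R\<^sup>*" using wv[OF \<open>w \<in> \<Union>T\<close>] by (elim bexE)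
  obtain v' where v': "v' \<in> verts G" "(w', nV v') \<in> ?R\<^sup>*" using wv[OF \<open>w' \<in> \<Union>T\<close>] by (elim bexE)
  have "(nV v', w') \<in> ?R\<^sup>*" using sym v'(2) by (rule symD)
  then show "(w, w') \<in> ?R\<^sup>*"
    by (rule rtrancl_trans[OF rtrancl_trans[OF v(2) vv[OF v(1) v'(1)]]])
qed

section \<open>The drawing of the graph in the flag complex\<close>

definition eu :: "'a set \<Rightarrow> 'a" where "eu e = fst (SOME (u, w). e = {u, w} \<and> u \<noteq> w)"
definition ew :: "'a set \<Rightarrow> 'a" where "ew e = snd (SOME (u, w). e = {u, w} \<and> u \<noteq> w)"

lemma ends:
  assumes "e \<in> edges G"
  shows "e = {eu e, ew e}" "eu e \<noteq> ew e" "eu e \<in> verts G" "ew e \<in> verts G" "nV (eu e) \<noteq> nV (ew e)"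
proof -
  obtain u v where "u \<noteq> v" "e = {u, v}" using assms by (rule edgeE)
  then have "\<exists>p. case p of (u, w) \<Rightarrow> e = {u, w} \<and> u \<noteq> w" by auto
  then have "case (SOME (u, w). e = {u, w} \<and> u \<noteq> w) of (u, w) \<Rightarrow> e = {u, w} \<and> u \<noteq> w" by (rule someI_ex)
  then show 1: "e = {eu e, ew e}" "eu e \<noteq> ew e" unfolding eu_def ew_def by (auto simp: case_prod_beta)
  show 2: "eu e \<in> verts G" "ew e \<in> verts G" using edge_verts[OF assms] 1(1) by blast+
  show "nV (eu e) \<noteq> nV (ew e)" using eqV[OF 2] 1(2) by simp
qed

text \<open>Piecewise linear: from the vertex \<open>eu e\<close> to the point of the edge at
  parameter 1/2, then on to the vertex \<open>ew e\<close>.\<close>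

definition earc :: "'a set \<Rightarrow> real \<Rightarrow> nat \<Rightarrow> real" where
  "earc e s = (\<lambda>i. if i = nV (eu e) then max 0 (1 - 2 * s) else if i = nE e then 1 - \<bar>2 * s - 1\<bar>
     else if i = nV (ew e) then max 0 (2 * s - 1) else 0)"

lemma earc_nE: "earc e s (nE e) = 1 - \<bar>2 * s - 1\<bar>"
  by (simp add: earc_def)

lemma earc_nF: "earc e s (nF f) = 0"
  by (simp add: earc_def)

lemma earc_ends:
  assumes "e \<in> edges G"
  shows "earc e 0 = ev (nV (eu e))" "earc e 1 = ev (nV (ew e))"
  using ends(5)[OF assms] by (auto simp: earc_def ev_def fun_eq_iff)

lemma fc2: "a \<noteq> b \<Longrightarrow> t \<in> fc {a, b} \<longleftrightarrow> 0 \<le> t a \<and> 0 \<le> t b \<and> t a + t b = 1 \<and> (\<forall>i. i \<noteq> a \<longrightarrow> i \<noteq> b \<longrightarrow> t i = 0)"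
  unfolding fc_def by (auto; metis order_refl)

lemma earc_inj: "e \<in> edges G \<Longrightarrow> inj_on (earc e) {0..1}"
proof (rule inj_onI)
  fix s t assume e: "e \<in> edges G" and eq: "earc e s = earc e t"
  have "earc e x (nV (ew e)) - earc e x (nV (eu e)) = 2 * x - 1" for x
    using ends(5)[OF e] by (simp add: earc_def max_def)
  from this[of s] this[of t] show "s = t" unfolding eq by simp
qed

lemma earc_image:
  assumes e: "e \<in> edges G"
  shows "earc e ` {0..1} = (\<Union>v\<in>e. fc {nV v, nE e})"
proof -
  let ?u = "nV (eu e)" and ?w = "nV (ew e)"
  have uw: "?u \<noteq> ?w" "?w \<noteq> ?u" using ends(5)[OF e] by auto
  have "earc e ` {0..1} = fc {?u, nE e} \<union> fc {?w, nE e}"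
  proof (intro equalityI subsetI)
    fix t assume "t \<in> earc e ` {0..1}"
    then obtain s where s: "0 \<le> s" "s \<le> 1" "t = earc e s" by auto
    show "t \<in> fc {?u, nE e} \<union> fc {?w, nE e}"
    proof (cases "s \<le> 1 / 2")
      case True
      then have "t \<in> fc {?u, nE e}" using s uw by (subst fc2) (auto simp: earc_def)
      then show ?thesis by blast
    next
      case False
      then have "t \<in> fc {?w, nE e}" using s uw by (subst fc2) (auto simp: earc_def)
      then show ?thesis by blast
    qed
  next
    fix t assume "t \<in> fc {?u, nE e} \<union> fc {?w, nE e}"
    then show "t \<in> earc e ` {0..1}"
    proof
      assume "t \<in> fc {?u, nE e}"
      then have t: "0 \<le> t ?u" "0 \<le> t (nE e)" "t ?u + t (nE e) = 1" "\<And>i. i \<noteq> ?u \<Longrightarrow> i \<noteq> nE e \<Longrightarrow> t i = 0"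
        by (simp_all add: fc2)
      have "t = earc e ((1 - t ?u) / 2)"
        using t uw by (auto simp: earc_def fun_eq_iff field_simps)
      then show ?thesis using t by (intro image_eqI[of _ _ "(1 - t ?u) / 2"]) auto
    next
      assume "t \<in> fc {?w, nE e}"
      then have t: "0 \<le> t ?w" "0 \<le> t (nE e)" "t ?w + t (nE e) = 1" "\<And>i. i \<noteq> ?w \<Longrightarrow> i \<noteq> nE e \<Longrightarrow> t i = 0"
        by (simp_all add: fc2)
      have "t = earc e ((1 + t ?w) / 2)"
        using t uw by (auto simp: earc_def fun_eq_iff field_simps)
      then show ?thesis using t by (intro image_eqI[of _ _ "(1 + t ?w) / 2"]) auto
    qed
  qed
  also have "\<dots> = (\<Union>v\<in>{eu e, ew e}. fc {nV v, nE e})" by simp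
  finally show ?thesis using ends(1)[OF e] by simp
qed


abbreviation pt :: "'a \<Rightarrow> nat \<Rightarrow> real" where "pt v \<equiv> ev (nV v)"

lemma fc_face_sub: "\<sigma> \<subseteq> \<tau> \<Longrightarrow> finite \<tau> \<Longrightarrow> fc \<sigma> \<subseteq> fc \<tau>"
proof
  fix t assume s: "\<sigma> \<subseteq> \<tau>" "finite \<tau>" and t: "t \<in> fc \<sigma>"
  have "sum t \<tau> = sum t \<sigma>"
    by (rule sum.mono_neutral_right) (use s t in \<open>auto simp: fc_def\<close>)
  then show "t \<in> fc \<tau>" using s t by (auto simp: fc_def)
qed

lemma flag_drop_face:
  assumes "t \<in> fc {nV v, nE e, nF f}" "t (nF f) = 0"
  shows "t \<in> fc {nV v, nE e}"
  using assms unfolding fc_def by auto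

lemma K_E:
  assumes "t \<in> K"
  obtains v e f where "f \<in> Q" "e \<in> f" "v \<in> e" "e \<in> edges G" "v \<in> verts G" "t \<in> fc {nV v, nE e, nF f}"
proof -
  have "\<exists>\<sigma>\<in>T. t \<in> fc \<sigma>" using assms by (simp add: K_def)
  then obtain \<sigma> where s: "\<sigma> \<in> T" "t \<in> fc \<sigma>" by blast
  from s(1) obtain v e f where "\<sigma> = {nV v, nE e, nF f}" "f \<in> Q" "e \<in> f" "v \<in> e" "e \<in> edges G" "v \<in> verts G" by (rule TE)
  then show ?thesis using s(2) by (intro that[of f e v]) simp_all
qed

lemma K_I: "f \<in> Q \<Longrightarrow> e \<in> f \<Longrightarrow> v \<in> e \<Longrightarrow> t \<in> fc {nV v, nE e, nF f} \<Longrightarrow> t \<in> K"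
  using TI unfolding K_def by blast

lemma earc_K:
  assumes e: "e \<in> edges G"
  shows "earc e ` {0..1} \<subseteq> K"
proof
  fix t assume "t \<in> earc e ` {0..1}"
  then obtain v where v: "v \<in> e" "t \<in> fc {nV v, nE e}" using earc_image[OF e] by auto
  obtain f where f: "f \<in> Q" "e \<in> f" using edge_face[OF e] by blast
  have "t \<in> fc {nV v, nE e, nF f}" using fc_face_sub[of "{nV v, nE e}" "{nV v, nE e, nF f}"] v(2) by auto
  then show "t \<in> K" by (rule K_I[OF f v(1)])
qed

definition skel :: "(nat \<Rightarrow> real) set" where
  "skel = pt ` verts G \<union> (\<Union>e\<in>edges G. earc e ` {0..1})"

text \<open>A point of a flag triangle whose face coordinate vanishes lies on the side from a vertex
  to the midpoint of an edge, which is half an arc.\<close>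

lemma skel_eq: "skel = {t \<in> K. \<forall>f\<in>Q. t (nF f) = 0}"
proof (intro equalityI subsetI)
  fix t assume "t \<in> skel"
  then consider v where "v \<in> verts G" "t = pt v" | e where "e \<in> edges G" "t \<in> earc e ` {0..1}"
    unfolding skel_def by blast
  then show "t \<in> {t \<in> K. \<forall>f\<in>Q. t (nF f) = 0}"
  proof cases
    case 1
    obtain e where e: "e \<in> edges G" "v \<in> e" using vertex_edge[OF 1(1)] by blast
    obtain f where f: "f \<in> Q" "e \<in> f" using edge_face[OF e(1)] by blast
    have "t \<in> K" using K_I[OF f e(2), of t] ev_fc[of "{nV v, nE e, nF f}" "nV v"] 1(2) by simp
    then show ?thesis using 1(2) by (simp add: ev_def)
  next
    case 2
    have "t \<in> K" using earc_K[OF 2(1)] 2(2) by blast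
    moreover obtain s where "t = earc e s" using 2(2) by blast
    ultimately show ?thesis by (simp add: earc_nF)
  qed
next
  fix t assume t: "t \<in> {t \<in> K. \<forall>f\<in>Q. t (nF f) = 0}"
  then have "t \<in> K" by simp
  then obtain v e f where vef: "f \<in> Q" "e \<in> f" "v \<in> e" "e \<in> edges G" "v \<in> verts G" "t \<in> fc {nV v, nE e, nF f}" by (rule K_E)
  then have "t \<in> fc {nV v, nE e}" using t by (intro flag_drop_face) auto
  then have "t \<in> earc e ` {0..1}" using earc_image[OF vef(4)] vef(3) by blast
  then show "t \<in> skel" unfolding skel_def using vef(4) by blast
qed

lemma nF_T: "f \<in> Q \<Longrightarrow> nF f \<in> \<Union>T"
proof -
  assume f: "f \<in> Q"
  obtain a b c d where "f = {{a, b}, {b, c}, {c, d}, {d, a}}" using f by (rule quadE)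
  then have "{nV a, nE {a, b}, nF f} \<in> T" using TI[OF f, of "{a, b}" a] by simp
  then show ?thesis by blast
qed

lemma star_face_unique:
  assumes "f \<in> Q" "g \<in> Q" "t \<in> star (nF f)" "t \<in> star (nF g)"
  shows "f = g"
proof -
  have "t \<in> K" using assms by (simp add: star_def)
  then obtain v e h where h: "h \<in> Q" "t \<in> fc {nV v, nE e, nF h}" by (rule K_E)
  have mem: "nF x \<in> {nV v, nE e, nF h}" if "t \<in> star (nF x)" for x
  proof (rule ccontr)
    assume "nF x \<notin> {nV v, nE e, nF h}"
    then have "t (nF x) = 0" using h(2) unfolding fc_def by blast
    then show False using that by (simp add: star_def)
  qed
  have "nF f = nF h" using mem[OF assms(3)] by simp
  moreover have "nF g = nF h" using mem[OF assms(4)] by simp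
  ultimately show ?thesis using eqF[OF assms(1) h(1)] eqF[OF assms(2) h(1)] by simp
qed

text \<open>By \<open>skel_eq\<close> the complement of the drawing is the union of the open stars
  of the face points. A flag contains a single face, so these stars are disjoint, and they are open
  and connected.\<close>

lemma faces_eq: "faces G X pt earc = (\<lambda>f. star (nF f)) ` Q"
proof -
  let ?Y = "subtopology X (topspace X - skel)"
  have U: "topspace X - skel = (\<Union>f\<in>Q. star (nF f))"
  proof (intro equalityI subsetI)
    fix t assume "t \<in> topspace X - skel"
    then have t: "t \<in> K" "\<not> (\<forall>f\<in>Q. t (nF f) = 0)" by (auto simp: skel_eq)
    then obtain f where "f \<in> Q" "t (nF f) \<noteq> 0" by blast
    moreover have "0 \<le> t (nF f)" using star_nonneg t(1) by blast
    ultimately have "t \<in> star (nF f)" using t(1) by (simp add: star_def)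
    then show "t \<in> (\<Union>f\<in>Q. star (nF f))" using \<open>f \<in> Q\<close> by blast
  next
    fix t assume "t \<in> (\<Union>f\<in>Q. star (nF f))"
    then obtain f where f: "f \<in> Q" "t \<in> star (nF f)" by blast
    then have "t \<in> K" "t (nF f) \<noteq> 0" by (simp_all add: star_def)
    then show "t \<in> topspace X - skel" using f(1) unfolding skel_eq by auto
  qed
  have "connected_components_of ?Y = (\<lambda>f. star (nF f)) ` Q"
  proof (rule components_of_disjoint_open)
    show "topspace ?Y = (\<Union>f\<in>Q. star (nF f))" using U by auto
    fix f assume f: "f \<in> Q"
    have sub: "star (nF f) \<subseteq> topspace X - skel" using U f by blast
    show "openin ?Y (star (nF f))"
      using openin_subtopology_Int2[OF open_star[of "nF f"], of "topspace X - skel"] sub by (simp only: Int_absorb1)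
    show "connectedin ?Y (star (nF f))"
      using connected_star[OF nF_T[OF f]] sub star_K by (simp add: connectedin_subtopology connectedin_iff_connected)
    show "star (nF f) \<noteq> {}"
      using star_homeomorphic[OF nF_T[OF f]] by (auto simp: homeomorphic_empty)
    fix g assume g: "g \<in> Q" "star (nF f) \<inter> star (nF g) \<noteq> {}"
    then have "f = g" using star_face_unique[OF f g(1)] by blast
    then show "star (nF f) = star (nF g)" by simp
  qed
  then show ?thesis unfolding faces_def skel_def .
qed

lemma lnk_face:
  assumes f: "f \<in> Q"
  shows "lnk (nF f) = (\<Union>e\<in>f. earc e ` {0..1})"
proof (intro equalityI subsetI)
  fix t assume "t \<in> lnk (nF f)"
  then have t: "t \<in> cstar (nF f)" "t (nF f) = 0" by (auto simp: lnk_def)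
  then obtain \<sigma> where s: "\<sigma> \<in> T" "nF f \<in> \<sigma>" "t \<in> fc \<sigma>" by (auto simp: cstar_def)
  from s(1) obtain v e g where vef: "\<sigma> = {nV v, nE e, nF g}" "g \<in> Q" "e \<in> g" "v \<in> e" "e \<in> edges G" "v \<in> verts G" by (rule TE)
  have "g = f" using vef(1) s(2) eqF[OF f vef(2)] by auto
  then have "t \<in> fc {nV v, nE e}" using s(3) vef(1) t(2) by (intro flag_drop_face) auto
  then show "t \<in> (\<Union>e\<in>f. earc e ` {0..1})" using earc_image[OF vef(5)] vef(3,4) \<open>g = f\<close> by blast
next
  fix t assume "t \<in> (\<Union>e\<in>f. earc e ` {0..1})"
  then obtain e where e: "e \<in> f" "t \<in> earc e ` {0..1}" by blast
  have eG: "e \<in> edges G" using face_edges[OF f e(1)] .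
  obtain v where v: "v \<in> e" "t \<in> fc {nV v, nE e}" using e(2) earc_image[OF eG] by blast
  have "t \<in> fc {nV v, nE e, nF f}" using fc_face_sub[of "{nV v, nE e}" "{nV v, nE e, nF f}"] v(2) by auto
  then have "t \<in> cstar (nF f)" unfolding cstar_def using TI[OF f e(1) v(1)] by blast
  moreover have "t (nF f) = 0" using v(2) by (simp add: fc_def)
  ultimately show "t \<in> lnk (nF f)" by (simp add: lnk_def)
qed

text \<open>The midpoint of an arc is the complex vertex \<open>nE e\<close>, which lies on no other
  arc, so an arc contained in the boundary of a face is one of its four.\<close>

lemma boundary_edges_face:
  assumes f: "f \<in> Q"
  shows "boundary_edges G X earc (star (nF f)) = f"
proof (intro equalityI subsetI)
  fix e assume "e \<in> boundary_edges G X earc (star (nF f))"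
  then have e: "e \<in> edges G" "earc e ` {0..1} \<subseteq> lnk (nF f)"
    unfolding boundary_edges_def frontier_star[OF nF_T[OF f]] by auto
  have "earc e (1/2) \<in> earc e ` {0..1}" by (rule imageI) simp
  then have "earc e (1/2) \<in> (\<Union>e\<in>f. earc e ` {0..1})" using e(2) lnk_face[OF f] by blast
  then obtain e' where e': "e' \<in> f" "earc e (1/2) \<in> earc e' ` {0..1}" by blast
  have eG: "e' \<in> edges G" using face_edges[OF f e'(1)] .
  obtain v where "earc e (1/2) \<in> fc {nV v, nE e'}" using e'(2) earc_image[OF eG] by blast
  moreover have "earc e (1/2) (nE e) = 1" by (simp add: earc_nE)
  ultimately have "nE e \<in> {nV v, nE e'}" unfolding fc_def by force
  then have "e = e'" using eqE[OF e(1) eG] by auto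
  then show "e \<in> f" using e'(1) by simp
next
  fix e assume e: "e \<in> f"
  then show "e \<in> boundary_edges G X earc (star (nF f))"
    unfolding boundary_edges_def frontier_star[OF nF_T[OF f]] lnk_face[OF f]
    using face_edges[OF f e] by blast
qed

lemma embedding_X: "embedding G X pt earc"
  unfolding embedding_def
proof (intro conjI ballI impI)
  show "pt ` verts G \<subseteq> topspace X" using skel_eq by (auto simp: skel_def)
  show "inj_on pt (verts G)"
  proof (rule inj_onI)
    fix u v assume uv: "u \<in> verts G" "v \<in> verts G" and e: "pt u = pt v"
    have "nV u = nV v" using fun_cong[OF e, of "nV u"] by (simp add: ev_def split: if_splits)
    then show "u = v" using eqV[OF uv] by simp
  qed
  fix e assume e: "e \<in> edges G"
  have "continuous_on {0..1} (earc e)"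
  proof (rule continuous_on_coordinatewise_then_product)
    fix i
    consider "i = nV (eu e)" | "i = nE e" | "i = nV (ew e)" | "i \<noteq> nV (eu e)" "i \<noteq> nE e" "i \<noteq> nV (ew e)" by blast
    then show "continuous_on {0..1} (\<lambda>s. earc e s i)"
      using ends(5)[OF e] by cases (auto simp: earc_def intro!: continuous_intros)
  qed
  then show "pathin X (earc e)"
    using earc_K[OF e] by (simp add: pathin_def continuous_map_in_subtopology image_subset_iff_funcset)
  show "inj_on (earc e) {0..1}" by (rule earc_inj[OF e])
  have "pt ` {eu e, ew e} = {pt (eu e), pt (ew e)}" by simp
  then have "pt ` e = {pt (eu e), pt (ew e)}" by (simp only: ends(1)[OF e, symmetric])
  then show "{earc e 0, earc e 1} = pt ` e" using earc_ends[OF e] by simp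
  have pos: "0 < earc d s (nE d)" if "s \<in> {0<..<1}" for d s using that by (auto simp: earc_nE)
  show "earc e ` {0<..<1} \<inter> pt ` verts G = {}"
  proof (rule ccontr)
    assume "earc e ` {0<..<1} \<inter> pt ` verts G \<noteq> {}"
    then obtain s v where s: "s \<in> {0<..<1}" "earc e s = pt v" by blast
    have "0 < pt v (nE e)" using pos[OF s(1), of e] s(2) by simp
    then show False by (simp add: ev_def)
  qed
  fix d assume d: "d \<in> edges G" "e \<noteq> d"
  show "earc e ` {0<..<1} \<inter> earc d ` {0<..<1} = {}"
  proof (rule ccontr)
    assume "earc e ` {0<..<1} \<inter> earc d ` {0<..<1} \<noteq> {}"
    then obtain s s' where s: "s \<in> {0<..<1}" "s' \<in> {0<..<1}" "earc e s = earc d s'" by blast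
    have "0 < earc d s' (nE e)" using pos[OF s(1), of e] s(3) by simp
    moreover have "nE e \<noteq> nE d" using eqE[OF e d(1)] d(2) by simp
    ultimately show False by (simp add: earc_def)
  qed
qed

lemma cellular_X: "cellular_embedding G X pt earc"
  unfolding cellular_embedding_def faces_eq
proof (intro conjI ballI closed_surface_X embedding_X)
  fix F assume "F \<in> (\<lambda>f. star (nF f)) ` Q"
  then obtain f where f: "f \<in> Q" "F = star (nF f)" by blast
  show "subtopology X F homeomorphic_space open_disk"
    unfolding f(2) by (rule star_open_disk[OF nF_T[OF f(1)]])
qed

lemma quadrangular_X: "quadrangular G X pt earc"
  unfolding quadrangular_def faces_eq
proof
  fix F assume "F \<in> (\<lambda>f. star (nF f)) ` Q"
  then obtain f where f: "f \<in> Q" "F = star (nF f)" by blast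
  obtain a b c d where vs: "cycle_in G [a, b, c, d]" "f = cycle_edges [a, b, c, d]" using f(1) by (rule quadE)
  obtain h g where h: "homeomorphism (cball 0 1) (cstar (nF f)) h g" "h ` ball (0::complex) 1 = star (nF f)" "h ` sphere 0 1 = lnk (nF f)"
    using nF_T[OF f(1)] by (rule star_disk)
  have "subtopology X (X closure_of F) = top_of_set (cstar (nF f))"
    using closure_star[OF nF_T[OF f(1)]] cstar_K f(2) by (simp add: subtopology_subtopology Int_absorb1)
  then have hm: "homeomorphic_map closed_disk (subtopology X (X closure_of F)) h"
    using homeomorphic_maps_imp_map[OF homeomorphism_imp_maps[OF h(1)]] by (simp only:)
  have "h ` ball 0 1 = F" using h(2) f(2) by simp
  moreover have "h ` sphere 0 1 = (\<Union>e\<in>cycle_edges [a, b, c, d]. earc e ` {0..1})"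
    unfolding h(3) vs(2)[symmetric] by (rule lnk_face[OF f(1)])
  ultimately have "face_bounded_by X earc F [a, b, c, d]"
    unfolding face_bounded_by_def by (intro exI[of _ h] conjI hm)
  then show "\<exists>vs. cycle_in G vs \<and> length vs = 4 \<and> face_bounded_by X earc F vs"
    using vs(1) by (intro exI[of _ "[a, b, c, d]"]) simp
qed

lemma face_simple_X: "face_simple G X pt earc"
  unfolding face_simple_def faces_eq
proof (intro ballI impI)
  fix F F' e e' assume F: "F \<in> (\<lambda>f. star (nF f)) ` Q" "F' \<in> (\<lambda>f. star (nF f)) ` Q" "F \<noteq> F'"
    and e: "e \<in> boundary_edges G X earc F \<inter> boundary_edges G X earc F'"
      "e' \<in> boundary_edges G X earc F \<inter> boundary_edges G X earc F'"
  obtain f f' where f: "f \<in> Q" "F = star (nF f)" "f' \<in> Q" "F' = star (nF f')" using F by blast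
  then have "f \<noteq> f'" using F(3) by blast
  moreover have "e \<in> f \<inter> f'" "e' \<in> f \<inter> f'" using e f boundary_edges_face by simp_all
  ultimately show "e = e'" using qs_share f by blast
qed

section \<open>Orientability in terms of flags\<close>

lemma vt_flag:
  assumes "{nV v, nE e, nF f} \<in> T"
  shows "vt {nV v, nE e, nF f} 0 = nV v" "vt {nV v, nE e, nF f} 1 = nE e" "vt {nV v, nE e, nF f} 2 = nF f"
  using vt_col[OF assms, of "nV v"] vt_col[OF assms, of "nE e"] vt_col[OF assms, of "nF f"]
  by (simp_all add: colV colE colF)

lemma flag_eq:
  assumes "e \<in> edges G" "v \<in> verts G" "f \<in> Q" "e' \<in> edges G" "v' \<in> verts G" "f' \<in> Q"
  shows "{nV v, nE e, nF f} = {nV v', nE e', nF f'} \<longleftrightarrow> v = v' \<and> e = e' \<and> f = f'"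
proof
  assume eq: "{nV v, nE e, nF f} = {nV v', nE e', nF f'}"
  have "nV v \<in> {nV v', nE e', nF f'}" "nE e \<in> {nV v', nE e', nF f'}" "nF f \<in> {nV v', nE e', nF f'}"
    unfolding eq[symmetric] by auto
  then show "v = v' \<and> e = e' \<and> f = f'"
    using eqV[OF assms(2,5)] eqE[OF assms(1,4)] eqF[OF assms(3,6)] by auto
qed simp

text \<open>The moves \<open>nb 0\<close>, \<open>nb 1\<close> and \<open>nb 2\<close> change the
  vertex, the edge and the face of a flag, so \<open>flag_sign\<close> is \<open>alternating\<close>
  with truth values in place of signs.\<close>

lemma orientable_iff_flag_sign: "orientable X \<longleftrightarrow> (\<exists>s. flag_sign Q s)"
proof
  assume "orientable X"
  then obtain S where S: "alternating S" by (rule orientable_imp_alternating)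
  define s where "s v e f \<longleftrightarrow> S {nV v, nE e, nF f} = 1" for v e f
  have step: "s v' e' f' = (\<not> s v e f)"
    if "f \<in> Q" "e \<in> f" "v \<in> e" "f' \<in> Q" "e' \<in> f'" "v' \<in> e'" "k \<le> 2"
      "{nV v', nE e', nF f'} \<noteq> {nV v, nE e, nF f}"
      "{nV v, nE e, nF f} - {vt {nV v, nE e, nF f} k} \<subseteq> {nV v', nE e', nF f'}" for v e f v' e' f' k
  proof -
    have t: "{nV v, nE e, nF f} \<in> T" "{nV v', nE e', nF f'} \<in> T" using TI that by auto
    have "nb k {nV v, nE e, nF f} = {nV v', nE e', nF f'}" by (rule nb_eqI[OF t(1) that(7) t(2) that(8,9)])
    then have "S {nV v', nE e', nF f'} = - S {nV v, nE e, nF f}" using alternating_nb[OF S t(1) that(7)] by simp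
    moreover have "S {nV v, nE e, nF f} \<in> {1, -1}" by (rule alternating_val[OF S t(1)])
    ultimately show ?thesis unfolding s_def by auto
  qed
  have "flag_sign Q s"
    unfolding flag_sign_def
  proof (intro ballI conjI impI)
    fix f e v assume fev: "f \<in> Q" "e \<in> f" "v \<in> e"
    have eG: "e \<in> edges G" by (rule face_edges[OF fev(1,2)])
    have vG: "v \<in> verts G" by (rule edge_verts[OF eG fev(3)])
    note vt = vt_flag[OF TI[OF fev]]
    {
      fix v' assume v': "v' \<in> e" "v' \<noteq> v"
      show "s v' e f = (\<not> s v e f)"
        by (rule step[OF fev fev(1,2) v'(1), of 0])
          (use flag_eq[OF eG edge_verts[OF eG v'(1)] fev(1) eG vG fev(1)] v' vt in auto)
    next
      fix e' assume e': "e' \<in> f" "e' \<noteq> e" "v \<in> e'"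
      show "s v e' f = (\<not> s v e f)"
        by (rule step[OF fev fev(1) e'(1) e'(3), of 1])
          (use flag_eq[OF face_edges[OF fev(1) e'(1)] vG fev(1) eG vG fev(1)] e' vt in auto)
    next
      fix f' assume f': "f' \<in> Q" "f' \<noteq> f" "e \<in> f'"
      show "s v e f' = (\<not> s v e f)"
        by (rule step[OF fev f'(1) f'(3) fev(3), of 2])
          (use flag_eq[OF eG vG f'(1) eG vG fev(1)] f' vt in auto)
    }
  qed
  then show "\<exists>s. flag_sign Q s" by blast
next
  assume "\<exists>s. flag_sign Q s"
  then obtain s where s: "flag_sign Q s" by blast
  define S :: "nat set \<Rightarrow> int" where "S \<sigma> = (if \<exists>v e f. f \<in> Q \<and> e \<in> f \<and> v \<in> e \<and> \<sigma> = {nV v, nE e, nF f} \<and> s v e f then 1 else -1)" for \<sigma>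
  have S: "S {nV v, nE e, nF f} = (if s v e f then 1 else -1)" if fev: "f \<in> Q" "e \<in> f" "v \<in> e" for v e f
  proof -
    have eG: "e \<in> edges G" by (rule face_edges[OF fev(1,2)])
    have vG: "v \<in> verts G" by (rule edge_verts[OF eG fev(3)])
    have "(\<exists>v' e' f'. f' \<in> Q \<and> e' \<in> f' \<and> v' \<in> e' \<and> {nV v, nE e, nF f} = {nV v', nE e', nF f'} \<and> s v' e' f') \<longleftrightarrow> s v e f"
    proof
      assume "\<exists>v' e' f'. f' \<in> Q \<and> e' \<in> f' \<and> v' \<in> e' \<and> {nV v, nE e, nF f} = {nV v', nE e', nF f'} \<and> s v' e' f'"
      then obtain v' e' f' where 1: "f' \<in> Q" "e' \<in> f'" "v' \<in> e'" "{nV v, nE e, nF f} = {nV v', nE e', nF f'}" "s v' e' f'"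
        by blast
      have e'G: "e' \<in> edges G" by (rule face_edges[OF 1(1,2)])
      show "s v e f" using flag_eq[OF eG vG fev(1) e'G edge_verts[OF e'G 1(3)] 1(1)] 1(4,5) by simp
    qed (use fev in blast)
    then show ?thesis unfolding S_def by simp
  qed
  have "alternating S"
    unfolding alternating_def
  proof (intro ballI conjI allI impI)
    fix \<sigma> assume st: "\<sigma> \<in> T"
    show "S \<sigma> \<in> {1, -1}" by (simp add: S_def)
    fix k :: nat assume k: "k \<le> 2"
    from st obtain v e f where vef: "\<sigma> = {nV v, nE e, nF f}" "f \<in> Q" "e \<in> f" "v \<in> e" "e \<in> edges G" "v \<in> verts G" by (rule TE)
    from nb(1)[OF st k] obtain v' e' f' where vef': "nb k \<sigma> = {nV v', nE e', nF f'}" "f' \<in> Q" "e' \<in> f'" "v' \<in> e'" "e' \<in> edges G" "v' \<in> verts G" by (rule TE)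
    have ne: "\<not> (v' = v \<and> e' = e \<and> f' = f)"
    proof
      assume "v' = v \<and> e' = e \<and> f' = f"
      then have "nb k \<sigma> = {nV v, nE e, nF f}" using vef'(1) by simp
      then show False using nb(2)[OF st k] vef(1) by metis
    qed
    have sub: "\<sigma> - {vt \<sigma> k} \<subseteq> {nV v', nE e', nF f'}" using nb(3)[OF st k] vef'(1) by simp
    note vt = vt_flag[OF st[unfolded vef(1)], folded vef(1)]
    have mv: "nV v \<in> {nV v', nE e', nF f'} \<Longrightarrow> v' = v" and me: "nE e \<in> {nV v', nE e', nF f'} \<Longrightarrow> e' = e"
      and mf: "nF f \<in> {nV v', nE e', nF f'} \<Longrightarrow> f' = f"
      using eqV[OF vef(6) vef'(6)] eqE[OF vef(5) vef'(5)] eqF[OF vef(2) vef'(2)] by auto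
    have flip: "s v' e' f' = (\<not> s v e f)"
    proof -
      consider "k = 0" | "k = 1" | "k = 2" using k by linarith
      then show ?thesis
      proof cases
        case 1
        have "nE e \<in> \<sigma> - {vt \<sigma> k}" "nF f \<in> \<sigma> - {vt \<sigma> k}"
          unfolding 1 vt(1) unfolding vef(1) by simp_all
        then have q: "e' = e" "f' = f" using me mf sub by blast+
        show ?thesis unfolding q
          by (rule flag_sign_V[OF s vef(2,3,4)]) (use vef'(4) ne q in simp_all)
      next
        case 2
        have "nV v \<in> \<sigma> - {vt \<sigma> k}" "nF f \<in> \<sigma> - {vt \<sigma> k}"
          unfolding 2 vt(2) unfolding vef(1) by simp_all
        then have q: "v' = v" "f' = f" using mv mf sub by blast+
        show ?thesis unfolding q
          by (rule flag_sign_E[OF s vef(2,3,4)]) (use vef'(3,4) ne q in simp_all)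
      next
        case 3
        have "nV v \<in> \<sigma> - {vt \<sigma> k}" "nE e \<in> \<sigma> - {vt \<sigma> k}"
          unfolding 3 vt(3) unfolding vef(1) by simp_all
        then have q: "v' = v" "e' = e" using mv me sub by blast+
        show ?thesis unfolding q
          by (rule flag_sign_F[OF s vef(2,3,4)]) (use vef'(2,3) ne q in simp_all)
      qed
    qed
    show "S (nb k \<sigma>) = - S \<sigma>"
      unfolding vef'(1) S[OF vef'(2,3,4)] unfolding vef(1) S[OF vef(2,3,4)] using flip by simp
  qed
  then show "orientable X" by (rule alternating_imp_orientable)
qed

end

theorem quad_system_embedding:
  fixes G :: "'a graph"
  assumes "simple_graph G" "connected_graph G" "quad_system G Q"
  shows "\<exists>(X :: point topology) p a. cellular_embedding G X p a \<and> quadrangular G X p a \<and> face_simple G X p a \<and>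
    (orientable X \<longleftrightarrow> (\<exists>s. flag_sign Q s))"
proof -
  have fV: "finite (verts G)" using assms(1) by (simp add: simple_graph_def)
  have eV: "edges G \<subseteq> Pow (verts G)"
  proof
    fix e assume "e \<in> edges G"
    then have "\<exists>u\<in>verts G. \<exists>v\<in>verts G. u \<noteq> v \<and> e = {u, v}"
      using assms(1)[unfolded simple_graph_def, THEN conjunct2] by (rule_tac bspec)
    then show "e \<in> Pow (verts G)" by auto
  qed
  have fE: "finite (edges G)" using finite_subset[OF eV] fV by simp
  have qE: "Q \<subseteq> Pow (edges G)"
  proof
    fix f assume "f \<in> Q"
    then have "\<exists>vs. cycle_in G vs \<and> length vs = 4 \<and> f = cycle_edges vs"
      using assms(3)[unfolded quad_system_def, THEN conjunct1] by (rule_tac bspec)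
    then obtain vs where "cycle_in G vs" "f = cycle_edges vs" by blast
    then show "f \<in> Pow (edges G)" by (simp add: cycle_in_def)
  qed
  have fQ: "finite Q" using finite_subset[OF qE] fE by simp
  let ?g = "to_nat_on (verts G)" and ?h = "to_nat_on (edges G)" and ?k = "to_nat_on Q"
  have inj: "inj_on ?g (verts G)" "inj_on ?h (edges G)" "inj_on ?k Q"
    using fV fE fQ by (auto intro: inj_on_to_nat_on countable_finite)
  \<comment> \<open>Residues modulo 3 separate the numbers of vertices, edges and faces and serve as
    their colours.\<close>
  interpret quads G Q "\<lambda>v. 3 * ?g v" "\<lambda>e. 3 * ?h e + 1" "\<lambda>f. 3 * ?k f + 2" "\<lambda>n. n mod 3"
  proof
    show "inj_on (\<lambda>v. 3 * ?g v) (verts G)" "inj_on (\<lambda>e. 3 * ?h e + 1) (edges G)" "inj_on (\<lambda>f. 3 * ?k f + 2) Q"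
      using inj by (auto simp: inj_on_def)
    show "(3 * ?g v) mod 3 = 0" for v by simp
    show "(3 * ?h e + 1) mod 3 = 1" for e by presburger
    show "(3 * ?k f + 2) mod 3 = 2" for f by presburger
  qed (use assms in auto)
  show ?thesis
    by (rule exI[of _ X], rule exI[of _ pt], rule exI[of _ earc])
      (intro conjI cellular_X quadrangular_X face_simple_X orientable_iff_flag_sign)
qed

subsection \<open>Cyclic lists and dart sets\<close>

text \<open>The darts of a closed walk: consecutive pairs including the closing one from the last
  entry to the first, which the open version \<open>lc\<close> omits.\<close>

definition dl :: "'b list \<Rightarrow> ('b \<times> 'b) list" where
  "dl q = zip q (tl q @ [hd q])"

definition lc :: "'b list \<Rightarrow> ('b \<times> 'b) list" where
  "lc q = zip q (tl q)"

definition und :: "('b \<times> 'b) set \<Rightarrow> 'b set set" where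
  "und d = (\<lambda>(x, y). {x, y}) ` d"

text \<open>Adjacency by a dart in either direction; not the map of the same name in
  \<open>surf\<close>.\<close>

definition nb :: "('b \<times> 'b) set \<Rightarrow> 'b \<Rightarrow> 'b \<Rightarrow> bool" where
  "nb d x y \<longleftrightarrow> (x, y) \<in> d \<or> (y, x) \<in> d"

lemma und_iff: "{x, y} \<in> und d \<longleftrightarrow> nb d x y"
proof
  assume "{x, y} \<in> und d"
  then obtain a b where "(a, b) \<in> d" "{x, y} = {a, b}" unfolding und_def by auto
  then show "nb d x y" unfolding nb_def by (auto simp: doubleton_eq_iff)
next
  assume "nb d x y"
  then show "{x, y} \<in> und d" unfolding nb_def und_def by (force simp: insert_commute)
qed

lemma nb_sym: "nb d x y \<longleftrightarrow> nb d y x" by (auto simp: nb_def)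

lemma length_dl: "q \<noteq> [] \<Longrightarrow> length (dl q) = length q"
  by (cases q) (auto simp: dl_def)

lemma dl_nth: "i < length q \<Longrightarrow> dl q ! i = (q ! i, q ! (Suc i mod length q))"
proof -
  assume i: "i < length q"
  then obtain a r where q: "q = a # r" by (cases q) auto
  have "(r @ [a]) ! i = q ! (Suc i mod length q)"
    using i q by (cases "i = length r") (auto simp: nth_append)
  then show ?thesis using i q by (simp add: dl_def)
qed

lemma set_dl: "q \<noteq> [] \<Longrightarrow> set (dl q) = (\<lambda>i. (q ! i, q ! (Suc i mod length q))) ` {..<length q}"
  unfolding set_conv_nth using dl_nth[of _ q] by (auto simp: length_dl image_iff) metis

lemma in_dlE:
  assumes "(y, z) \<in> set (dl q)" "q \<noteq> []"
  obtains i where "i < length q" "y = q ! i" "z = q ! (Suc i mod length q)"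
  using assms unfolding set_dl[OF assms(2)] by blast

lemma und_dl: "q \<noteq> [] \<Longrightarrow> und (set (dl q)) = cycle_edges q"
  by (simp add: und_def set_dl cycle_edges_image image_image)

lemma dl_map: "dl (map f q) = map (map_prod f f) (dl q)"
proof (cases "q = []")
  case False
  then have "tl (map f q) @ [hd (map f q)] = map f (tl q @ [hd q])" by (simp add: map_tl hd_map)
  then show ?thesis unfolding dl_def by (simp only: zip_map_map map_prod_def)
qed (simp add: dl_def)

lemma lc_map: "lc (map f q) = map (map_prod f f) (lc q)"
  by (simp add: lc_def map_tl[symmetric] zip_map_map map_prod_def case_prod_unfold)

lemma dl_lc: "q \<noteq> [] \<Longrightarrow> set (dl q) = insert (last q, hd q) (set (lc q))"
proof (induction q)
  case (Cons a r)
  have "set (zip (a # r) (r @ [b])) = insert (last (a # r), b) (set (zip (a # r) r))" for b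
    by (induction r arbitrary: a) auto
  then show ?case by (simp add: dl_def lc_def)
qed simp

lemma lc_append:
  assumes "xs \<noteq> []" "ys \<noteq> []"
  shows "set (lc (xs @ ys)) = insert (last xs, hd ys) (set (lc xs) \<union> set (lc ys))"
  using assms(1)
proof (induction xs)
  case (Cons a r)
  show ?case
  proof (cases r)
    case Nil then show ?thesis using assms(2) by (cases ys) (auto simp: lc_def)
  next
    case (Cons b s)
    then show ?thesis using Cons.IH by (auto simp: lc_def)
  qed
qed simp

lemma lc_rev: "(y, z) \<in> set (lc (rev q)) \<longleftrightarrow> (z, y) \<in> set (lc q)"
proof (induction q)
  case (Cons a r)
  show ?case
  proof (cases "r = []")
    case True then show ?thesis by (simp add: lc_def)
  next
    case False
    have "set (lc (rev r @ [a])) = insert (last (rev r), a) (set (lc (rev r)))"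
      using lc_append[of "rev r" "[a]"] False by (simp add: lc_def)
    moreover have "set (lc (a # r)) = insert (a, hd r) (set (lc r))"
      using False by (cases r) (auto simp: lc_def)
    ultimately show ?thesis using Cons.IH False by (auto simp: last_rev)
  qed
qed (simp add: lc_def)

lemma lc_concat:
  assumes "\<forall>b\<in>set bs. b \<noteq> []" "bs \<noteq> []"
  shows "set (lc (concat bs)) = (\<Union>b\<in>set bs. set (lc b)) \<union> (\<lambda>(b, c). (last b, hd c)) ` set (lc bs)"
  using assms
proof (induction bs)
  case (Cons b bs)
  show ?case
  proof (cases "bs = []")
    case True then show ?thesis by (auto simp: lc_def)
  next
    case False
    have 1: "concat bs \<noteq> []" "hd (concat bs) = hd (hd bs)" using False Cons.prems by (cases bs; auto)+
    have 2: "set (lc (b # bs)) = insert (b, hd bs) (set (lc bs))" using False by (cases bs) (auto simp: lc_def)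
    show ?thesis
      using lc_append[of b "concat bs"] 1 2 Cons False by (auto simp: image_iff)
  qed
qed simp

text \<open>Rotations will be concatenations of one block for each neighbour: a consecutive pair
  lies inside a block or joins the last entry of a block to the first of the next.\<close>

lemma dl_concat:
  assumes "\<forall>b\<in>set bs. b \<noteq> []" "bs \<noteq> []"
  shows "set (dl (concat bs)) = (\<Union>b\<in>set bs. set (lc b)) \<union> (\<lambda>(b, c). (last b, hd c)) ` set (dl bs)"
proof -
  have 0: "concat bs \<noteq> []" "hd (concat bs) = hd (hd bs)"
    using assms by (cases bs; auto)+
  have "concat (butlast bs @ [last bs]) = concat (butlast bs) @ last bs" by simp
  then have "concat bs = concat (butlast bs) @ last bs" using assms(2) by simp
  moreover have "last bs \<noteq> []" using assms by simp
  ultimately have "last (concat bs) = last (last bs)" by (metis last_appendR)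
  note 1 = 0 this
  show ?thesis
    unfolding dl_lc[OF 1(1)] dl_lc[OF assms(2)] lc_concat[OF assms] 1(2,3) by auto
qed

text \<open>\<open>R3\<close> and \<open>R5\<close> together say that the corners at x are the
  consecutive pairs of \<open>rot x\<close>, and \<open>R4\<close> is face-simplicity. That an edge
  {x, y} lies in exactly two faces then follows: they are the faces at the corners on either side of
  y in \<open>rot x\<close>.\<close>

lemma quad_systemI:
  assumes H: "simple_graph H"
    and cyc: "\<And>d. d \<in> D \<Longrightarrow> \<exists>vs. cycle_in H vs \<and> length vs = 4 \<and> und d = cycle_edges vs"
    and R1: "\<And>x. x \<in> verts H \<Longrightarrow> distinct (rot x) \<and> 3 \<le> length (rot x) \<and> set (rot x) = {y. {x, y} \<in> edges H}"
    and R3: "\<And>x y z. x \<in> verts H \<Longrightarrow> (y, z) \<in> set (dl (rot x)) \<Longrightarrow> \<exists>d\<in>D. nb d x y \<and> nb d x z"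
    and R5: "\<And>d x y z. d \<in> D \<Longrightarrow> nb d x y \<Longrightarrow> nb d x z \<Longrightarrow> y \<noteq> z \<Longrightarrow> (y, z) \<in> set (dl (rot x)) \<or> (z, y) \<in> set (dl (rot x))"
    and R4: "\<And>d d' x y x' y'. d \<in> D \<Longrightarrow> d' \<in> D \<Longrightarrow> nb d x y \<Longrightarrow> nb d' x y \<Longrightarrow> nb d x' y' \<Longrightarrow> nb d' x' y' \<Longrightarrow>
        {x, y} \<noteq> {x', y'} \<Longrightarrow> und d = und d'"
  shows "quad_system H (und ` D)"
proof -
  have eH: "\<exists>x y. x \<in> verts H \<and> y \<in> verts H \<and> x \<noteq> y \<and> e = {x, y}" if "e \<in> edges H" for e
  proof -
    have "\<exists>u\<in>verts H. \<exists>v\<in>verts H. u \<noteq> v \<and> e = {u, v}"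
      using H[unfolded simple_graph_def, THEN conjunct2] that by (rule bspec)
    then show ?thesis by blast
  qed
  have dE: "e \<in> edges H" if "d \<in> D" "e \<in> und d" for d e
    using cyc[OF that(1)] that(2) by (auto simp: cycle_in_def)
  have share: "und d = und d'" if a: "d \<in> D" "d' \<in> D" "e \<in> und d" "e \<in> und d'" "e' \<in> und d" "e' \<in> und d'" "e \<noteq> e'" for d d' e e'
  proof -
    obtain x y where 1: "e = {x, y}" using eH[OF dE[OF a(1,3)]] by blast
    obtain x' y' where 2: "e' = {x', y'}" using eH[OF dE[OF a(1,5)]] by blast
    show ?thesis using R4[OF a(1,2)] a(3-7) unfolding 1 2 und_iff by blast
  qed
  have two: "e2 = e3" if d: "d \<in> D" and "e1 \<in> und d" "e2 \<in> und d" "e3 \<in> und d" "v \<in> e1" "v \<in> e2" "v \<in> e3" "e1 \<noteq> e2" "e1 \<noteq> e3"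
    for d e1 e2 e3 v
  proof -
    obtain vs where vs: "cycle_in H vs" "length vs = 4" "und d = cycle_edges vs" using cyc[OF d] by blast
    obtain a b c k where abcd: "vs = [a, b, c, k]" using length_4_cases[OF vs(2)] by blast
    then have "distinct [a, b, c, k]" "und d = {{a, b}, {b, c}, {c, k}, {k, a}}"
      using vs by (simp_all add: cycle_in_def cycle_edges_4)
    then show ?thesis using that(2-) by auto
  qed
  show ?thesis
    unfolding quad_system_def
  proof (intro conjI ballI impI)
    fix f assume "f \<in> und ` D"
    then show "\<exists>vs. cycle_in H vs \<and> length vs = 4 \<and> f = cycle_edges vs" using cyc by blast
  next
    fix f f' e e' assume "f \<in> und ` D" "f' \<in> und ` D" "f \<noteq> f'" "e \<in> f \<inter> f'" "e' \<in> f \<inter> f'"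
    then show "e = e'" using share by blast
  next
    fix x assume x: "x \<in> verts H"
    note r = R1[OF x]
    let ?es = "map (\<lambda>y. {x, y}) (rot x)"
    have rne: "rot x \<noteq> []" using r by auto
    have "inj_on (\<lambda>y. {x, y}) (set (rot x))" by (auto simp: inj_on_def doubleton_eq_iff)
    then have "distinct ?es" using r by (simp add: distinct_map)
    moreover have "set ?es = {e \<in> edges H. x \<in> e}"
    proof (intro equalityI subsetI)
      fix e assume "e \<in> {e \<in> edges H. x \<in> e}"
      then obtain y where "e = {x, y}" "e \<in> edges H" using eH by blast
      then show "e \<in> set ?es" using r by auto
    qed (use r in auto)
    moreover have "\<exists>f\<in>und ` D. ?es ! i \<in> f \<and> ?es ! (Suc i mod length ?es) \<in> f" if i: "i < length ?es" for i
    proof -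
      have l1: "i < length (rot x)" using i by simp
      then have l2: "Suc i mod length (rot x) < length (rot x)" by (intro mod_less_divisor) linarith
      note l = l1 l2
      have "(rot x ! i, rot x ! (Suc i mod length (rot x))) \<in> set (dl (rot x))"
        using dl_nth[OF l(1)] nth_mem[of i "dl (rot x)"] l length_dl[OF rne] by simp
      then obtain d where d: "d \<in> D" "nb d x (rot x ! i)" "nb d x (rot x ! (Suc i mod length (rot x)))"
        using R3[OF x] by blast
      then show ?thesis using l by (intro bexI[of _ "und d"]) (auto simp: und_iff)
    qed
    ultimately show "\<exists>es. distinct es \<and> 3 \<le> length es \<and> set es = {e \<in> edges H. x \<in> e} \<and>
        (\<forall>i<length es. \<exists>f\<in>und ` D. es ! i \<in> f \<and> es ! (Suc i mod length es) \<in> f)"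
      using r by (intro exI[of _ ?es]) simp
  next
    fix e assume e: "e \<in> edges H"
    then obtain x y where xy: "x \<in> verts H" "e = {x, y}" using eH by blast
    note r = R1[OF xy(1)]
    let ?n = "length (rot x)"
    have rne: "rot x \<noteq> []" using r by auto
    have n0: "0 < ?n" using rne by simp
    have "y \<in> set (rot x)" using r e xy by simp
    then obtain k where k: "k < ?n" "y = rot x ! k" by (auto simp: in_set_conv_nth)
    obtain p where p: "p < ?n" "Suc p mod ?n = k"
    proof (cases k)
      case 0
      have "Suc (?n - 1) = ?n" using n0 by linarith
      then show ?thesis using 0 n0 by (intro that[of "?n - 1"]) simp_all
    next
      case (Suc l) then show ?thesis using k that[of l] by simp
    qed
    let ?z = "rot x ! (Suc k mod ?n)" and ?w = "rot x ! p"
    have dm: "(rot x ! i, rot x ! (Suc i mod ?n)) \<in> set (dl (rot x))" if "i < ?n" for i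
      using dl_nth[OF that] nth_mem[of i "dl (rot x)"] that length_dl[OF rne] by simp
    have nq: "rot x ! i = rot x ! j \<longleftrightarrow> i = j" if "i < ?n" "j < ?n" for i j
      using r that by (simp add: nth_eq_iff_index_eq)
    have s: "Suc k mod ?n < ?n" using n0 by (rule mod_less_divisor)
    have kz: "k \<noteq> Suc k mod ?n" using r k by (cases "Suc k = ?n") auto
    have pk: "p \<noteq> k" using r p by (cases "Suc p = ?n") auto
    have pz: "p \<noteq> Suc k mod ?n"
      using mod_cycle_asym[of ?n k p] r k(1) p by metis
    obtain d1 where d1: "d1 \<in> D" "nb d1 x y" "nb d1 x ?z" using R3[OF xy(1) dm[OF k(1)]] k(2) by blast
    obtain d2 where d2: "d2 \<in> D" "nb d2 x ?w" "nb d2 x y" using R3[OF xy(1) dm[OF p(1)]] p(2) k(2) by blast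
    have n1: "{x, y} \<noteq> {x, ?z}" "{x, y} \<noteq> {x, ?w}" "{x, ?z} \<noteq> {x, ?w}"
      using nq[OF k(1) s] nq[OF k(1) p(1)] nq[OF s p(1)] kz pk pz k(2) by (auto simp: doubleton_eq_iff)
    \<comment> \<open>A 4-cycle has just two edges at x, but if the faces were equal there would be
      three: to y, to its successor and to its predecessor.\<close>
    have "und d1 \<noteq> und d2"
    proof
      assume eq: "und d1 = und d2"
      have "{x, y} \<in> und d1" "{x, ?z} \<in> und d1" "{x, ?w} \<in> und d2"
        using d1 d2 by (simp_all only: und_iff)
      then have "{x, y} \<in> und d1" "{x, ?z} \<in> und d1" "{x, ?w} \<in> und d1" using eq by simp_all
      then show False using two[OF d1(1), of "{x, y}" "{x, ?z}" "{x, ?w}" x] n1 by simp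
    qed
    moreover have "{f \<in> und ` D. e \<in> f} = {und d1, und d2}"
    proof (intro equalityI subsetI)
      fix f assume "f \<in> {f \<in> und ` D. e \<in> f}"
      then obtain d where d: "d \<in> D" "f = und d" "e \<in> und d" by blast
      obtain vs where vs: "cycle_in H vs" "length vs = 4" "und d = cycle_edges vs" using cyc[OF d(1)] by blast
      obtain a b c l where abcd: "vs = [a, b, c, l]" using length_4_cases[OF vs(2)] by blast
      then have q: "distinct [a, b, c, l]" "und d = {{a, b}, {b, c}, {c, l}, {l, a}}"
        using vs by (simp_all add: cycle_in_def cycle_edges_4)
      \<comment> \<open>The second neighbour of x in the face forms a corner with y. By
        \<open>R5\<close> it is the successor or the predecessor of y, and \<open>R4\<close> then
        identifies the face.\<close>
      have "\<exists>z. z \<noteq> y \<and> {x, z} \<in> und d"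
      proof -
        have "{x, y} \<in> {{a, b}, {b, c}, {c, l}, {l, a}}" using d(3) xy(2) q(2) by simp
        then consider "x = a" | "x = b" | "x = c" | "x = l" by (auto simp: doubleton_eq_iff)
        then show ?thesis
        proof cases
          case 1
          then have "{x, b} \<in> und d" "{x, l} \<in> und d" using q(2) by (auto simp: insert_commute)
          then show ?thesis using q(1) by (cases "y = b") auto
        next
          case 2
          then have "{x, a} \<in> und d" "{x, c} \<in> und d" using q(2) by (auto simp: insert_commute)
          then show ?thesis using q(1) by (cases "y = a") auto
        next
          case 3
          then have "{x, b} \<in> und d" "{x, l} \<in> und d" using q(2) by (auto simp: insert_commute)
          then show ?thesis using q(1) by (cases "y = b") auto
        next
          case 4
          then have "{x, a} \<in> und d" "{x, c} \<in> und d" using q(2) by (auto simp: insert_commute)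
          then show ?thesis using q(1) by (cases "y = a") auto
        qed
      qed
      then obtain z where z: "z \<noteq> y" "nb d x z" unfolding und_iff by blast
      have dy: "nb d x y" using d(3) xy(2) und_iff by metis
      have ne: "{x, y} \<noteq> {x, z}" using z(1) by (auto simp: doubleton_eq_iff)
      from R5[OF d(1) dy z(2)] z(1) consider "(y, z) \<in> set (dl (rot x))" | "(z, y) \<in> set (dl (rot x))" by blast
      then have "z = ?z \<or> z = ?w"
      proof cases
        case 1
        obtain i where i: "i < ?n" "y = rot x ! i" "z = rot x ! (Suc i mod ?n)" using 1 rne by (rule in_dlE)
        have "rot x ! i = rot x ! k" by (rule trans[OF i(2)[symmetric] k(2)])
        then have "i = k" by (rule nq[OF i(1) k(1), THEN iffD1])
        then show ?thesis using i(3) by (intro disjI1) (simp only:)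
      next
        case 2
        obtain i where i: "i < ?n" "z = rot x ! i" "y = rot x ! (Suc i mod ?n)" using 2 rne by (rule in_dlE)
        have l: "Suc i mod ?n < ?n" using n0 by (rule mod_less_divisor)
        have "rot x ! (Suc i mod ?n) = rot x ! k" by (rule trans[OF i(3)[symmetric] k(2)])
        then have "Suc i mod ?n = k" by (rule nq[OF l k(1), THEN iffD1])
        then have "Suc i mod ?n = Suc p mod ?n" using p(2) by (simp only:)
        then have "i = p" using i(1) p(1) by (auto simp: mod_Suc split: if_splits)
        then show ?thesis using i(2) by (intro disjI2) (simp only:)
      qed
      then have "und d = und d1 \<or> und d = und d2"
        using R4[OF d(1) d1(1) dy d1(2) z(2) _ ne] R4[OF d(1) d2(1) dy d2(3) z(2) _ ne] d1(3) d2(2) by blast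
      then show "f \<in> {und d1, und d2}" using d(2) by blast
    next
      fix f assume "f \<in> {und d1, und d2}"
      then show "f \<in> {f \<in> und ` D. e \<in> f}" using d1 d2 und_iff[of x y] xy(2) by auto
    qed
    ultimately show "\<exists>f f'. f \<noteq> f' \<and> {f \<in> und ` D. e \<in> f} = {f, f'}" by blast
  qed
qed

text \<open>A flag is positive if its vertex is the tail of its edge in the direction of its face.
  Changing the vertex turns tail into head; at a vertex of a directed cycle one edge enters and one
  leaves; and by \<open>uniq\<close> two faces run through a common edge in opposite
  directions.\<close>

lemma flag_sign_darts:
  assumes cyc: "\<And>d. d \<in> D \<Longrightarrow> \<exists>vs. distinct vs \<and> length vs = 4 \<and> d = set (dl vs)"
    and uniq: "\<And>d d' x y. d \<in> D \<Longrightarrow> d' \<in> D \<Longrightarrow> (x, y) \<in> d \<Longrightarrow> (x, y) \<in> d' \<Longrightarrow> und d = und d'"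
  shows "\<exists>s. flag_sign (und ` D) s"
proof -
  \<comment> \<open>Faces are edge sets, which forget the direction; one dart set is chosen for
    each.\<close>
  define ori where "ori f = (SOME d. d \<in> D \<and> und d = f)" for f
  have ori: "ori f \<in> D" "und (ori f) = f" if "f \<in> und ` D" for f
  proof -
    have "\<exists>d. d \<in> D \<and> und d = f" using that by blast
    then have "ori f \<in> D \<and> und (ori f) = f" unfolding ori_def by (rule someI_ex)
    then show "ori f \<in> D" "und (ori f) = f" by auto
  qed
  define s where "s v e f \<longleftrightarrow> (\<exists>y. e = {v, y} \<and> (v, y) \<in> ori f)" for v e f
  have 4: "\<exists>a b c l. distinct [a, b, c, l] \<and> d = {(a, b), (b, c), (c, l), (l, a)}" if "d \<in> D" for d
  proof -
    from cyc[OF that] obtain vs where vs: "distinct vs" "length vs = 4" "d = set (dl vs)" by blast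
    obtain a b c l where "vs = [a, b, c, l]" using length_4_cases[OF vs(2)] by blast
    then show ?thesis using vs by (intro exI[of _ a] exI[of _ b] exI[of _ c] exI[of _ l]) (simp add: dl_def)
  qed
  have s_iff: "s x {x, y} f \<longleftrightarrow> (x, y) \<in> ori f" for x y f
    unfolding s_def by (auto simp: doubleton_eq_iff)
  have asym: "(y, x) \<in> ori f \<longleftrightarrow> (x, y) \<notin> ori f" if fx: "f \<in> und ` D" "{x, y} \<in> f" for f x y
  proof -
    have "nb (ori f) x y" using ori[OF fx(1)] fx(2) und_iff by metis
    moreover obtain a b c l where "distinct [a, b, c, l]" "ori f = {(a, b), (b, c), (c, l), (l, a)}"
      using 4[OF ori(1)[OF fx(1)]] by blast
    ultimately show ?thesis unfolding nb_def by auto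
  qed
  have "flag_sign (und ` D) s"
    unfolding flag_sign_def
  proof (intro ballI conjI impI)
    fix f e v assume f: "f \<in> und ` D" and e: "e \<in> f" and v: "v \<in> e"
    obtain a b c l where q: "distinct [a, b, c, l]" "ori f = {(a, b), (b, c), (c, l), (l, a)}"
      using 4[OF ori(1)[OF f]] by blast
    have "e \<in> und (ori f)" using e ori(2)[OF f] by simp
    then obtain p r where "(p, r) \<in> ori f" "e = {p, r}" unfolding und_def by auto
    then obtain y where y: "e = {v, y}" "v \<noteq> y"
      using v q by auto
    {
      fix v' assume "v' \<in> e" "v' \<noteq> v"
      then have v': "v' = y" using y by auto
      have "s v' e f \<longleftrightarrow> (y, v) \<in> ori f" unfolding v' y(1) using s_iff[of y v f] by (simp add: insert_commute)
      also have "\<dots> \<longleftrightarrow> (v, y) \<notin> ori f" using asym[OF f] e y(1) by simp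
      finally show "s v' e f = (\<not> s v e f)" unfolding y(1) s_iff by simp
    next
      fix e' assume e': "e' \<in> f" "e' \<noteq> e" "v \<in> e'"
      have "e' \<in> und (ori f)" using e' ori(2)[OF f] by simp
      then obtain p' r' where "(p', r') \<in> ori f" "e' = {p', r'}" unfolding und_def by auto
      then obtain y' where y': "e' = {v, y'}" "v \<noteq> y'" using e'(3) q by auto
      have "y' \<noteq> y" using e'(2) y(1) y'(1) by auto
      moreover have "nb (ori f) v y" "nb (ori f) v y'"
        using e e'(1) ori(2)[OF f] y(1) y'(1) und_iff by metis+
      ultimately have "(v, y') \<in> ori f \<longleftrightarrow> (v, y) \<notin> ori f" using q unfolding nb_def by auto
      then show "s v e' f = (\<not> s v e f)" unfolding y(1) y'(1) s_iff .
    next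
      fix f' assume f': "f' \<in> und ` D" "f' \<noteq> f" "e \<in> f'"
      have "\<not> ((v, y) \<in> ori f \<and> (v, y) \<in> ori f')" "\<not> ((y, v) \<in> ori f \<and> (y, v) \<in> ori f')"
        using uniq[OF ori(1)[OF f] ori(1)[OF f'(1)]] ori(2)[OF f] ori(2)[OF f'(1)] f'(2) by metis+
      moreover have "(y, v) \<in> ori f \<longleftrightarrow> (v, y) \<notin> ori f" "(y, v) \<in> ori f' \<longleftrightarrow> (v, y) \<notin> ori f'"
        using asym[OF f] asym[OF f'(1)] e f'(3) y(1) by auto
      ultimately show "s v e f' = (\<not> s v e f)" unfolding y(1) s_iff by blast
    }
  qed
  then show ?thesis by blast
qed

subsection \<open>The two patterns\<close>

text \<open>The numbers 0 to 3 stand for the copy over u, 4 to 7 for the copy over v. With the four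
  quadrilaterals of \<open>slp\<close> these give eight directed 4-cycles that traverse each of the
  16 edges of K44 once in each direction and close up to a torus.\<close>

definition P4 :: "nat list list" where
  "P4 = [[0,6,2,5], [1,4,2,6], [1,5,2,7], [1,6,3,5]]"

text \<open>These ten and the four of \<open>slp\<close> traverse each of the 28 edges of K8 once in
  each direction; Euler characteristic 8 - 28 + 14 gives genus 4.\<close>

definition P8 :: "nat list list" where
  "P8 = [[0,1,2,3], [0,2,6,1], [0,3,1,5], [0,6,4,2], [1,3,5,2], [1,4,7,5], [1,6,5,7], [2,5,4,6], [2,7,6,3], [4,5,6,7]]"

definition pat :: "bool \<Rightarrow> nat list list" where
  "pat m = (if m then P8 else P4)"

text \<open>The cyclic order of the neighbours of vertex i in the closed pattern, cut open at the
  corner of the removed quadrilateral with i on its diagonal. That corner always lies between 7 and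
  4, so every list starts with 4 and ends with 7.\<close>

definition R :: "bool \<Rightarrow> nat \<Rightarrow> nat list" where
  "R m i = (if m then [[4,5,3,1,2,6,7], [4,5,3,2,0,6,7], [4,0,6,5,1,3,7], [4,5,1,0,2,6,7]] ! i
            else [[4,5,6,7], [4,6,5,7], [4,6,5,7], [4,5,6,7]] ! i)"

definition sw :: "nat \<Rightarrow> nat" where "sw k = (k + 4) mod 8"

definition nbl :: "nat list \<Rightarrow> nat \<Rightarrow> nat \<Rightarrow> bool" where
  "nbl p i j \<longleftrightarrow> (i, j) \<in> set (dl p) \<or> (j, i) \<in> set (dl p)"

text \<open>The edges around slit s of the first end: its two vertices are joined to (v,0) and
  (v,3), which are numbered 4 and 7.\<close>

definition sle :: "nat \<Rightarrow> nat \<Rightarrow> nat \<Rightarrow> bool" where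
  "sle s i j \<longleftrightarrow> (i = 2 * s \<or> i = 2 * s + 1) \<and> (j = 4 \<or> j = 7)"

text \<open>The quadrilaterals removed from the closed patterns, two slits for each end, in the
  direction that fits the others.\<close>

definition slp :: "nat list list" where
  "slp = [[0,4,1,7], [2,4,3,7], [4,0,5,3], [6,0,7,3]]"


lemma pat_basic:
  assumes "p \<in> set (pat m)"
  shows "length p = 4" "distinct p" "\<forall>i\<in>set p. i < 8" "\<forall>(i, j)\<in>set (dl p). i \<noteq> j \<and> (m \<or> (i < 4) \<noteq> (j < 4))"
proof -
  have "\<forall>p\<in>set (pat m). length p = 4 \<and> distinct p \<and> (\<forall>i\<in>set p. i < 8) \<and> (\<forall>(i, j)\<in>set (dl p). i \<noteq> j \<and> (m \<or> (i < 4) \<noteq> (j < 4)))"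
    unfolding list_all_iff[symmetric] by (cases m; simp only:; code_simp)
  from bspec[OF this assms] show "length p = 4" "distinct p" "\<forall>i\<in>set p. i < 8" "\<forall>(i, j)\<in>set (dl p). i \<noteq> j \<and> (m \<or> (i < 4) \<noteq> (j < 4))"
    by blast+
qed

text \<open>Exchanging the two ends permutes the quadrilaterals of a pattern, up to the starting
  points of the cyclic lists. Therefore edges of G need no direction, and only the vertices 0 to 3
  have to be examined.\<close>

lemma pat_swap:
  assumes "p \<in> set (pat m)"
  shows "\<exists>p'\<in>set (pat m). \<exists>n. map sw p = rotate n p'"
proof -
  have "\<forall>p\<in>set (pat m). \<exists>p'\<in>set (pat m). map sw p = p' \<or> map sw p = rotate1 p' \<or>
      map sw p = rotate1 (rotate1 p') \<or> map sw p = rotate1 (rotate1 (rotate1 p'))"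
    unfolding list_all_iff[symmetric] list_ex_iff[symmetric] by (cases m; simp only:; code_simp)
  from bspec[OF this assms] obtain p' where p': "p' \<in> set (pat m)" "map sw p = p' \<or> map sw p = rotate1 p' \<or>
      map sw p = rotate1 (rotate1 p') \<or> map sw p = rotate1 (rotate1 (rotate1 p'))" by blast
  then have "map sw p = rotate 0 p' \<or> map sw p = rotate 1 p' \<or> map sw p = rotate 2 p' \<or> map sw p = rotate 3 p'"
    by (simp add: numeral_2_eq_2 numeral_3_eq_3)
  then show ?thesis using p'(1) by blast
qed

lemma length_le_1D: "length xs \<le> 1 \<Longrightarrow> a \<in> set xs \<Longrightarrow> b \<in> set xs \<Longrightarrow> a = b"
  by (cases xs) auto

lemma pat_share:
  assumes "p \<in> set (pat m)" "p' \<in> set (pat m)" "p \<noteq> p'"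
    and "e \<in> set (dl p)" "nbl p' (fst e) (snd e)" "e' \<in> set (dl p)" "nbl p' (fst e') (snd e')"
  shows "e = e'"
proof -
  have "\<forall>p\<in>set (pat m). \<forall>p'\<in>set (pat m). p = p' \<or> length (filter (\<lambda>e. nbl p' (fst e) (snd e)) (dl p)) \<le> 1"
    unfolding list_all_iff[symmetric] by (cases m; simp only:; code_simp)
  then have "length (filter (\<lambda>e. nbl p' (fst e) (snd e)) (dl p)) \<le> 1" using assms(1-3) by blast
  then show ?thesis by (rule length_le_1D) (use assms(4-) in simp_all)
qed

text \<open>The finite core of face-simplicity between a pattern quadrilateral and a slit
  quadrilateral: whatever they share is an edge around the slit.\<close>

lemma pat_slit:
  assumes "p \<in> set (pat m)" "s < 2"
    and "e \<in> set (dl p)" "sle s (fst e) (snd e) \<or> sle s (snd e) (fst e)"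
    and "e' \<in> set (dl p)" "sle s (fst e') (snd e') \<or> sle s (snd e') (fst e')"
  shows "e = e'"
proof -
  have "\<forall>p\<in>set (pat m). \<forall>s\<in>set [0, 1]. length (filter (\<lambda>e. sle s (fst e) (snd e) \<or> sle s (snd e) (fst e)) (dl p)) \<le> 1"
    unfolding list_all_iff[symmetric] by (cases m; simp only:; code_simp)
  moreover have "s \<in> set [0, 1]" using assms(2) by auto
  ultimately have "length (filter (\<lambda>e. sle s (fst e) (snd e) \<or> sle s (snd e) (fst e)) (dl p)) \<le> 1"
    using assms(1) by blast
  then show ?thesis by (rule length_le_1D) (use assms(3-) in simp_all)
qed

text \<open>Void for the vertices of the second end, which \<open>pat_swap\<close> reduces to the
  first.\<close>

definition corner :: "bool \<Rightarrow> nat \<Rightarrow> nat \<Rightarrow> nat \<Rightarrow> bool" where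
  "corner m x y z \<longleftrightarrow> x < 4 \<longrightarrow> (y, z) \<in> set (lc (R m x)) \<or> (z, y) \<in> set (lc (R m x))"

lemma pat_corner:
  assumes "p \<in> set (pat m)" "x < 4" "nbl p x y" "nbl p x z" "y \<noteq> z"
  shows "(y, z) \<in> set (lc (R m x)) \<or> (z, y) \<in> set (lc (R m x))"
proof -
  have "\<forall>p\<in>set (pat m). corner m (p ! 0) (p ! 1) (p ! 3) \<and> corner m (p ! 1) (p ! 0) (p ! 2) \<and>
      corner m (p ! 2) (p ! 1) (p ! 3) \<and> corner m (p ! 3) (p ! 0) (p ! 2)"
    unfolding list_all_iff[symmetric] by (cases m; simp only:; code_simp)
  from bspec[OF this assms(1)]
  have c: "corner m (p ! 0) (p ! 1) (p ! 3)" "corner m (p ! 1) (p ! 0) (p ! 2)"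
      "corner m (p ! 2) (p ! 1) (p ! 3)" "corner m (p ! 3) (p ! 0) (p ! 2)" by blast+
  obtain a b c d where abcd: "p = [a, b, c, d]" using length_4_cases[OF pat_basic(1)[OF assms(1)]] by blast
  have n: "distinct [a, b, c, d]" using pat_basic(2)[OF assms(1)] abcd by simp
  have "corner m a b d" "corner m b a c" "corner m c b d" "corner m d a c" using c abcd by simp_all
  moreover have "corner m x y z \<longleftrightarrow> corner m x z y" for x y z by (auto simp: corner_def)
  moreover have "(x = a \<and> {y, z} = {b, d}) \<or> (x = b \<and> {y, z} = {a, c}) \<or> (x = c \<and> {y, z} = {b, d}) \<or> (x = d \<and> {y, z} = {a, c})"
    using assms(3-) n unfolding abcd nbl_def dl_def by auto
  ultimately have "corner m x y z" unfolding doubleton_eq_iff by metis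
  then show ?thesis using assms(2) by (simp add: corner_def)
qed

text \<open>The vertices 0 and 3 are outer corners of the removed quadrilaterals at the other end.
  Their rotations keep the corners between 4 and 5 and between 6 and 7, to be filled by slit
  quadrilaterals at the other end.\<close>

lemma R_slit:
  assumes "x = 0 \<or> x = 3" "s < 2"
  shows "(4 + 2 * s, 5 + 2 * s) \<in> set (lc (R m x)) \<or> (5 + 2 * s, 4 + 2 * s) \<in> set (lc (R m x))"
proof -
  have "\<forall>x\<in>set [0, 3]. \<forall>s\<in>set [0, 1]. (4 + 2 * s, 5 + 2 * s) \<in> set (lc (R m x)) \<or> (5 + 2 * s, 4 + 2 * s) \<in> set (lc (R m x))"
    unfolding list_all_iff[symmetric] by (cases m; simp only:; code_simp)
  moreover have "x \<in> set [0, 3]" "s \<in> set [0, 1]" using assms by auto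
  ultimately show ?thesis by blast
qed

text \<open>Converse of \<open>pat_corner\<close> and \<open>R_slit\<close>: a consecutive pair is a
  corner of the pattern or one of the corners left to a slit at the other end.\<close>

lemma R_faces:
  assumes "x < 4" "(y, z) \<in> set (lc (R m x))"
  shows "(\<exists>p\<in>set (pat m). nbl p x y \<and> nbl p x z) \<or>
    (x = 0 \<or> x = 3) \<and> (\<exists>s\<in>{0, 1}. y = 4 + 2 * s \<and> z = 5 + 2 * s \<or> y = 5 + 2 * s \<and> z = 4 + 2 * s)"
proof -
  have "\<forall>x\<in>set [0, 1, 2, 3]. \<forall>yz\<in>set (lc (R m x)). (\<exists>p\<in>set (pat m). nbl p x (fst yz) \<and> nbl p x (snd yz)) \<or>
    (x = 0 \<or> x = 3) \<and> (\<exists>s\<in>set [0, 1]. fst yz = 4 + 2 * s \<and> snd yz = 5 + 2 * s \<or> fst yz = 5 + 2 * s \<and> snd yz = 4 + 2 * s)"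
    unfolding list_all_iff[symmetric] list_ex_iff[symmetric] by (cases m; simp only:; code_simp)
  moreover have "x \<in> set [0, 1, 2, 3]" using assms(1) by auto
  ultimately have "(\<exists>p\<in>set (pat m). nbl p x y \<and> nbl p x z) \<or>
    (x = 0 \<or> x = 3) \<and> (\<exists>s\<in>set [0, 1]. y = 4 + 2 * s \<and> z = 5 + 2 * s \<or> y = 5 + 2 * s \<and> z = 4 + 2 * s)"
    using assms(2) by (metis fst_conv snd_conv)
  then show ?thesis unfolding list.set .
qed

lemma R_basic:
  assumes "x < 4"
  shows "distinct (R m x)" "set (R m x) = (if m then {..<8} - {x} else {4..<8})" "hd (R m x) = 4" "last (R m x) = 7" "R m x \<noteq> []" "4 \<le> length (R m x)"
proof -
  have "\<forall>x\<in>set [0, 1, 2, 3]. distinct (R m x) \<and> hd (R m x) = 4 \<and> last (R m x) = 7 \<and> R m x \<noteq> [] \<and> 4 \<le> length (R m x) \<and>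
      set (R m x) = (if m then set [0, 1, 2, 3, 4, 5, 6, 7] - {x} else set [4, 5, 6, 7])"
    unfolding list_all_iff[symmetric] by (cases m; simp only:; code_simp)
  moreover have "x \<in> set [0, 1, 2, 3]" using assms by auto
  ultimately have c: "distinct (R m x) \<and> hd (R m x) = 4 \<and> last (R m x) = 7 \<and> R m x \<noteq> [] \<and> 4 \<le> length (R m x) \<and>
      set (R m x) = (if m then set [0, 1, 2, 3, 4, 5, 6, 7] - {x} else set [4, 5, 6, 7])" by (rule bspec)
  have "{..<8::nat} = set [0, 1, 2, 3, 4, 5, 6, 7]" "{4..<8::nat} = set [4, 5, 6, 7]" by auto
  then show "set (R m x) = (if m then {..<8} - {x} else {4..<8})" using c by (simp only:)
  show "distinct (R m x)" "hd (R m x) = 4" "last (R m x) = 7" "R m x \<noteq> []" "4 \<le> length (R m x)"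
    using c by blast+
qed

text \<open>Coherence of the closed patterns. Including \<open>slp\<close> ensures that the slit
  quadrilaterals, which inherit the directions of the removed ones, fit as well.\<close>

lemma pat_darts: "distinct (concat (map dl (pat m @ slp)))"
  by (cases m; simp only:; code_simp)

lemma in_dlD: "(x, y) \<in> set (dl q) \<Longrightarrow> q \<noteq> [] \<and> x \<in> set q \<and> y \<in> set q"
proof -
  assume a: "(x, y) \<in> set (dl q)"
  then have q: "q \<noteq> []" by (auto simp: dl_def)
  have "x \<in> set q" "y \<in> set (tl q @ [hd q])"
    using a unfolding dl_def by (auto dest: set_zip_leftD set_zip_rightD)
  moreover have "set (tl q @ [hd q]) = set q" using q by (cases q) auto
  ultimately show ?thesis using q by blast
qed

lemma dl_functional:
  assumes "distinct q" "(v, w) \<in> set (dl q)" "(v', w') \<in> set (dl q)"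
  shows "v = v' \<longleftrightarrow> w = w'"
proof -
  have q: "q \<noteq> []" using in_dlD[OF assms(2)] by (rule conjunct1)
  then have m: "map fst (dl q) = q" "map snd (dl q) = tl q @ [hd q]"
    by (simp_all add: dl_def)
  have "distinct (map fst (dl q))" unfolding m by (rule assms(1))
  then have 1: "inj_on fst (set (dl q))" unfolding distinct_map by (rule conjunct2)
  have "distinct (map snd (dl q))" unfolding m using assms(1) q by (cases q) auto
  then have 2: "inj_on snd (set (dl q))" unfolding distinct_map by (rule conjunct2)
  show ?thesis
    using inj_onD[OF 1 _ assms(2,3)] inj_onD[OF 2 _ assms(2,3)] by auto
qed

lemma dl_left: "v \<in> set q \<Longrightarrow> \<exists>w. (v, w) \<in> set (dl q)"
proof -
  assume v: "v \<in> set q"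
  then have "q \<noteq> []" by auto
  then have "map fst (dl q) = q" by (simp add: dl_def)
  then have "v \<in> fst ` set (dl q)" using v by (metis set_map)
  then show ?thesis by auto
qed

lemma dl_right: "w \<in> set q \<Longrightarrow> \<exists>v. (v, w) \<in> set (dl q)"
proof -
  assume w: "w \<in> set q"
  then have "q \<noteq> []" by auto
  then have "map snd (dl q) = tl q @ [hd q]" "set (tl q @ [hd q]) = set q" by (simp add: dl_def, cases q) auto
  then have "w \<in> snd ` set (dl q)" using w by (metis set_map)
  then show ?thesis by auto
qed

lemma dl_rotate1: "dl (rotate1 q) = rotate1 (dl q)"
proof (cases q)
  case (Cons x xs)
  show ?thesis
  proof (cases xs)
    case (Cons y ys)
    have "zip ((y # ys) @ [x]) ((ys @ [x]) @ [y]) = zip (y # ys) (ys @ [x]) @ zip [x] [y]"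
      by (rule zip_append) simp
    then show ?thesis using Cons \<open>q = x # xs\<close> by (simp add: dl_def)
  qed (simp add: \<open>q = x # xs\<close> dl_def)
qed (simp add: dl_def)

lemma set_dl_rotate: "set (dl (rotate n q)) = set (dl q)"
  by (induction n) (simp_all add: dl_rotate1)

section \<open>Patterns placed over an edge of G\<close>

definition ph :: "'v \<Rightarrow> 'v \<Rightarrow> nat \<Rightarrow> 'v \<times> nat" where
  "ph u v k = (if k < 4 then (u, k) else (v, k - 4))"

lemma ph_inj: "u \<noteq> v \<Longrightarrow> ph u v i = ph u v j \<longleftrightarrow> i = j"
  by (auto simp: ph_def split: if_splits)

lemma ph_sw: "i < 8 \<Longrightarrow> ph v u i = ph u v (sw i)"
  by (auto simp: ph_def sw_def mod_if)

definition pin :: "'v \<Rightarrow> 'v \<Rightarrow> nat list \<Rightarrow> (('v \<times> nat) \<times> 'v \<times> nat) set" where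
  "pin u v p = set (dl (map (ph u v) p))"

lemma in_pin: "(x, y) \<in> pin u v p \<longleftrightarrow> (\<exists>i j. (i, j) \<in> set (dl p) \<and> x = ph u v i \<and> y = ph u v j)"
  by (auto simp: pin_def dl_map)

lemma nb_pin: "nb (pin u v p) x y \<longleftrightarrow> (\<exists>i j. nbl p i j \<and> x = ph u v i \<and> y = ph u v j)"
  unfolding nb_def nbl_def in_pin by blast

lemma pin_swap:
  assumes "p \<in> set (pat m)"
  shows "\<exists>p'\<in>set (pat m). pin v u p = pin u v p'"
proof -
  obtain p' n where p': "p' \<in> set (pat m)" "map sw p = rotate n p'" using pat_swap[OF assms] by blast
  have "map (ph v u) p = map (ph u v) (map sw p)"
    using pat_basic(3)[OF assms] by (simp add: ph_sw)
  also have "\<dots> = rotate n (map (ph u v) p')" unfolding p'(2) by (simp add: rotate_map)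
  finally have "pin v u p = pin u v p'" unfolding pin_def by (simp only: set_dl_rotate)
  then show ?thesis using p'(1) by blast
qed

lemma nb_pin_at:
  assumes "u \<noteq> v" "nb (pin u v p) (u, i) y"
  shows "\<exists>j. nbl p i j \<and> y = ph u v j \<and> i < 4"
proof -
  obtain i' j' where *: "nbl p i' j'" "(u, i) = ph u v i'" "y = ph u v j'" using assms(2) unfolding nb_pin by blast
  have "i' = i \<and> i < 4" using *(2) assms(1) by (cases "i' < 4") (simp_all add: ph_def)
  then show ?thesis using * by blast
qed

text \<open>Lets every argument at a vertex x assume that x lies over the first end of the
  pattern.\<close>

lemma pin_recenter:
  assumes "nb (pin u v p) x y" "p \<in> set (pat m)"
  shows "\<exists>w p'. {u, v} = {fst x, w} \<and> p' \<in> set (pat m) \<and> pin u v p = pin (fst x) w p'"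
proof -
  obtain i where "x = ph u v i" using assms(1) unfolding nb_pin by blast
  then consider "fst x = u" | "fst x = v" unfolding ph_def by (auto split: if_splits)
  then show ?thesis
  proof cases
    case 1 then show ?thesis using assms(2) by (intro exI[of _ v] exI[of _ p]) simp
  next
    case 2
    obtain p' where "p' \<in> set (pat m)" "pin u v p = pin v u p'" using pin_swap[OF assms(2), where u = v and v = u] by blast
    then show ?thesis using 2 by (intro exI[of _ u] exI[of _ p']) (simp add: insert_commute)
  qed
qed

section \<open>The blow-up of G with prescribed twists\<close>

locale blowup =
  fixes G :: "'v graph" and M :: "'v set set" and L :: "'v \<Rightarrow> 'v list" and tw :: "'v \<Rightarrow> nat \<Rightarrow> 'v \<Rightarrow> bool"
  assumes simple: "simple_graph G"
    and connected: "connected_graph G"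
    and M_sub: "M \<subseteq> edges G"
    and mate_ex: "u \<in> verts G \<Longrightarrow> \<exists>v. {u, v} \<in> M"
    and mate_unique: "{u, v} \<in> M \<Longrightarrow> {u, v'} \<in> M \<Longrightarrow> v = v'"
    and L_distinct: "u \<in> verts G \<Longrightarrow> distinct (L u)"
    and L_set: "u \<in> verts G \<Longrightarrow> set (L u) = {v. {u, v} \<in> edges G}"
begin

abbreviation mt :: "'v \<Rightarrow> 'v \<Rightarrow> bool" where "mt u v \<equiv> {u, v} \<in> M"

abbreviation H :: "('v \<times> nat) graph" where "H \<equiv> lex_product G (complete_graph 4)"

text \<open>In the rotations at (u,2s) and (u,2s+1) the block of v starts at (v,0) and ends at
  (v,3). A twist \<open>tw u s v\<close> exchanges the two, which reflects the pattern over uv at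
  this one slit.\<close>

definition lt :: "'v \<Rightarrow> nat \<Rightarrow> 'v \<Rightarrow> nat" where "lt u s v = (if tw u s v then 3 else 0)"

definition rt :: "'v \<Rightarrow> nat \<Rightarrow> 'v \<Rightarrow> nat" where "rt u s v = (if tw u s v then 0 else 3)"

text \<open>Half of the removed quadrilateral of w and half of that of v, glued along the diagonal
  from (a,2s) to (a,2s+1). If a has a single neighbour, then v = w and the removed quadrilateral is
  put back.\<close>

definition slit :: "'v \<Rightarrow> nat \<Rightarrow> 'v \<Rightarrow> 'v \<Rightarrow> (('v \<times> nat) \<times> 'v \<times> nat) set" where
  "slit a s v w = set (dl [(a, 2 * s), (w, lt a s w), (a, 2 * s + 1), (v, rt a s v)])"

definition D :: "(('v \<times> nat) \<times> 'v \<times> nat) set set" where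
  "D = {pin u v p | u v p. {u, v} \<in> edges G \<and> p \<in> set (pat (mt u v))} \<union>
       {slit a s v w | a s v w. a \<in> verts G \<and> s < 2 \<and> (v, w) \<in> set (dl (L a))}"

text \<open>The slit containing (u,i) is number \<open>i div 2\<close>. A twisted block is read
  backwards, so it starts at (v,3), in accordance with \<open>lt\<close>.\<close>

definition blk :: "'v \<Rightarrow> nat \<Rightarrow> 'v \<Rightarrow> ('v \<times> nat) list" where
  "blk u i v = map (ph u v) (if tw u (i div 2) v then rev (R (mt u v) i) else R (mt u v) i)"

definition rot :: "'v \<times> nat \<Rightarrow> ('v \<times> nat) list" where
  "rot x = concat (map (blk (fst x) (snd x)) (L (fst x)))"

lemma edgeD:
  assumes "{u, v} \<in> edges G"
  shows "u \<noteq> v" "u \<in> verts G" "v \<in> verts G" "v \<in> set (L u)" "u \<in> set (L v)"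
proof -
  have "\<exists>a\<in>verts G. \<exists>b\<in>verts G. a \<noteq> b \<and> {u, v} = {a, b}"
    using simple[unfolded simple_graph_def, THEN conjunct2] assms by (rule bspec)
  then show 1: "u \<noteq> v" "u \<in> verts G" "v \<in> verts G" by (auto simp: doubleton_eq_iff)
  show "v \<in> set (L u)" "u \<in> set (L v)" using L_set[OF 1(2)] L_set[OF 1(3)] assms by (simp_all add: insert_commute)
qed

lemma L_edge: "u \<in> verts G \<Longrightarrow> v \<in> set (L u) \<Longrightarrow> {u, v} \<in> edges G"
  using L_set by auto

lemma dl_L:
  assumes "u \<in> verts G" "(v, w) \<in> set (dl (L u))"
  shows "{u, v} \<in> edges G" "{u, w} \<in> edges G" "u \<noteq> v" "u \<noteq> w"
proof -
  show 1: "{u, v} \<in> edges G" "{u, w} \<in> edges G"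
    using L_edge[OF assms(1)] in_dlD[OF assms(2)] by auto
  show "u \<noteq> v" "u \<noteq> w" using edgeD(1)[OF 1(1)] edgeD(1)[OF 1(2)] by auto
qed

lemma mtE: "mt u v \<Longrightarrow> {u, v} \<in> edges G"
  using M_sub by auto

lemma verts_H: "verts H = verts G \<times> {..<4}"
  by (simp add: lex_product_def complete_graph_def)

lemma edges_H: "{(u, i), (v, j)} \<in> edges H \<longleftrightarrow>
    i < 4 \<and> j < 4 \<and> ({u, v} \<in> edges G \<or> u = v \<and> u \<in> verts G \<and> i \<noteq> j)"
proof
  have K: "{w1, w2} \<in> edges (complete_graph 4) \<longleftrightarrow> w1 < 4 \<and> w2 < 4 \<and> w1 \<noteq> w2" for w1 w2
    by (auto simp: complete_graph_def doubleton_eq_iff)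
  assume "{(u, i), (v, j)} \<in> edges H"
  then have "\<exists>v1 w1 v2 w2. {(u, i), (v, j)} = {(v1, w1), (v2, w2)} \<and> v1 \<in> verts G \<and> v2 \<in> verts G \<and>
      w1 \<in> verts (complete_graph 4) \<and> w2 \<in> verts (complete_graph 4) \<and>
      ({v1, v2} \<in> edges G \<or> v1 = v2 \<and> {w1, w2} \<in> edges (complete_graph 4))"
    unfolding lex_product_def snd_conv mem_Collect_eq .
  then obtain v1 w1 v2 w2 where *: "{(u, i), (v, j)} = {(v1, w1), (v2, w2)}" "v1 \<in> verts G" "v2 \<in> verts G"
      "w1 \<in> verts (complete_graph 4)" "w2 \<in> verts (complete_graph 4)"
      "{v1, v2} \<in> edges G \<or> v1 = v2 \<and> w1 \<noteq> w2"
    unfolding K by blast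
  have "w1 < 4" "w2 < 4" using *(4,5) by (simp_all add: complete_graph_def)
  then show "i < 4 \<and> j < 4 \<and> ({u, v} \<in> edges G \<or> u = v \<and> u \<in> verts G \<and> i \<noteq> j)"
    using * by (auto simp: doubleton_eq_iff insert_commute)
next
  assume a: "i < 4 \<and> j < 4 \<and> ({u, v} \<in> edges G \<or> u = v \<and> u \<in> verts G \<and> i \<noteq> j)"
  have K: "{i, j} \<in> edges (complete_graph 4) \<longleftrightarrow> i \<noteq> j" "i \<in> verts (complete_graph 4)" "j \<in> verts (complete_graph 4)"
    using a by (auto simp: complete_graph_def doubleton_eq_iff)
  have "u \<in> verts G" "v \<in> verts G" using a edgeD by auto
  then show "{(u, i), (v, j)} \<in> edges H"
    using a K unfolding lex_product_def snd_conv mem_Collect_eq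
    by (intro exI[of _ u] exI[of _ i] exI[of _ v] exI[of _ j]) simp
qed

lemma simple_H: "simple_graph H"
  unfolding simple_graph_def
proof (intro conjI ballI)
  show "finite (verts H)" using simple by (simp add: verts_H simple_graph_def)
  fix e assume e: "e \<in> edges H"
  then obtain v1 w1 v2 w2 where v: "e = {(v1, w1), (v2, w2)}" unfolding lex_product_def by auto
  then have h: "w1 < 4 \<and> w2 < 4 \<and> ({v1, v2} \<in> edges G \<or> v1 = v2 \<and> v1 \<in> verts G \<and> w1 \<noteq> w2)"
    using e by (simp only: edges_H)
  then have "(v1, w1) \<in> verts H" "(v2, w2) \<in> verts H" "(v1, w1) \<noteq> (v2, w2)"
    using edgeD unfolding verts_H by auto
  then show "\<exists>u\<in>verts H. \<exists>v\<in>verts H. u \<noteq> v \<and> e = {u, v}" using v by blast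
qed

lemma connected_H: "connected_graph H"
proof -
  have G: "verts G \<noteq> {}" "(u, v) \<in> {(x, y). {x, y} \<in> edges G}\<^sup>*" if "u \<in> verts G" "v \<in> verts G" for u v
    using connected that unfolding connected_graph_def by auto
  have "((u, i), (v, j)) \<in> {(x, y). {x, y} \<in> edges H}\<^sup>*"
    if "u \<in> verts G" "i < 4" "j < 4" "(u, v) \<in> {(x, y). {x, y} \<in> edges G}\<^sup>*" for u v i j
    using that(4,3)
  proof (induction arbitrary: j)
    case base
    show ?case
    proof (cases "i = j")
      case False
      then have "{(u, i), (u, j)} \<in> edges H" using that(1,2) base by (simp add: edges_H)
      then show ?thesis by (intro r_into_rtrancl) simp
    qed simp
  next
    case (step y z)
    have "((u, i), (y, 0)) \<in> {(x, y). {x, y} \<in> edges H}\<^sup>*" using step.IH[of 0] by simp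
    moreover have "((y, 0), (z, j)) \<in> {(x, y). {x, y} \<in> edges H}"
      using step.hyps(2) step.prems by (simp add: edges_H)
    ultimately show ?case by (rule rtrancl_into_rtrancl)
  qed
  then show ?thesis
    using G connected unfolding connected_graph_def verts_H by (auto simp: lessThan_empty_iff)
qed

lemma D_cases:
  assumes "d \<in> D"
  obtains u v p where "d = pin u v p" "{u, v} \<in> edges G" "p \<in> set (pat (mt u v))"
  | a s v w where "d = slit a s v w" "a \<in> verts G" "s < 2" "(v, w) \<in> set (dl (L a))"
  using assms unfolding D_def by blast

lemma pin_D: "{u, v} \<in> edges G \<Longrightarrow> p \<in> set (pat (mt u v)) \<Longrightarrow> pin u v p \<in> D"
  unfolding D_def by blast

lemma slit_D: "a \<in> verts G \<Longrightarrow> s < 2 \<Longrightarrow> (v, w) \<in> set (dl (L a)) \<Longrightarrow> slit a s v w \<in> D"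
  unfolding D_def by blast

lemma slit_darts:
  "slit a s v w = {((a, 2 * s), (w, lt a s w)), ((w, lt a s w), (a, 2 * s + 1)),
     ((a, 2 * s + 1), (v, rt a s v)), ((v, rt a s v), (a, 2 * s))}"
  by (simp add: slit_def dl_def)

lemma lt_rt: "lt a s v \<noteq> rt a s v" "lt a s v = 0 \<or> lt a s v = 3" "rt a s v = 0 \<or> rt a s v = 3"
  "i = 0 \<or> i = 3 \<Longrightarrow> i = lt a s v \<or> i = rt a s v" "lt a s v < 4" "rt a s v < 4"
  by (auto simp: lt_def rt_def)

text \<open>The pairs of opposite corners of a slit quadrilateral, \<open>SA\<close> on its diagonal
  and \<open>SB\<close> outside; its four edges are all those between the two pairs.\<close>

definition SA where "SA a s = {(a, 2 * s), (a, 2 * s + 1 :: nat)}" for a :: 'v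
definition SB where "SB a s v w = {(w, lt a s w), (v, rt a s v)}"

lemma nb_slit: "nb (slit a s v w) x y \<longleftrightarrow> x \<in> SA a s \<and> y \<in> SB a s v w \<or> x \<in> SB a s v w \<and> y \<in> SA a s"
  unfolding nb_def slit_darts SA_def SB_def by blast

lemma SA_iff: "(u, i) \<in> SA a s \<longleftrightarrow> u = a \<and> i div 2 = s"
  unfolding SA_def by auto

lemma D_cycle:
  assumes "d \<in> D"
  shows "\<exists>vs. distinct vs \<and> length vs = 4 \<and> d = set (dl vs) \<and> (\<forall>(x, y)\<in>d. {x, y} \<in> edges H)"
  using assms
proof (cases rule: D_cases)
  case (1 u v p)
  note b = pat_basic[OF 1(3)]
  have uv: "u \<noteq> v" using edgeD(1)[OF 1(2)] .
  have "{ph u v i, ph u v j} \<in> edges H" if ij: "(i, j) \<in> set (dl p)" for i j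
  proof -
    have lt: "i < 8" "j < 8" using in_dlD[OF ij] b(3) by auto
    have ij': "i \<noteq> j" "mt u v \<or> (i < 4) \<noteq> (j < 4)" using b(4) ij by auto
    show ?thesis
      using ij' lt 1(2) edgeD(2,3)[OF 1(2)] unfolding ph_def
      by (auto simp: edges_H insert_commute split: if_splits)
  qed
  moreover have "distinct (map (ph u v) p)" using b(2) ph_inj[OF uv] by (simp add: distinct_map inj_on_def)
  moreover have "pin u v p = set (dl (map (ph u v) p))" by (rule pin_def)
  moreover have "\<forall>(x, y)\<in>pin u v p. {x, y} \<in> edges H"
  proof clarify
    fix a i b j assume "((a, i), b, j) \<in> pin u v p"
    then obtain i' j' where "(i', j') \<in> set (dl p)" "(a, i) = ph u v i'" "(b, j) = ph u v j'" unfolding in_pin by blast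
    then show "{(a, i), (b, j)} \<in> edges H" using calculation(1) by simp
  qed
  ultimately show ?thesis
    unfolding 1(1) using b(1) by (intro exI[of _ "map (ph u v) p"]) simp
next
  case (2 a s v w)
  note e = dl_L[OF 2(2,4)]
  have "{(a, i), (w, lt a s w)} \<in> edges H" "{(w, lt a s w), (a, i)} \<in> edges H"
    "{(a, i), (v, rt a s v)} \<in> edges H" "{(v, rt a s v), (a, i)} \<in> edges H" if "i < 4" for i
    using that e lt_rt(5,6) by (simp_all add: edges_H insert_commute)
  moreover have "2 * s < 4" "2 * s + 1 < 4" using 2(3) by linarith+
  ultimately have "\<forall>(x, y)\<in>d. {x, y} \<in> edges H" unfolding 2(1) slit_darts by simp
  moreover have "distinct [(a, 2 * s), (w, lt a s w), (a, 2 * s + 1), (v, rt a s v)]"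
    using e lt_rt(1) by auto
  ultimately show ?thesis unfolding 2(1)
    by (intro exI[of _ "[(a, 2 * s), (w, lt a s w), (a, 2 * s + 1), (v, rt a s v)]"]) (simp add: slit_def)
qed

end

section \<open>Rotations around the vertices\<close>

context blowup begin

lemma pin_locate:
  assumes "{u', v'} \<in> edges G" "p' \<in> set (pat (mt u' v'))" "nb (pin u' v' p') (u, i) y"
  obtains v p where "{u, v} \<in> edges G" "p \<in> set (pat (mt u v))" "pin u' v' p' = pin u v p" "u \<noteq> v"
proof -
  obtain v p where "{u', v'} = {u, v}" "p \<in> set (pat (mt u' v'))" "pin u' v' p' = pin u v p"
    using pin_recenter[OF assms(3,2)] by auto
  then show ?thesis using assms(1) edgeD(1) by (intro that[of v p]) auto
qed

lemma blk_ends: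
  assumes "i < 4"
  shows "hd (blk u i v) = (v, lt u (i div 2) v)" "last (blk u i v) = (v, rt u (i div 2) v)" "blk u i v \<noteq> []"
    "distinct (blk u i v) \<longleftrightarrow> inj_on (ph u v) (set (R (mt u v) i))" "4 \<le> length (blk u i v)"
    "set (blk u i v) = ph u v ` set (R (mt u v) i)"
  using R_basic[OF assms, of "mt u v"]
  unfolding blk_def lt_def rt_def
  by (auto simp: hd_map last_map hd_rev last_rev distinct_map ph_def)

text \<open>Every block covers the copy over v, and only the block of the mate adds vertices of the
  copy over u itself. Hence each neighbour of (u,i) occurs in exactly one block of its
  rotation.\<close>

lemma set_blk:
  assumes "i < 4"
  shows "set (blk u i v) = {v} \<times> {..<4} \<union> (if mt u v then {u} \<times> ({..<4} - {i}) else {})"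
proof -
  have 1: "ph u v ` {4..<8} = {v} \<times> {..<4}"
  proof (intro equalityI subsetI)
    fix x assume "x \<in> {v} \<times> {..<4::nat}"
    then obtain j where "x = (v, j)" "j < 4" by auto
    then show "x \<in> ph u v ` {4..<8}" by (intro image_eqI[of _ _ "j + 4"]) (auto simp: ph_def)
  qed (auto simp: ph_def)
  have 2: "ph u v ` ({..<4} - {i}) = {u} \<times> ({..<4} - {i})" by (auto simp: ph_def image_iff)
  have 3: "{..<8} - {i} = {4..<8} \<union> ({..<4} - {i})" using assms by auto
  show ?thesis
    unfolding blk_ends(6)[OF assms] R_basic(2)[OF assms] using 1 2 by (simp add: 3 image_Un)
qed

lemma lc_blk: "(y, z) \<in> set (lc (blk u i v)) \<longleftrightarrow>
    (\<exists>j k. y = ph u v j \<and> z = ph u v k \<and>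
       (if tw u (i div 2) v then (k, j) else (j, k)) \<in> set (lc (R (mt u v) i)))"
proof -
  have "(y, z) \<in> set (lc (map f q)) \<longleftrightarrow> (\<exists>j k. y = f j \<and> z = f k \<and> (j, k) \<in> set (lc q))" for f :: "nat \<Rightarrow> 'v \<times> nat" and q
    unfolding lc_map by force
  then show ?thesis by (simp add: blk_def lc_rev)
qed

text \<open>Pairs inside a block are corners of the pattern or of slits at the other end v; pairs
  between consecutive blocks are corners of slits at u.\<close>

lemma rot_dl:
  assumes "u \<in> verts G" "i < 4" "L u \<noteq> []"
  shows "set (dl (rot (u, i))) = (\<Union>v\<in>set (L u). set (lc (blk u i v))) \<union>
    (\<lambda>(v, w). ((v, rt u (i div 2) v), (w, lt u (i div 2) w))) ` set (dl (L u))"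
proof -
  have "set (dl (rot (u, i))) = (\<Union>b\<in>set (map (blk u i) (L u)). set (lc b)) \<union>
      (\<lambda>(b, c). (last b, hd c)) ` set (dl (map (blk u i) (L u)))"
    unfolding rot_def fst_conv snd_conv using assms blk_ends(3)[OF assms(2)] by (intro dl_concat) auto
  moreover have "(\<lambda>(b, c). (last b, hd c)) ` set (dl (map (blk u i) (L u))) =
      (\<lambda>(v, w). ((v, rt u (i div 2) v), (w, lt u (i div 2) w))) ` set (dl (L u))"
    unfolding dl_map set_map image_image by (intro image_cong refl) (auto simp: blk_ends(1,2)[OF assms(2)])
  ultimately show ?thesis by simp
qed

lemma L_nonempty: "u \<in> verts G \<Longrightarrow> L u \<noteq> []"
  using mate_ex[of u] mtE edgeD(4) by fastforce

lemma rot_basic: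
  assumes "x \<in> verts H"
  shows "distinct (rot x) \<and> 3 \<le> length (rot x) \<and> set (rot x) = {y. {x, y} \<in> edges H}"
proof -
  obtain u i where x: "x = (u, i)" "u \<in> verts G" "i < 4" using assms unfolding verts_H by auto
  have L: "{u, v} \<in> edges G" "u \<noteq> v" if "v \<in> set (L u)" for v
    using L_edge[OF x(2) that] edgeD(1) by blast+
  have disj: "set (blk u i v) \<inter> set (blk u i w) = {}" if "v \<in> set (L u)" "w \<in> set (L u)" "v \<noteq> w" for v w
  proof -
    have "\<not> (mt u v \<and> mt u w)" using mate_unique that(3) by blast
    then show ?thesis using L(2)[OF that(1)] L(2)[OF that(2)] that(3) unfolding set_blk[OF x(3)] by auto
  qed
  have "distinct (rot x)"
    unfolding rot_def x(1) fst_conv snd_conv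
  proof (rule distinct_concat)
    have "inj_on (blk u i) (set (L u))"
    proof (rule inj_onI)
      fix v w assume a: "v \<in> set (L u)" "w \<in> set (L u)" "blk u i v = blk u i w"
      show "v = w"
      proof (rule ccontr)
        assume "v \<noteq> w"
        from disj[OF a(1,2) this] have "set (blk u i v) = {}" using a(3) by simp
        then show False using blk_ends(3)[OF x(3)] by simp
      qed
    qed
    then show "distinct (map (blk u i) (L u))" using L_distinct[OF x(2)] by (simp add: distinct_map)
    show "distinct b" if b: "b \<in> set (map (blk u i) (L u))" for b
    proof -
      obtain v where v: "v \<in> set (L u)" "b = blk u i v" using b by auto
      show ?thesis unfolding v(2) blk_ends(4)[OF x(3)] using ph_inj[OF L(2)[OF v(1)]] by (simp add: inj_on_def)
    qed
    show "set b \<inter> set c = {}" if bc: "b \<in> set (map (blk u i) (L u))" "c \<in> set (map (blk u i) (L u))" "b \<noteq> c" for b c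
    proof -
      obtain v w where "v \<in> set (L u)" "w \<in> set (L u)" "b = blk u i v" "c = blk u i w" using bc(1,2) by auto
      then show ?thesis using disj bc(3) by blast
    qed
  qed
  moreover have "3 \<le> length (rot x)"
  proof -
    obtain v r where "L u = v # r" using L_nonempty[OF x(2)] by (cases "L u") auto
    then show ?thesis using blk_ends(5)[OF x(3), of u v] by (simp add: rot_def x(1))
  qed
  moreover have "set (rot x) = {y. {x, y} \<in> edges H}"
  proof -
    obtain m where m: "mt u m" using mate_ex[OF x(2)] by blast
    have mL: "m \<in> set (L u)" using edgeD(4)[OF mtE[OF m]] .
    have "(v, j) \<in> set (rot x) \<longleftrightarrow> {x, (v, j)} \<in> edges H" for v j
    proof -
      have "(v, j) \<in> set (rot x) \<longleftrightarrow> (\<exists>w\<in>set (L u). (v, j) \<in> set (blk u i w))"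
        by (simp add: rot_def x(1))
      also have "\<dots> \<longleftrightarrow> v \<in> set (L u) \<and> j < 4 \<or> v = u \<and> j < 4 \<and> j \<noteq> i"
        unfolding set_blk[OF x(3)] using m mL by auto
      also have "\<dots> \<longleftrightarrow> {x, (v, j)} \<in> edges H"
        unfolding x(1) edges_H using x(2,3) L_set[OF x(2)] by auto
      finally show ?thesis .
    qed
    then show ?thesis by auto
  qed
  ultimately show ?thesis by blast
qed

lemma div2_ends: "i < 4 \<Longrightarrow> (u, i) \<in> SA u (i div 2)" "i < 4 \<Longrightarrow> i div 2 < (2::nat)"
  by (auto simp: SA_iff)

lemma rot_face:
  assumes "x \<in> verts H" "(y, z) \<in> set (dl (rot x))"
  shows "\<exists>d\<in>D. nb d x y \<and> nb d x z"
proof -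
  obtain u i where x: "x = (u, i)" "u \<in> verts G" "i < 4" using assms unfolding verts_H by auto
  from assms(2) consider
      v where "v \<in> set (L u)" "(y, z) \<in> set (lc (blk u i v))"
    | v w where "(v, w) \<in> set (dl (L u))" "y = (v, rt u (i div 2) v)" "z = (w, lt u (i div 2) w)"
    unfolding x(1) rot_dl[OF x(2,3) L_nonempty[OF x(2)]] by auto
  then show ?thesis
  proof cases
    case 1
    have uv: "{u, v} \<in> edges G" using L_edge[OF x(2) 1(1)] .
    obtain j k where jk: "y = ph u v j" "z = ph u v k"
        "(j, k) \<in> set (lc (R (mt u v) i)) \<or> (k, j) \<in> set (lc (R (mt u v) i))"
      using 1(2) unfolding lc_blk by (auto split: if_splits)
    have xi: "x = ph u v i" using x by (simp add: ph_def)
    from jk(3) have "(\<exists>p\<in>set (pat (mt u v)). nbl p i j \<and> nbl p i k) \<or>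
      (i = 0 \<or> i = 3) \<and> (\<exists>s\<in>{0, 1}. j = 4 + 2 * s \<and> k = 5 + 2 * s \<or> j = 5 + 2 * s \<and> k = 4 + 2 * s)"
      using R_faces[OF x(3), of j k "mt u v"] R_faces[OF x(3), of k j "mt u v"] by blast
    then show ?thesis
    proof (elim disjE bexE conjE)
      fix p assume p: "p \<in> set (pat (mt u v))" "nbl p i j" "nbl p i k"
      have "nb (pin u v p) x y" unfolding nb_pin by (intro exI[of _ i] exI[of _ j]) (simp add: jk(1) xi p(2))
      moreover have "nb (pin u v p) x z" unfolding nb_pin by (intro exI[of _ i] exI[of _ k]) (simp add: jk(2) xi p(3))
      ultimately show ?thesis using pin_D[OF uv p(1)] by (intro bexI[of _ "pin u v p"]) simp_all
    next
      \<comment> \<open>The corner belongs to a slit at the neighbour v. Around v the vertex u has a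
        predecessor and a successor, hence two slit quadrilaterals. Their corners over u are
        \<open>lt\<close> and \<open>rt\<close>, that is 0 and 3 in some order, so one of them
        contains (u,i).\<close>
      have *: ?thesis if s: "s < 2" "{y, z} \<subseteq> SA v s" and i: "i = 0 \<or> i = 3" for s
      proof -
        have v: "v \<in> verts G" "u \<in> set (L v)" using edgeD[OF uv] by auto
        obtain a w where aw: "(a, u) \<in> set (dl (L v))" "(u, w) \<in> set (dl (L v))"
          using dl_left[OF v(2)] dl_right[OF v(2)] by blast
        have "(u, i) \<in> SB v s a u \<or> (u, i) \<in> SB v s u w" using lt_rt(4)[OF i, of v s u] unfolding SB_def by auto
        then show ?thesis
        proof
          assume "(u, i) \<in> SB v s a u"
          then show ?thesis using slit_D[OF v(1) s(1) aw(1)] s(2) x(1)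
            by (intro bexI[of _ "slit v s a u"]) (simp_all add: nb_slit)
        next
          assume "(u, i) \<in> SB v s u w"
          then show ?thesis using slit_D[OF v(1) s(1) aw(2)] s(2) x(1)
            by (intro bexI[of _ "slit v s u w"]) (simp_all add: nb_slit)
        qed
      qed
      {
        fix s :: nat assume "s \<in> {0, 1}" "j = 4 + 2 * s" "k = 5 + 2 * s" "i = 0"
        then show ?thesis using *[of s] by (auto simp: jk SA_def ph_def)
      next
        fix s :: nat assume "s \<in> {0, 1}" "j = 5 + 2 * s" "k = 4 + 2 * s" "i = 0"
        then show ?thesis using *[of s] by (auto simp: jk SA_def ph_def)
      next
        fix s :: nat assume "s \<in> {0, 1}" "j = 4 + 2 * s" "k = 5 + 2 * s" "i = 3"
        then show ?thesis using *[of s] by (auto simp: jk SA_def ph_def)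
      next
        fix s :: nat assume "s \<in> {0, 1}" "j = 5 + 2 * s" "k = 4 + 2 * s" "i = 3"
        then show ?thesis using *[of s] by (auto simp: jk SA_def ph_def)
      }
    qed
  next
    case 2
    have "slit u (i div 2) v w \<in> D" using slit_D[OF x(2) div2_ends(2)[OF x(3)] 2(1)] .
    moreover have "y \<in> SB u (i div 2) v w" "z \<in> SB u (i div 2) v w" using 2 by (auto simp: SB_def)
    ultimately show ?thesis using div2_ends(1)[OF x(3), of u] x(1)
      by (intro bexI[of _ "slit u (i div 2) v w"]) (simp_all add: nb_slit)
  qed
qed

text \<open>A pattern corner is consecutive inside a block by \<open>pat_corner\<close>. At a
  diagonal corner of a slit quadrilateral the pair joins two blocks, and at an outer corner it is
  the pair of \<open>R_slit\<close> inside one block.\<close>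

lemma corner_rot:
  assumes "d \<in> D" "nb d x y" "nb d x z" "y \<noteq> z"
  shows "(y, z) \<in> set (dl (rot x)) \<or> (z, y) \<in> set (dl (rot x))"
proof -
  obtain u i where x: "x = (u, i)" by (cases x)
  have block: ?thesis if "u \<in> verts G" "i < 4" "v \<in> set (L u)" "y = ph u v j" "z = ph u v k"
      "(j, k) \<in> set (lc (R (mt u v) i)) \<or> (k, j) \<in> set (lc (R (mt u v) i))" for v j k
  proof -
    have "(y, z) \<in> set (lc (blk u i v)) \<or> (z, y) \<in> set (lc (blk u i v))"
      unfolding lc_blk that(4,5) using that(6) by (cases "tw u (i div 2) v") (simp_all, blast+)
    then show ?thesis unfolding x rot_dl[OF that(1,2) L_nonempty[OF that(1)]] using that(3) by blast
  qed
  show ?thesis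
    using assms(1)
  proof (cases rule: D_cases)
    case (1 u' v' p')
    obtain v p where p: "{u, v} \<in> edges G" "p \<in> set (pat (mt u v))" "d = pin u v p" "u \<noteq> v"
      using pin_locate[OF 1(2,3)] assms(2) unfolding 1(1) x by metis
    obtain j where j: "nbl p i j" "y = ph u v j" "i < 4" using nb_pin_at[OF p(4)] assms(2) unfolding p(3) x by blast
    obtain k where k: "nbl p i k" "z = ph u v k" using nb_pin_at[OF p(4)] assms(3) unfolding p(3) x by blast
    have "j \<noteq> k" using j k assms(4) by auto
    from pat_corner[OF p(2) j(3,1) k(1) this] show ?thesis
      using edgeD[OF p(1)] by (intro block[of v j k] j k) auto
  next
    case (2 a s v w)
    from assms(2) consider "x \<in> SA a s" "y \<in> SB a s v w" | "x \<in> SB a s v w" "y \<in> SA a s"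
      unfolding 2(1) nb_slit by blast
    then show ?thesis
    proof cases
      case A: 1
      then have "z \<in> SB a s v w" using assms(3) dl_L(3,4)[OF 2(2,4)] unfolding 2(1) nb_slit SA_def SB_def by auto
      then have yz: "(y = (v, rt a s v) \<and> z = (w, lt a s w)) \<or> (z = (v, rt a s v) \<and> y = (w, lt a s w))"
        using A(2) assms(4) unfolding SB_def by auto
      have ui: "u = a" "i div 2 = s" "i < 4" using A(1) 2(3) unfolding x SA_iff by auto
      have "((v, rt a s v), (w, lt a s w)) \<in> set (dl (rot x))"
        unfolding x ui(1) rot_dl[OF 2(2) ui(3) L_nonempty[OF 2(2)]] ui(2) using 2(4) by force
      then show ?thesis using yz by blast
    next
      case B: 2
      then have "z \<in> SA a s" using assms(3) dl_L(3,4)[OF 2(2,4)] unfolding 2(1) nb_slit SA_def SB_def by auto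
      then have yz: "(y = (a, 2 * s) \<and> z = (a, 2 * s + 1)) \<or> (z = (a, 2 * s) \<and> y = (a, 2 * s + 1))"
        using B(2) assms(4) unfolding SA_def by auto
      have "u = v \<or> u = w" "i = 0 \<or> i = 3" using B(1) lt_rt(2)[of a s w] lt_rt(3)[of a s v] unfolding x SB_def by auto
      then have ui: "{a, u} \<in> edges G" "i = 0 \<or> i = 3" "i < 4" using dl_L(1,2)[OF 2(2,4)] by auto
      note u = edgeD(3,5)[OF ui(1)]
      have ph: "ph u a (4 + 2 * s) = (a, 2 * s)" "ph u a (5 + 2 * s) = (a, 2 * s + 1)" by (simp_all add: ph_def)
      note r = R_slit[OF ui(2) 2(3), of "mt u a"]
      from yz show ?thesis
      proof
        assume "y = (a, 2 * s) \<and> z = (a, 2 * s + 1)"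
        then show ?thesis using r ph by (intro block[of a "4 + 2 * s" "5 + 2 * s"] u ui) auto
      next
        assume "z = (a, 2 * s) \<and> y = (a, 2 * s + 1)"
        then show ?thesis using r ph by (intro block[of a "5 + 2 * s" "4 + 2 * s"] u ui) auto
      qed
    qed
  qed
qed

end

section \<open>Edges common to two quadrilaterals\<close>

lemma nbl_dart: "nbl q i j \<Longrightarrow> \<exists>e\<in>set (dl q). e = (i, j) \<or> e = (j, i)"
  unfolding nbl_def by (elim disjE) (rule bexI[of _ "(i, j)"], simp, assumption, rule bexI[of _ "(j, i)"], simp, assumption)

lemma nbl_sym: "nbl q i j \<longleftrightarrow> nbl q j i"
  unfolding nbl_def by (rule disj_commute)

text \<open>The quadrilaterals of \<open>P4\<close> use only edges between the two ends.\<close>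

lemma nbl_low:
  assumes "q \<in> set (pat m)" "nbl q i j" "i < 4" "j < 4"
  shows m
proof -
  obtain e where e: "e \<in> set (dl q)" "e = (i, j) \<or> e = (j, i)" using nbl_dart[OF assms(2)] by (elim bexE)
  have "case e of (i, j) \<Rightarrow> i \<noteq> j \<and> (m \<or> (i < 4) \<noteq> (j < 4))" using pat_basic(4)[OF assms(1)] e(1) by (rule bspec)
  then show ?thesis using e(2) assms(3,4) by (elim disjE) simp_all
qed

lemma pat_slit_nbl:
  assumes "q \<in> set (pat m)" "s < 2" "nbl q i j" "sle s i j" "nbl q k l" "sle s k l"
  shows "{i, j} = {k, l}"
proof -
  obtain e where e: "e \<in> set (dl q)" "e = (i, j) \<or> e = (j, i)" using nbl_dart[OF assms(3)] by (elim bexE)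
  obtain e' where e': "e' \<in> set (dl q)" "e' = (k, l) \<or> e' = (l, k)" using nbl_dart[OF assms(5)] by (elim bexE)
  have "e = e'"
    by (rule pat_slit[OF assms(1,2) e(1) _ e'(1)]) (use e(2) e'(2) assms(4,6) in auto)
  then show ?thesis using e(2) e'(2) by (elim disjE) (simp_all add: insert_commute)
qed

lemma pat_share_nbl:
  assumes "q \<in> set (pat m)" "q' \<in> set (pat m)" "q \<noteq> q'" "nbl q i j" "nbl q' i j" "nbl q k l" "nbl q' k l"
  shows "{i, j} = {k, l}"
proof -
  obtain e where e: "e \<in> set (dl q)" "e = (i, j) \<or> e = (j, i)" using nbl_dart[OF assms(4)] by (elim bexE)
  obtain e' where e': "e' \<in> set (dl q)" "e' = (k, l) \<or> e' = (l, k)" using nbl_dart[OF assms(6)] by (elim bexE)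
  have "nbl q' j i" "nbl q' l k" using assms(5,7) nbl_sym by blast+
  then have "nbl q' (fst e) (snd e)" "nbl q' (fst e') (snd e')" using e(2) e'(2) assms(5,7) by (elim disjE; simp)+
  then have "e = e'" using pat_share[OF assms(1-3) e(1) _ e'(1)] by (simp only:)
  then show ?thesis using e(2) e'(2) by (elim disjE) (simp_all add: insert_commute)
qed

lemma pat_dart_unique:
  assumes "p \<in> set (pat m)" "p' \<in> set (pat m)" "e \<in> set (dl p)" "e \<in> set (dl p')"
  shows "p = p'"
proof -
  have "distinct (concat (map dl (pat m)))" using pat_darts[of m] by (simp only: map_append concat_append distinct_append)
  then have "dl p = dl p'" using assms unfolding distinct_concat_iff by auto
  moreover have "map fst (dl p) = p" "map fst (dl p') = p'"
    using in_dlD[of "fst e" "snd e" p] in_dlD[of "fst e" "snd e" p'] assms(3,4) by (simp_all add: dl_def)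
  ultimately show ?thesis by metis
qed

lemma pat_dart_slit:
  assumes "p \<in> set (pat m)" "e \<in> set (dl p)" "s < 2"
  shows "e \<notin> {(2 * s, 4), (4, 2 * s + 1), (2 * s + 1, 7), (7, 2 * s)}"
proof
  assume e: "e \<in> {(2 * s, 4), (4, 2 * s + 1), (2 * s + 1, 7), (7, 2 * s)}"
  have "s = 0 \<or> s = 1" using assms(3) by auto
  then have "e \<in> set (concat (map dl slp))" using e by (elim disjE) (auto simp: slp_def dl_def)
  moreover have "e \<in> set (concat (map dl (pat m)))" using assms(1,2) by auto
  moreover have "set (concat (map dl (pat m))) \<inter> set (concat (map dl slp)) = {}"
    using pat_darts[of m] by (simp only: map_append concat_append distinct_append)
  ultimately show False by blast
qed

context blowup begin

text \<open>An edge between two copies determines the edge of G below it. An edge inside one copy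
  occurs only in the pattern of the mate, which is unique.\<close>

lemma share_pin_pin:
  assumes "{a, b} \<in> edges G" "p \<in> set (pat (mt a b))" "{a', b'} \<in> edges G" "p' \<in> set (pat (mt a' b'))"
    and "nb (pin a b p) x y" "nb (pin a' b' p') x y"
  obtains u v q q' where "u \<noteq> v" "q \<in> set (pat (mt u v))" "q' \<in> set (pat (mt u v))"
    "pin a b p = pin u v q" "pin a' b' p' = pin u v q'"
proof -
  obtain u i where x: "x = (u, i)" by (cases x)
  obtain v q where q: "{u, v} \<in> edges G" "q \<in> set (pat (mt u v))" "pin a b p = pin u v q" "u \<noteq> v"
    using pin_locate[OF assms(1,2) assms(5)[unfolded x]] .
  obtain v' q' where q': "{u, v'} \<in> edges G" "q' \<in> set (pat (mt u v'))" "pin a' b' p' = pin u v' q'" "u \<noteq> v'"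
    using pin_locate[OF assms(3,4) assms(6)[unfolded x]] .
  obtain j where j: "nbl q i j" "y = ph u v j" "i < 4"
    using nb_pin_at[OF q(4) assms(5)[unfolded q(3) x]] by (elim exE conjE)
  obtain j' where j': "nbl q' i j'" "y = ph u v' j'"
    using nb_pin_at[OF q'(4) assms(6)[unfolded q'(3) x]] by (elim exE conjE)
  have eq: "ph u v j = ph u v' j'" using j(2) j'(2) by simp
  have "v = v'"
  proof (cases "j < 4")
    case True
    then have "j' < 4" using eq q'(4) by (cases "j' < 4") (simp_all add: ph_def)
    then have "mt u v'" using nbl_low[OF q'(2) j'(1) j(3)] by simp
    moreover have "mt u v" using nbl_low[OF q(2) j(1) j(3) True] .
    ultimately show ?thesis using mate_unique by simp
  next
    case False
    then show ?thesis using eq q(4) by (cases "j' < 4") (simp_all add: ph_def)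
  qed
  show ?thesis by (rule that[OF q(4,2) _ q(3)]) (use q'(2,3) \<open>v = v'\<close> in simp_all)
qed

lemma pin_slit_locate:
  assumes "{a', b'} \<in> edges G" "p' \<in> set (pat (mt a' b'))" "nb (pin a' b' p') x y" "nb (slit a s v w) x y"
  obtains b q where "a \<noteq> b" "q \<in> set (pat (mt a b))" "pin a' b' p' = pin a b q"
proof -
  from assms(4) consider "x \<in> SA a s" | "y \<in> SA a s" unfolding nb_slit by blast
  then obtain i z where "nb (pin a' b' p') (a, i) z"
  proof cases
    case 1
    then obtain i where "x = (a, i)" unfolding SA_def by auto
    then show ?thesis using that[of i y] assms(3) by simp
  next
    case 2
    then obtain i where "y = (a, i)" unfolding SA_def by auto
    then show ?thesis using that[of i x] assms(3) nb_sym[of "pin a' b' p'" x y] by simp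
  qed
  from pin_locate[OF assms(1,2) this] show ?thesis using that by metis
qed

text \<open>The outer corners of a slit quadrilateral have second coordinate 0 or 3 whatever the
  twists, so in the numbering of the pattern they are 4 or 7.\<close>

lemma pin_slit_at:
  assumes ab: "a \<noteq> b" and a: "a \<in> verts G" "(v, w) \<in> set (dl (L a))"
    and n: "nb (pin a b q) x y" "nb (slit a s v w) x y"
  shows "\<exists>i j. {x, y} = {ph a b i, ph a b j} \<and> nbl q i j \<and> sle s i j"
proof -
  have *: "\<exists>i j. {x, y} = {ph a b i, ph a b j} \<and> nbl q i j \<and> sle s i j"
    if h: "nb (pin a b q) x y" "x \<in> SA a s" "y \<in> SB a s v w" for x y
  proof -
    obtain i where x: "x = (a, i)" "i = 2 * s \<or> i = 2 * s + 1" using h(2) unfolding SA_def by auto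
    obtain j where j: "nbl q i j" "y = ph a b j" "i < 4"
      using nb_pin_at[OF ab h(1)[unfolded x(1)]] by (elim exE conjE)
    have y: "fst y \<noteq> a" "snd y = 0 \<or> snd y = 3"
      using h(3) dl_L(3,4)[OF a] lt_rt(2)[of a s w] lt_rt(3)[of a s v] unfolding SB_def by (elim insertE emptyE; simp)+
    have "\<not> j < 4" using y(1) j(2) by (auto simp: ph_def)
    then have "j = 4 \<or> j = 7" using y(2) j(2) by (auto simp: ph_def)
    then have "sle s i j" unfolding sle_def using x(2) by simp
    moreover have "x = ph a b i" using x(1) j(3) by (simp add: ph_def)
    ultimately show ?thesis using j(1,2) by (intro exI[of _ i] exI[of _ j]) simp
  qed
  from n(2) consider "x \<in> SA a s" "y \<in> SB a s v w" | "x \<in> SB a s v w" "y \<in> SA a s" unfolding nb_slit by blast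
  then show ?thesis
  proof cases
    case 1 then show ?thesis by (rule *[OF n(1)])
  next
    case 2
    have "nb (pin a b q) y x" using n(1) nb_sym[of "pin a b q" x y] by simp
    from *[OF this 2(2,1)] show ?thesis by (simp only: insert_commute)
  qed
qed

lemma share_pin_slit:
  assumes "{a', b'} \<in> edges G" "p' \<in> set (pat (mt a' b'))"
    and a: "a \<in> verts G" "s < 2" "(v, w) \<in> set (dl (L a))"
    and "nb (pin a' b' p') x y" "nb (slit a s v w) x y" "nb (pin a' b' p') x' y'" "nb (slit a s v w) x' y'"
  shows "{x, y} = {x', y'}"
proof -
  obtain b q where b: "a \<noteq> b" "q \<in> set (pat (mt a b))" "pin a' b' p' = pin a b q"
    using pin_slit_locate[OF assms(1,2,6,7)] .
  obtain i j where 1: "{x, y} = {ph a b i, ph a b j}" "nbl q i j" "sle s i j"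
    using pin_slit_at[OF b(1) a(1,3) assms(6)[unfolded b(3)] assms(7)] by (elim exE conjE)
  obtain k l where 2: "{x', y'} = {ph a b k, ph a b l}" "nbl q k l" "sle s k l"
    using pin_slit_at[OF b(1) a(1,3) assms(8)[unfolded b(3)] assms(9)] by (elim exE conjE)
  have "ph a b ` {i, j} = ph a b ` {k, l}" using pat_slit_nbl[OF b(2) a(2) 1(2,3) 2(2,3)] by (simp only:)
  then show ?thesis unfolding 1(1) 2(1) by simp
qed

text \<open>If the common edge has its diagonal corner at the same end for both, then vertex and
  slit agree, and so do the neighbours because \<open>L a\<close> is distinct. Otherwise each end is
  a diagonal corner for one and an outer corner for the other, which leaves only one possible
  edge.\<close>

lemma share_slit_slit:
  assumes a: "a \<in> verts G" "s < 2" "(v, w) \<in> set (dl (L a))"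
    and a': "a' \<in> verts G" "s' < 2" "(v', w') \<in> set (dl (L a'))"
    and n: "nb (slit a s v w) x y" "nb (slit a' s' v' w') x y"
  shows "slit a s v w = slit a' s' v' w' \<or> {x, y} = {(a, 3 * s), (a', 3 * s')}"
proof -
  have *: "slit a s v w = slit a' s' v' w' \<or> {x, y} = {(a, 3 * s), (a', 3 * s')}"
    if h: "x \<in> SA a s" "y \<in> SB a s v w"
      and n': "x \<in> SA a' s' \<and> y \<in> SB a' s' v' w' \<or> x \<in> SB a' s' v' w' \<and> y \<in> SA a' s'" for x y
    using n'
  proof (elim disjE conjE)
    assume k: "x \<in> SA a' s'" "y \<in> SB a' s' v' w'"
    obtain u i where x: "x = (u, i)" by (cases x)
    have eq: "a' = a" "s' = s" using h(1) k(1) unfolding x SA_iff by auto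
    note f = dl_functional[OF L_distinct[OF a(1)] a(3) a'(3)[unfolded eq]]
    have "v = v' \<or> w = w'"
      using h(2) k(2) lt_rt(1) unfolding SB_def eq by (elim insertE emptyE) (simp_all, metis+)
    then have "v = v'" "w = w'" using f by blast+
    then show ?thesis using eq by simp
  next
    assume k: "x \<in> SB a' s' v' w'" "y \<in> SA a' s'"
    obtain i j where x: "x = (a, i)" "i = 2 * s \<or> i = 2 * s + 1" and y: "y = (a', j)" "j = 2 * s' \<or> j = 2 * s' + 1"
      using h(1) k(2) unfolding SA_def by auto
    have ij: "i = 0 \<or> i = 3" "j = 0 \<or> j = 3"
      using k(1) h(2) lt_rt(2)[of a' s' w'] lt_rt(3)[of a' s' v'] lt_rt(2)[of a s w] lt_rt(3)[of a s v]
      unfolding SB_def x(1) y(1) by auto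
    have s01: "s = 0 \<or> s = 1" "s' = 0 \<or> s' = 1" using a(2) a'(2) by auto
    \<comment> \<open>A diagonal corner has index 2s or 2s + 1, an outer one 0 or 3; for s < 2 the
      common value is 3s.\<close>
    have "i = 3 * s" using ij(1) x(2) s01(1) by (elim disjE) simp_all
    moreover have "j = 3 * s'" using ij(2) y(2) s01(2) by (elim disjE) simp_all
    ultimately show ?thesis using x(1) y(1) by simp
  qed
  have n2: "x \<in> SA a' s' \<and> y \<in> SB a' s' v' w' \<or> x \<in> SB a' s' v' w' \<and> y \<in> SA a' s'"
    "y \<in> SA a' s' \<and> x \<in> SB a' s' v' w' \<or> y \<in> SB a' s' v' w' \<and> x \<in> SA a' s'"
    using n(2) unfolding nb_slit by blast+
  from n(1) consider "x \<in> SA a s" "y \<in> SB a s v w" | "x \<in> SB a s v w" "y \<in> SA a s" unfolding nb_slit by blast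
  then show ?thesis
  proof cases
    case 1 then show ?thesis by (rule *[OF _ _ n2(1)])
  next
    case 2
    have "{y, x} = {x, y}" by (rule insert_commute)
    then show ?thesis using *[OF 2(2,1) n2(2)] by (simp only:)
  qed
qed

lemma share_D:
  assumes "d \<in> D" "d' \<in> D" "nb d x y" "nb d' x y" "nb d x' y'" "nb d' x' y'" "{x, y} \<noteq> {x', y'}"
  shows "d = d'"
  using assms(1)
proof (cases rule: D_cases)
  case p: (1 a b p)
  show ?thesis
    using assms(2)
  proof (cases rule: D_cases)
    case p': (1 a' b' p')
    obtain u v q q' where q: "u \<noteq> v" "q \<in> set (pat (mt u v))" "q' \<in> set (pat (mt u v))" "d = pin u v q" "d' = pin u v q'"
      using share_pin_pin[OF p(2,3) p'(2,3) assms(3)[unfolded p(1)] assms(4)[unfolded p'(1)]] unfolding p(1) p'(1) .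
    have both: "\<exists>i j. nbl q i j \<and> nbl q' i j \<and> x = ph u v i \<and> y = ph u v j" if n: "nb d x y" "nb d' x y" for x y
    proof -
      obtain i j where ij: "nbl q i j" "x = ph u v i" "y = ph u v j" using n(1) unfolding q(4) nb_pin by blast
      obtain i' j' where ij': "nbl q' i' j'" "x = ph u v i'" "y = ph u v j'" using n(2) unfolding q(5) nb_pin by blast
      have "i' = i" "j' = j" using ij(2,3) ij'(2,3) ph_inj[OF q(1)] by metis+
      then show ?thesis using ij ij'(1) by blast
    qed
    obtain i j where 1: "nbl q i j" "nbl q' i j" "x = ph u v i" "y = ph u v j"
      using both[OF assms(3,4)] by (elim exE conjE)
    obtain k l where 2: "nbl q k l" "nbl q' k l" "x' = ph u v k" "y' = ph u v l"
      using both[OF assms(5,6)] by (elim exE conjE)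
    have "q = q'"
    proof (rule ccontr)
      assume "q \<noteq> q'"
      from pat_share_nbl[OF q(2,3) this 1(1,2) 2(1,2)] have "ph u v ` {i, j} = ph u v ` {k, l}" by (simp only:)
      then show False using assms(7) 1(3,4) 2(3,4) by simp
    qed
    then show ?thesis using q(4,5) by simp
  next
    case s: (2 a s v w)
    show ?thesis
      using share_pin_slit[OF p(2,3) s(2-4) assms(3)[unfolded p(1)] assms(4)[unfolded s(1)]
        assms(5)[unfolded p(1)] assms(6)[unfolded s(1)]] assms(7) by simp
  qed
next
  case s: (2 a s v w)
  show ?thesis
    using assms(2)
  proof (cases rule: D_cases)
    case p: (1 a' b' p')
    show ?thesis
      using share_pin_slit[OF p(2,3) s(2-4) assms(4)[unfolded p(1)] assms(3)[unfolded s(1)]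
        assms(6)[unfolded p(1)] assms(5)[unfolded s(1)]] assms(7) by simp
  next
    case s': (2 a' s' v' w')
    show ?thesis
      using share_slit_slit[OF s(2-4) s'(2-4) assms(3)[unfolded s(1)] assms(4)[unfolded s'(1)]]
        share_slit_slit[OF s(2-4) s'(2-4) assms(5)[unfolded s(1)] assms(6)[unfolded s'(1)]] assms(7)
      unfolding s(1) s'(1) by metis
  qed
qed

lemma quad_system_D: "quad_system H (und ` D)"
proof (rule quad_systemI[OF simple_H, where rot = rot])
  fix d assume "d \<in> D"
  from D_cycle[OF this] obtain vs where vs: "distinct vs" "length vs = 4" "d = set (dl vs)" "\<forall>(x, y)\<in>d. {x, y} \<in> edges H"
    by (elim exE conjE)
  have "vs \<noteq> []" using vs(2) by auto
  then have u: "und d = cycle_edges vs" unfolding vs(3) by (rule und_dl)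
  have "und d \<subseteq> edges H" unfolding und_def using vs(4) by (intro image_subsetI) (simp add: case_prod_unfold)
  then show "\<exists>vs. cycle_in H vs \<and> length vs = 4 \<and> und d = cycle_edges vs"
    using u vs(1,2) by (intro exI[of _ vs]) (simp add: cycle_in_def)
next
  fix d d' x y x' y'
  assume "d \<in> D" "d' \<in> D" "nb d x y" "nb d' x y" "nb d x' y'" "nb d' x' y'" "{x, y} \<noteq> {x', y'}"
  from share_D[OF this] show "und d = und d'" by simp
qed (fact rot_basic rot_face corner_rot)+

text \<open>Without twists the slit quadrilaterals keep the directions of the removed ones, so by
  \<open>pat_darts\<close> no dart occurs in two different quadrilaterals.\<close>

lemma flag_sign_untwisted:
  assumes tw: "\<And>a s v. \<not> tw a s v"
  shows "\<exists>\<sigma>. flag_sign (und ` D) \<sigma>"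
proof (rule flag_sign_darts)
  fix d assume "d \<in> D"
  from D_cycle[OF this] show "\<exists>vs. distinct vs \<and> length vs = 4 \<and> d = set (dl vs)" by (elim exE conjE) (intro exI conjI)
next
  have lr: "lt a s v = 0" "rt a s v = 3" for a s v using tw by (simp_all add: lt_def rt_def)
  have pin_slit: False
    if h: "{a', b'} \<in> edges G" "p' \<in> set (pat (mt a' b'))" "a \<in> verts G" "s < 2" "(v, w) \<in> set (dl (L a))"
      "(x, y) \<in> pin a' b' p'" "(x, y) \<in> slit a s v w" for a' b' p' a s v w x y
  proof -
    have "nb (pin a' b' p') x y" "nb (slit a s v w) x y" using h(6,7) unfolding nb_def by simp_all
    then obtain b q where b: "a \<noteq> b" "q \<in> set (pat (mt a b))" "pin a' b' p' = pin a b q"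
      using pin_slit_locate[OF h(1,2)] by metis
    obtain i j where ij: "(i, j) \<in> set (dl q)" "x = ph a b i" "y = ph a b j" using h(6) unfolding b(3) in_pin by blast
    have e: "a \<noteq> v" "a \<noteq> w" using dl_L(3,4)[OF h(3,5)] .
    have p1: "k = c" if "(a, c) = ph a b k" for k c using that b(1) by (cases "k < 4") (simp_all add: ph_def)
    have p2: "k = c + 4" if "(z, c) = ph a b k" "a \<noteq> z" for k c z using that by (cases "k < 4") (simp_all add: ph_def)
    \<comment> \<open>In the numbering of the pattern, the darts of a slit quadrilateral are darts
      of the quadrilaterals removed at slit s.\<close>
    from h(7) have "(i, j) \<in> {(2 * s, 4), (4, 2 * s + 1), (2 * s + 1, 7), (7, 2 * s)}"
      unfolding slit_darts lr
    proof (elim insertE emptyE)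
      assume "(x, y) = ((a, 2 * s), (w, 0))"
      then show ?thesis using p1[of "2 * s" i] p2[of w 0 j] e ij(2,3) by simp
    next
      assume "(x, y) = ((w, 0), (a, 2 * s + 1))"
      then show ?thesis using p1[of "2 * s + 1" j] p2[of w 0 i] e ij(2,3) by simp
    next
      assume "(x, y) = ((a, 2 * s + 1), (v, 3))"
      then show ?thesis using p1[of "2 * s + 1" i] p2[of v 3 j] e ij(2,3) by simp
    next
      assume "(x, y) = ((v, 3), (a, 2 * s))"
      then show ?thesis using p1[of "2 * s" j] p2[of v 3 i] e ij(2,3) by simp
    qed
    then show False using pat_dart_slit[OF b(2) ij(1) h(4)] by (rule notE[rotated])
  qed
  fix d d' x y assume d: "d \<in> D" "d' \<in> D" and xy: "(x, y) \<in> d" "(x, y) \<in> d'"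
  have n: "nb d x y" "nb d' x y" using xy unfolding nb_def by simp_all
  from d(1) show "und d = und d'"
  proof (cases rule: D_cases)
    case p: (1 a b p)
    from d(2) show ?thesis
    proof (cases rule: D_cases)
      case p': (1 a' b' p')
      obtain u v q q' where q: "u \<noteq> v" "q \<in> set (pat (mt u v))" "q' \<in> set (pat (mt u v))" "d = pin u v q" "d' = pin u v q'"
        using share_pin_pin[OF p(2,3) p'(2,3) n(1)[unfolded p(1)] n(2)[unfolded p'(1)]] unfolding p(1) p'(1) .
      obtain i j where ij: "(i, j) \<in> set (dl q)" "x = ph u v i" "y = ph u v j" using xy(1) unfolding q(4) in_pin by blast
      obtain i' j' where ij': "(i', j') \<in> set (dl q')" "x = ph u v i'" "y = ph u v j'" using xy(2) unfolding q(5) in_pin by blast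
      have "i' = i" "j' = j" using ij(2,3) ij'(2,3) ph_inj[OF q(1)] by metis+
      then have "q = q'" using pat_dart_unique[OF q(2,3) ij(1)] ij'(1) by simp
      then show ?thesis using q(4,5) by simp
    next
      case s: (2 a s v w)
      show ?thesis using pin_slit[OF p(2,3) s(2-4)] xy unfolding p(1) s(1) by blast
    qed
  next
    case s: (2 a s v w)
    from d(2) show ?thesis
    proof (cases rule: D_cases)
      case p: (1 a' b' p')
      show ?thesis using pin_slit[OF p(2,3) s(2-4)] xy unfolding p(1) s(1) by blast
    next
      case s': (2 a' s' v' w')
      note e = dl_L(3,4)[OF s(2,4)] and e' = dl_L(3,4)[OF s'(2,4)]
      \<comment> \<open>Two slit quadrilaterals with this common edge run through it in opposite
        directions; the four values of s and s' are checked one by one.\<close>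
      have "\<not> {x, y} = {(a, 3 * s), (a', 3 * s')}" if "d \<noteq> d'"
      proof
        assume eq: "{x, y} = {(a, 3 * s), (a', 3 * s')}"
        have s01: "s = 0 \<or> s = 1" "s' = 0 \<or> s' = 1" using s(3) s'(3) by auto
        from eq have "(x = (a, 3 * s) \<and> y = (a', 3 * s')) \<or> (x = (a', 3 * s') \<and> y = (a, 3 * s))"
          by (simp only: doubleton_eq_iff)
        then show False
          using xy e e' s01 unfolding s(1) s'(1) slit_darts lr by (elim disjE) simp_all
      qed
      then show ?thesis
        using share_slit_slit[OF s(2-4) s'(2-4) n(1)[unfolded s(1)] n(2)[unfolded s'(1)]] unfolding s(1) s'(1) by metis
    qed
  qed
qed

end

section \<open>Propagation of signs and the nonorientable case\<close>

definition quad_sign :: "('b \<Rightarrow> 'b set \<Rightarrow> 'b set set \<Rightarrow> bool) \<Rightarrow> ('b \<times> 'b) set \<Rightarrow> bool \<Rightarrow> bool" where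
  "quad_sign \<sigma> d X \<longleftrightarrow> (\<forall>(x, y)\<in>d. \<sigma> x {x, y} (und d) = X \<and> \<sigma> y {x, y} (und d) = (\<not> X))"

text \<open>From the tail of a dart to the tail of the next one there are two flag moves, a change
  of vertex and a change of edge, so the sign is restored.\<close>

lemma quad_sign_ex:
  assumes fs: "flag_sign Q \<sigma>" and f: "und d \<in> Q" and d: "d = {(a, b), (b, c), (c, e), (e, a)}"
    and ne: "distinct [a, b, c, e]"
  shows "\<exists>X. quad_sign \<sigma> d X"
proof -
  let ?f = "und d"
  have in_f: "{a, b} \<in> ?f" "{b, c} \<in> ?f" "{c, e} \<in> ?f" "{e, a} \<in> ?f" unfolding d und_def by simp_all
  have V: "\<sigma> y {x, y} ?f = (\<not> \<sigma> x {x, y} ?f)" if h: "{x, y} \<in> ?f" "x \<noteq> y" for x y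
    by (rule flag_sign_V[OF fs f h(1)]) (use h in auto)
  have E: "\<sigma> y {y, z} ?f = (\<not> \<sigma> y {x, y} ?f)" if h: "{x, y} \<in> ?f" "{y, z} \<in> ?f" "x \<noteq> z" for x y z
    by (rule flag_sign_E[OF fs f h(1)]) (use h in \<open>auto simp: doubleton_eq_iff\<close>)
  have "a \<noteq> b" "b \<noteq> c" "c \<noteq> e" "e \<noteq> a" "a \<noteq> c" "b \<noteq> e" using ne by auto
  note s = V[OF in_f(1) this(1)] E[OF in_f(1,2) this(5)] V[OF in_f(2) this(2)] E[OF in_f(2,3) this(6)]
    V[OF in_f(3) this(3)] E[OF in_f(3,4) this(5)[symmetric]] V[OF in_f(4) this(4)]
  have "\<forall>(x, y)\<in>{(a, b), (b, c), (c, e), (e, a)}. \<sigma> x {x, y} ?f = \<sigma> a {a, b} ?f \<and> \<sigma> y {x, y} ?f = (\<not> \<sigma> a {a, b} ?f)"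
    using s by (simp only: ball_simps case_prod_conv) blast
  then have "quad_sign \<sigma> d (\<sigma> a {a, b} ?f)" unfolding quad_sign_def d[symmetric] .
  then show ?thesis by (rule exI)
qed

text \<open>Crossing an edge flips the sign of the flag at a fixed vertex. If the two quadrilaterals
  use the edge in opposite directions, that vertex is a tail for one and a head for the other, a
  second flip; in equal directions there is only one flip.\<close>

lemma quad_sign_share:
  assumes fs: "flag_sign Q \<sigma>" and f: "und d \<in> Q" "und d' \<in> Q" "und d \<noteq> und d'"
    and s: "quad_sign \<sigma> d X" "quad_sign \<sigma> d' X'" and e: "(x, y) \<in> d"
  shows "(y, x) \<in> d' \<Longrightarrow> X = X'" "(x, y) \<in> d' \<Longrightarrow> X' = (\<not> X)"
proof -
  have F: "\<sigma> x {x, y} (und d') = (\<not> \<sigma> x {x, y} (und d))" if "nb d' x y"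
  proof -
    have "{x, y} \<in> und d" "{x, y} \<in> und d'" using e that unfolding und_iff nb_def by simp_all
    then show ?thesis by (intro flag_sign_F[OF fs f(1)]) (use f in auto)
  qed
  have X: "\<sigma> x {x, y} (und d) = X" using s(1) e unfolding quad_sign_def by fast
  show "X = X'" if h: "(y, x) \<in> d'"
  proof -
    have "\<sigma> x {y, x} (und d') = (\<not> X')" using s(2) h unfolding quad_sign_def by fast
    moreover have "{y, x} = {x, y}" by (rule insert_commute)
    moreover have "nb d' x y" using h unfolding nb_def by simp
    ultimately show ?thesis using F X by simp
  qed
  show "X' = (\<not> X)" if h: "(x, y) \<in> d'"
  proof -
    have "\<sigma> x {x, y} (und d') = X'" using s(2) h unfolding quad_sign_def by fast
    moreover have "nb d' x y" using h unfolding nb_def by simp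
    ultimately show ?thesis using F X by simp
  qed
qed

lemma und_neq: "nb d x y \<Longrightarrow> \<not> nb d' x y \<Longrightarrow> und d \<noteq> und d'"
  using und_iff by metis

context blowup begin

text \<open>The signs of six quadrilaterals around the twisted slit would have to be propagated along a
  closed chain in which exactly one shared edge is traversed twice in the same direction.\<close>

lemma no_flag_sign_twisted:
  assumes tw: "\<And>a s v. tw a s v \<longleftrightarrow> a = u \<and> s = 1 \<and> v = m"
    and u: "u \<in> verts G" and m: "mt u m" and mw: "(m, w) \<in> set (dl (L u))" "m \<noteq> w"
  shows "\<not> flag_sign (und ` D) \<sigma>"
proof
  assume fs: "flag_sign (und ` D) \<sigma>"
  note uE = dl_L[OF u mw(1)]
  \<comment> \<open>The neighbour following the mate is not matched with u, so its pattern is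
    \<open>P4\<close>, from which \<open>J\<close> is taken.\<close>
  have nw: "\<not> mt u w" using mate_unique[OF m] mw(2) by blast
  have ne: "u \<noteq> m" "u \<noteq> w" "m \<noteq> u" "w \<noteq> u" "m \<noteq> w" "w \<noteq> m" using uE(3,4) mw(2) by auto
  \<comment> \<open>\<open>A0\<close> and \<open>A1\<close> are the quadrilaterals at the two slits
    of u between the blocks of m and w. They are connected through the pattern of m by
    \<open>I1\<close>, \<open>I2\<close>, \<open>I3\<close> and through the pattern of w by
    \<open>J\<close>. The twist gives \<open>A1\<close> the corner (m,0) in place of (m,3).\<close>
  define A0 A1 I1 I2 I3 J where defs: "A0 = slit u 0 m w" "A1 = slit u 1 m w"
    "I1 = pin u m [1,6,5,7]" "I2 = pin u m [0,2,6,1]" "I3 = pin u m [0,6,4,2]" "J = pin u w [1,4,2,6]"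
  have D: "A0 \<in> D" "A1 \<in> D" "I1 \<in> D" "I2 \<in> D" "I3 \<in> D" "J \<in> D"
    unfolding defs using m nw by (intro slit_D pin_D u mw(1) uE(1,2); simp add: pat_def P8_def P4_def)+
  have e: "A0 = {((u, 0), (w, 0)), ((w, 0), (u, 1)), ((u, 1), (m, 3)), ((m, 3), (u, 0))}"
    "A1 = {((u, 2), (w, 0)), ((w, 0), (u, 3)), ((u, 3), (m, 0)), ((m, 0), (u, 2))}"
    "I1 = {((u, 1), (m, 2)), ((m, 2), (m, 1)), ((m, 1), (m, 3)), ((m, 3), (u, 1))}"
    "I2 = {((u, 0), (u, 2)), ((u, 2), (m, 2)), ((m, 2), (u, 1)), ((u, 1), (u, 0))}"
    "I3 = {((u, 0), (m, 2)), ((m, 2), (m, 0)), ((m, 0), (u, 2)), ((u, 2), (u, 0))}"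
    "J = {((u, 1), (w, 0)), ((w, 0), (u, 2)), ((u, 2), (w, 2)), ((w, 2), (u, 1))}"
    unfolding defs using ne by (simp_all add: slit_darts lt_def rt_def tw pin_def dl_def ph_def)
  note Q = D[THEN imageI, of und]
  obtain X0 where X0: "quad_sign \<sigma> A0 X0" using quad_sign_ex[OF fs Q(1) e(1)] ne by auto
  obtain X4 where X4: "quad_sign \<sigma> A1 X4" using quad_sign_ex[OF fs Q(2) e(2)] ne by auto
  obtain X1 where X1: "quad_sign \<sigma> I1 X1" using quad_sign_ex[OF fs Q(3) e(3)] ne by auto
  obtain X2 where X2: "quad_sign \<sigma> I2 X2" using quad_sign_ex[OF fs Q(4) e(4)] ne by auto
  obtain X3 where X3: "quad_sign \<sigma> I3 X3" using quad_sign_ex[OF fs Q(5) e(5)] ne by auto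
  obtain X5 where X5: "quad_sign \<sigma> J X5" using quad_sign_ex[OF fs Q(6) e(6)] ne by auto
  have n1: "und A0 \<noteq> und I1" by (rule und_neq[of _ "(u, 0)" "(w, 0)"]) (use ne in \<open>simp_all add: nb_def e\<close>)
  have n2: "und I1 \<noteq> und I2" by (rule und_neq[of _ "(m, 2)" "(m, 1)"]) (use ne in \<open>simp_all add: nb_def e\<close>)
  have n3: "und I2 \<noteq> und I3" by (rule und_neq[of _ "(u, 2)" "(m, 2)"]) (use ne in \<open>simp_all add: nb_def e\<close>)
  have n4: "und I3 \<noteq> und A1" by (rule und_neq[of _ "(u, 0)" "(m, 2)"]) (use ne in \<open>simp_all add: nb_def e\<close>)
  have n5: "und A1 \<noteq> und J" by (rule und_neq[of _ "(w, 0)" "(u, 3)"]) (use ne in \<open>simp_all add: nb_def e\<close>)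
  have n6: "und J \<noteq> und A0" by (rule und_neq[of _ "(u, 2)" "(w, 2)"]) (use ne in \<open>simp_all add: nb_def e\<close>)
  have "X0 = X1" by (rule quad_sign_share(1)[OF fs Q(1,3) n1 X0 X1, of "(u, 1)" "(m, 3)"]) (simp_all add: e)
  moreover have "X1 = X2" by (rule quad_sign_share(1)[OF fs Q(3,4) n2 X1 X2, of "(u, 1)" "(m, 2)"]) (simp_all add: e)
  moreover have "X2 = X3" by (rule quad_sign_share(1)[OF fs Q(4,5) n3 X2 X3, of "(u, 0)" "(u, 2)"]) (simp_all add: e)
  \<comment> \<open>The one bad edge of the chain: \<open>I3\<close> and the twisted
    \<open>A1\<close> both run from (m,0) to (u,2).\<close>
  moreover have "X4 = (\<not> X3)" by (rule quad_sign_share(2)[OF fs Q(5,2) n4 X3 X4, of "(m, 0)" "(u, 2)"]) (simp_all add: e)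
  moreover have "X4 = X5" by (rule quad_sign_share(1)[OF fs Q(2,6) n5 X4 X5, of "(u, 2)" "(w, 0)"]) (simp_all add: e)
  moreover have "X5 = X0" by (rule quad_sign_share(1)[OF fs Q(6,1) n6 X5 X0, of "(u, 1)" "(w, 0)"]) (simp_all add: e)
  ultimately show False by blast
qed

end

theorem theorem1p5:
  fixes G :: "'v graph"
  assumes "simple_graph G"
    and "connected_graph G"
    and "\<exists>M. perfect_matching G M"
  shows "(\<exists>(X :: point topology) p a.
            cellular_embedding (lex_product G (complete_graph 4)) X p a \<and>
            quadrangular (lex_product G (complete_graph 4)) X p a \<and>
            face_simple (lex_product G (complete_graph 4)) X p a \<and>
            orientable X) \<and>
         ((\<exists>vs. cycle_in G vs) \<longrightarrow>
          (\<exists>(X :: point topology) p a.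
            cellular_embedding (lex_product G (complete_graph 4)) X p a \<and>
            quadrangular (lex_product G (complete_graph 4)) X p a \<and>
            face_simple (lex_product G (complete_graph 4)) X p a \<and>
            \<not> orientable X))"
proof -
  obtain M where "perfect_matching G M" using assms(3) by (elim exE)
  note pm = this[unfolded perfect_matching_def]
  note M = conjunct1[OF pm] bspec[OF conjunct2[OF pm]]
  have E: "\<exists>a\<in>verts G. \<exists>b\<in>verts G. a \<noteq> b \<and> e = {a, b}" if "e \<in> edges G" for e
    using assms(1)[unfolded simple_graph_def, THEN conjunct2] that by (rule bspec)
  have E2: "u \<in> verts G" "v \<in> verts G" "u \<noteq> v" if h: "{u, v} \<in> edges G" for u v
    using E[OF h] by (auto simp: doubleton_eq_iff)
  have mate: "\<exists>v. {u, v} \<in> M" if u: "u \<in> verts G" for u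
  proof -
    obtain e where e: "e \<in> M" "u \<in> e" using ex1_implies_ex[OF M(2)[OF u]] by (elim exE conjE)
    then have "e \<in> edges G" using M(1) by blast
    from E[OF this] obtain a b where ab: "e = {a, b}" by blast
    then have "u = a \<or> u = b" using e(2) by simp
    then show ?thesis
    proof
      assume "u = a" then show ?thesis using e(1) ab by (intro exI[of _ b]) simp
    next
      assume "u = b" then show ?thesis using e(1) ab by (intro exI[of _ a]) (simp add: insert_commute)
    qed
  qed
  have mate_unique: "v = v'" if h: "{u, v} \<in> M" "{u, v'} \<in> M" for u v v'
  proof -
    have "u \<in> verts G" using E2(1)[of u v] M(1) h(1) by blast
    from M(2)[OF this] have "\<forall>e e'. (e \<in> M \<and> u \<in> e) \<and> (e' \<in> M \<and> u \<in> e') \<longrightarrow> e = e'"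
      unfolding Ex1_def by metis
    then have "{u, v} = {u, v'}" using h by simp
    then show ?thesis by (auto simp: doubleton_eq_iff)
  qed
  have "\<forall>u. \<exists>l. distinct l \<and> set l = {v. {u, v} \<in> edges G}"
  proof
    fix u
    have "{v. {u, v} \<in> edges G} \<subseteq> verts G" using E2(2)[of u] by auto
    moreover have "finite (verts G)" using assms(1) unfolding simple_graph_def by (rule conjunct1)
    ultimately have "finite {v. {u, v} \<in> edges G}" by (rule finite_subset)
    from finite_distinct_list[OF this] show "\<exists>l. distinct l \<and> set l = {v. {u, v} \<in> edges G}"
      by (simp add: conj_commute)
  qed
  from choice[OF this] obtain L where L0: "\<forall>u. distinct (L u) \<and> set (L u) = {v. {u, v} \<in> edges G}" by (elim exE)
  have L: "distinct (L u)" "set (L u) = {v. {u, v} \<in> edges G}" for u using L0 by simp_all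
  have b: "blowup G M L"
  proof (rule blowup.intro)
    show "\<exists>v. {u, v} \<in> M" if "u \<in> verts G" for u using that by (rule mate)
    show "v = v'" if "{u, v} \<in> M" "{u, v'} \<in> M" for u v v' using that by (rule mate_unique)
  qed (fact assms(1) assms(2) M(1) | rule L)+
  \<comment> \<open>The construction works for every choice of twists; only the existence of flag
    signs depends on \<open>tw\<close>.\<close>
  have emb: "\<exists>(X :: point topology) p a. cellular_embedding (lex_product G (complete_graph 4)) X p a \<and>
      quadrangular (lex_product G (complete_graph 4)) X p a \<and> face_simple (lex_product G (complete_graph 4)) X p a \<and>
      (orientable X \<longleftrightarrow> (\<exists>\<sigma>. flag_sign (und ` blowup.D G M L tw) \<sigma>))" for tw
    by (rule quad_system_embedding[OF blowup.simple_H[OF b] blowup.connected_H[OF b] blowup.quad_system_D[OF b]])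
  have fs: "\<exists>\<sigma>. flag_sign (und ` blowup.D G M L (\<lambda>_ _ _. False)) \<sigma>"
    by (rule blowup.flag_sign_untwisted[OF b]) simp
  have tw: "\<exists>tw. \<nexists>\<sigma>. flag_sign (und ` blowup.D G M L tw) \<sigma>" if cyc: "cycle_in G vs" for vs
  proof -
    have vs: "3 \<le> length vs" "distinct vs" "cycle_edges vs \<subseteq> edges G" using cyc unfolding cycle_in_def by auto
    obtain x r1 where 1: "vs = x # r1" using vs(1) by (cases vs) auto
    obtain u r2 where 2: "r1 = u # r2" using vs(1) 1 by (cases r1) auto
    obtain y r where 3: "r2 = y # r" using vs(1) 1 2 by (cases r2) auto
    note xs = 1[unfolded 2 3]
    have "cycle_edges vs = und (set (dl vs))" using und_dl[of vs] xs by simp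
    then have "{x, u} \<in> cycle_edges vs" "{u, y} \<in> cycle_edges vs"
      by (simp_all add: und_iff nb_def dl_def xs)
    then have xy: "{u, x} \<in> edges G" "{u, y} \<in> edges G" using vs(3) by (auto simp: insert_commute)
    have uV: "u \<in> verts G" using E2(1)[OF xy(1)] .
    obtain m where m: "{u, m} \<in> M" using mate[OF uV] by blast
    have "{u, m} \<in> edges G" by (rule subsetD[OF M(1) m])
    then have "m \<in> set (L u)" unfolding L(2) by (rule CollectI)
    from dl_left[OF this] obtain w where w: "(m, w) \<in> set (dl (L u))" by (elim exE)
    \<comment> \<open>The two neighbours of u on the cycle make \<open>L u\<close> at least two
      entries long, so the cyclic successor of the mate is a different vertex.\<close>
    have "m \<noteq> w"
    proof
      assume mw: "m = w"
      have xyL: "x \<in> set (L u)" "y \<in> set (L u)" unfolding L(2) using xy by simp_all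
      have xny: "x \<noteq> y" using vs(2) unfolding xs by auto
      have Lne: "L u \<noteq> []" using xyL(1) by auto
      obtain i where i: "i < length (L u)" "m = L u ! i" "w = L u ! (Suc i mod length (L u))"
        using w Lne by (rule in_dlE)
      have l: "1 < length (L u)"
      proof (rule ccontr)
        assume "\<not> ?thesis"
        then have "length (L u) = 0 \<or> length (L u) = 1" by linarith
        then show False using xyL xny by (auto simp: length_Suc_conv)
      qed
      then have lt: "Suc i mod length (L u) < length (L u)" by (intro mod_less_divisor) linarith
      have "L u ! i = L u ! (Suc i mod length (L u))" by (rule trans[OF i(2)[symmetric] trans[OF mw i(3)]])
      then have eq: "i = Suc i mod length (L u)" by (rule nth_eq_iff_index_eq[OF L(1) i(1) lt, THEN iffD1])
      have "Suc i mod length (L u) \<noteq> i"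
      proof (cases "Suc i = length (L u)")
        case True
        then have "Suc i mod length (L u) = 0" by simp
        then show ?thesis using True l by linarith
      next
        case False
        then have "Suc i < length (L u)" using i(1) by linarith
        then have "Suc i mod length (L u) = Suc i" by (rule mod_less)
        then show ?thesis by linarith
      qed
      then show False using eq[symmetric] by (rule notE)
    qed
    then have "\<not> flag_sign (und ` blowup.D G M L (\<lambda>a s v. a = u \<and> s = 1 \<and> v = m)) \<sigma>" for \<sigma>
      by (intro blowup.no_flag_sign_twisted[OF b _ uV m w]) simp_all
    then show ?thesis by (intro exI[of _ "\<lambda>a s v. a = u \<and> s = 1 \<and> v = m"]) simp
  qed
  let ?H = "lex_product G (complete_graph 4)"
  show ?thesis
  proof (intro conjI impI)
    from emb[where tw = "\<lambda>_ _ _. False"] obtain X :: "point topology" and p a where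
        "cellular_embedding ?H X p a \<and> quadrangular ?H X p a \<and> face_simple ?H X p a \<and>
          (orientable X \<longleftrightarrow> (\<exists>\<sigma>. flag_sign (und ` blowup.D G M L (\<lambda>_ _ _. False)) \<sigma>))"
        by (elim exE)
    then show "\<exists>(X :: point topology) p a. cellular_embedding ?H X p a \<and> quadrangular ?H X p a \<and>
        face_simple ?H X p a \<and> orientable X"
      using fs by (intro exI[of _ X] exI[of _ p] exI[of _ a]) simp
  next
    assume "\<exists>vs. cycle_in G vs"
    then obtain vs where "cycle_in G vs" by (elim exE)
    from tw[OF this] obtain tw where tw: "\<nexists>\<sigma>. flag_sign (und ` blowup.D G M L tw) \<sigma>" by (elim exE)
    from emb[where tw = "tw"] obtain X :: "point topology" and p a where
        "cellular_embedding ?H X p a \<and> quadrangular ?H X p a \<and> face_simple ?H X p a \<and>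
          (orientable X \<longleftrightarrow> (\<exists>\<sigma>. flag_sign (und ` blowup.D G M L (tw)) \<sigma>))"
        by (elim exE)
    then show "\<exists>(X :: point topology) p a. cellular_embedding ?H X p a \<and> quadrangular ?H X p a \<and>
        face_simple ?H X p a \<and> \<not> orientable X"
      using tw by (intro exI[of _ X] exI[of _ p] exI[of _ a]) simp
  qed
qed

end
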